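(* Let $\Omega\subset\mathbb R^d$ be a connected bounded open set with $0\in\Omega$, let $p\in(1,d]$, and let $\varepsilon_k>0$ with $\varepsilon_k\to0$. For $u\in W^{1,p}_0(\Omega)$ define $$F_k(u)=\frac{1}{|B_{\varepsilon_k}|}\int_\Omega\int_{B_{\varepsilon_k}}|u(x)-u(y)|^p\,dy\,dx+\int_\Omega|\nabla u(x)|^p\,dx .$$ Then $F_k$ $\Gamma$-converges, with respect to weak convergence in $W^{1,p}_0(\Omega)$, to the functional $$F(u)=\int_\Omega|u(x)-m_p(u)|^p\,dx+\int_\Omega|\nabla u(x)|^p\,dx,\qquad u\in W^{1,p}_0(\Omega).$$
   Context: $B_r$ is the open ball of centre $0$ and radius $r$, $|\cdot|$ is Lebesgue measure. For $u\in L^p(\Omega)$, $m_p(u)$ is the unique minimum point of $t\mapsto\int_\Omega|u(x)-t|^p\,dx$. $\Gamma$-convergence is in the usual sequential sense for weak convergence in $W^{1,p}_0(\Omega)$. *)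

theory Defs
  imports "HOL-Analysis.Analysis"
begin

coinductive smooth_fun :: "('a::euclidean_space \<Rightarrow> real) \<Rightarrow> bool" where
  "(\<forall>x. f differentiable (at x)) \<Longrightarrow>
   (\<forall>v. smooth_fun (\<lambda>x. frechet_derivative f (at x) v)) \<Longrightarrow> smooth_fun f"

definition test_fun :: "'a::euclidean_space set \<Rightarrow> ('a \<Rightarrow> real) \<Rightarrow> bool" where
  "test_fun \<Omega> \<phi> \<longleftrightarrow> smooth_fun \<phi> \<and> compact (closure {x. \<phi> x \<noteq> 0})
      \<and> closure {x. \<phi> x \<noteq> 0} \<subseteq> \<Omega>"

definition Lp_fun :: "real \<Rightarrow> 'a::euclidean_space set \<Rightarrow> ('a \<Rightarrow> real) \<Rightarrow> bool" where
  "Lp_fun p \<Omega> u \<longleftrightarrow> u \<in> borel_measurable lebesgue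
      \<and> integrable lebesgue (\<lambda>x. indicator \<Omega> x * \<bar>u x\<bar> powr p)"

definition Lp_vec :: "real \<Rightarrow> 'a::euclidean_space set \<Rightarrow> ('a \<Rightarrow> 'a) \<Rightarrow> bool" where
  "Lp_vec p \<Omega> G \<longleftrightarrow> G \<in> borel_measurable lebesgue
      \<and> integrable lebesgue (\<lambda>x. indicator \<Omega> x * norm (G x) powr p)"

definition weak_grad :: "'a::euclidean_space set \<Rightarrow> ('a \<Rightarrow> real) \<Rightarrow> ('a \<Rightarrow> 'a) \<Rightarrow> bool" where
  "weak_grad \<Omega> u G \<longleftrightarrow> (\<forall>\<phi>. test_fun \<Omega> \<phi> \<longrightarrow> (\<forall>i\<in>Basis.
      (\<integral>x. indicator \<Omega> x * (u x * frechet_derivative \<phi> (at x) i) \<partial>lebesgue)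
      = - (\<integral>x. indicator \<Omega> x * ((G x \<bullet> i) * \<phi> x) \<partial>lebesgue)))"

definition W1p :: "real \<Rightarrow> 'a::euclidean_space set \<Rightarrow> ('a \<Rightarrow> real) \<Rightarrow> bool" where
  "W1p p \<Omega> u \<longleftrightarrow> Lp_fun p \<Omega> u \<and> (\<exists>G. Lp_vec p \<Omega> G \<and> weak_grad \<Omega> u G)"

text \<open>The (a.e. unique) weak gradient.\<close>
definition wgrad :: "real \<Rightarrow> 'a::euclidean_space set \<Rightarrow> ('a \<Rightarrow> real) \<Rightarrow> 'a \<Rightarrow> 'a" where
  "wgrad p \<Omega> u = (SOME G. Lp_vec p \<Omega> G \<and> weak_grad \<Omega> u G)"

definition W1p_norm :: "real \<Rightarrow> 'a::euclidean_space set \<Rightarrow> ('a \<Rightarrow> real) \<Rightarrow> real" where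
  "W1p_norm p \<Omega> u = ((\<integral>x. indicator \<Omega> x * \<bar>u x\<bar> powr p \<partial>lebesgue)
      + (\<integral>x. indicator \<Omega> x * norm (wgrad p \<Omega> u x) powr p \<partial>lebesgue)) powr (1 / p)"

definition W1p0 :: "real \<Rightarrow> 'a::euclidean_space set \<Rightarrow> ('a \<Rightarrow> real) set" where
  "W1p0 p \<Omega> = {u. W1p p \<Omega> u \<and> (\<forall>x. x \<notin> \<Omega> \<longrightarrow> u x = 0) \<and>
      (\<exists>\<phi>s. (\<forall>n. test_fun \<Omega> (\<phi>s n)) \<and>
         (\<lambda>n. W1p_norm p \<Omega> (\<lambda>x. \<phi>s n x - u x)) \<longlonglongrightarrow> 0)}"

definition W1p0_dual :: "real \<Rightarrow> 'a::euclidean_space set \<Rightarrow> (('a \<Rightarrow> real) \<Rightarrow> real) \<Rightarrow> bool" where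
  "W1p0_dual p \<Omega> L \<longleftrightarrow>
     (\<forall>u\<in>W1p0 p \<Omega>. \<forall>v\<in>W1p0 p \<Omega>. \<forall>a b. L (\<lambda>x. a * u x + b * v x) = a * L u + b * L v)
     \<and> (\<exists>C. \<forall>u\<in>W1p0 p \<Omega>. \<bar>L u\<bar> \<le> C * W1p_norm p \<Omega> u)"

definition weak_conv_W1p0 :: "real \<Rightarrow> 'a::euclidean_space set \<Rightarrow> (nat \<Rightarrow> 'a \<Rightarrow> real) \<Rightarrow> ('a \<Rightarrow> real) \<Rightarrow> bool" where
  "weak_conv_W1p0 p \<Omega> us u \<longleftrightarrow>
     (\<forall>L. W1p0_dual p \<Omega> L \<longrightarrow> (\<lambda>k. L (us k)) \<longlonglongrightarrow> L u)"

definition Gamma_conv :: "'b set \<Rightarrow> ((nat \<Rightarrow> 'b) \<Rightarrow> 'b \<Rightarrow> bool)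
    \<Rightarrow> (nat \<Rightarrow> 'b \<Rightarrow> ennreal) \<Rightarrow> ('b \<Rightarrow> ennreal) \<Rightarrow> bool" where
  "Gamma_conv X conv Fk F \<longleftrightarrow>
     (\<forall>u\<in>X. \<forall>us. (\<forall>k. us k \<in> X) \<and> conv us u \<longrightarrow> F u \<le> liminf (\<lambda>k. Fk k (us k)))
   \<and> (\<forall>u\<in>X. \<exists>us. (\<forall>k. us k \<in> X) \<and> conv us u \<and> limsup (\<lambda>k. Fk k (us k)) \<le> F u)"

definition m_p :: "real \<Rightarrow> 'a::euclidean_space set \<Rightarrow> ('a \<Rightarrow> real) \<Rightarrow> real" where
  "m_p p \<Omega> u = (THE t. \<forall>s.
      (\<integral>x. indicator \<Omega> x * \<bar>u x - t\<bar> powr p \<partial>lebesgue)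
      \<le> (\<integral>x. indicator \<Omega> x * \<bar>u x - s\<bar> powr p \<partial>lebesgue))"

definition F_eps :: "real \<Rightarrow> 'a::euclidean_space set \<Rightarrow> real \<Rightarrow> ('a \<Rightarrow> real) \<Rightarrow> ennreal" where
  "F_eps p \<Omega> \<epsilon> u =
     ennreal (1 / measure lebesgue (ball (0::'a) \<epsilon>)) *
       (\<integral>\<^sup>+ x. (\<integral>\<^sup>+ y. ennreal (\<bar>u x - u y\<bar> powr p) * indicator (ball 0 \<epsilon>) y \<partial>lebesgue)
                 * indicator \<Omega> x \<partial>lebesgue)
     + (\<integral>\<^sup>+ x. ennreal (norm (wgrad p \<Omega> u x) powr p) * indicator \<Omega> x \<partial>lebesgue)"

definition F_lim :: "real \<Rightarrow> 'a::euclidean_space set \<Rightarrow> ('a \<Rightarrow> real) \<Rightarrow> ennreal" where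
  "F_lim p \<Omega> u =
     (\<integral>\<^sup>+ x. ennreal (\<bar>u x - m_p p \<Omega> u\<bar> powr p) * indicator \<Omega> x \<partial>lebesgue)
     + (\<integral>\<^sup>+ x. ennreal (norm (wgrad p \<Omega> u x) powr p) * indicator \<Omega> x \<partial>lebesgue)"

end

theory Submission
  imports Defs
begin

text \<open>
  Lower bound: \<open>a \<mapsto> norm a powr p\<close> is convex with gradient \<open>powr_grad p\<close>, and the optimality of
  the p-mean \<open>m\<close> of \<open>u\<close> says that \<open>powr_grad p (u - m)\<close> has integral zero. Hence for every real \<open>t\<close>
  the integral of \<open>\<bar>v - t\<bar> powr p\<close> lies above an affine function of \<open>v\<close> which does not depend on
  \<open>t\<close>. Inserting \<open>t = v y\<close> and averaging over \<open>y\<close> shows that all functionals of the sequence lie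
  above the same affine functional, which is weakly continuous and touches the limit functional at
  \<open>u\<close>. No compact embedding is needed.

  Upper bound: because \<open>p \<le> DIM('a)\<close>, the origin has zero p-capacity, so test functions that equal
  \<open>m\<close> on \<open>ball 0 (\<epsilon> k)\<close> approximate \<open>u\<close> strongly. On such a function the nonlocal term is exactly the
  integral of \<open>\<bar>v - m\<bar> powr p\<close>.
\<close>

subsection \<open>Smooth functions\<close>

text \<open>For p <= d a function in W^{1,p} has no value at the origin that weak convergence could
  control: its values on small balls can be changed at vanishing cost in energy. The value on
  \<open>ball 0 (\<epsilon> k)\<close> can therefore be chosen freely, the p-mean is the best
  choice, and the limit is a minimum over constants. That minimum is convex in v, being the partial
  minimum of a jointly convex function, which is why a supporting affine functional at u exists.
  Zero capacity is delicate at p = d: the gradient energy of one cutoff at scale r is of order r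
  powr (d - p), which does not vanish there. Averaging N cutoffs on separated scales gains the
  factor N powr (1 - p), which tends to 0 because p > 1. This dictates the order of choices: first
  N, for the gradient, then the radius, depending on N, for the function itself. Since
  \<open>m_p\<close> is a definite description, existence and uniqueness of the minimum point have
  to be proved before its optimality can be used.\<close>

primrec differentiable_times :: "nat \<Rightarrow> ('a::euclidean_space \<Rightarrow> real) \<Rightarrow> bool" where
  "differentiable_times 0 f \<longleftrightarrow> True"
| "differentiable_times (Suc n) f \<longleftrightarrow> (\<forall>x. f differentiable (at x)) \<and>
     (\<forall>v. differentiable_times n (\<lambda>x. frechet_derivative f (at x) v))"

text \<open>A direct coinduction for products does not close, because the derivative of a product is
  a sum of products. Induction on the order of differentiability can use every closure property at
  the lower order, so the coinductive predicate is cut into finite stages.\<close>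

lemma smooth_fun_iff_differentiable_times: "smooth_fun f \<longleftrightarrow> (\<forall>n. differentiable_times n f)"
proof
  assume "smooth_fun f"
  then show "\<forall>n. differentiable_times n f"
  proof (intro allI)
    fix n show "differentiable_times n f" using \<open>smooth_fun f\<close>
    proof (induction n arbitrary: f)
      case (Suc n)
      from Suc.prems show ?case
        by (cases rule: smooth_fun.cases) (use Suc.IH in auto)
    qed simp
  qed
next
  assume "\<forall>n. differentiable_times n f"
  then show "smooth_fun f"
  proof (coinduction arbitrary: f)
    case smooth_fun
    have "\<forall>x. f differentiable at x"
      using smooth_fun[rule_format, of "Suc 0"] by simp
    moreover have "differentiable_times n (\<lambda>x. frechet_derivative f (at x) v)" for n v
      using smooth_fun[rule_format, of "Suc n"] by simp
    ultimately show ?case by auto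
  qed
qed

lemma differentiable_times_Suc_imp: "differentiable_times (Suc n) f \<Longrightarrow> differentiable_times n f"
proof (induction n arbitrary: f)
  case (Suc n)
  then show ?case by (metis differentiable_times.simps(2))
qed simp

lemma frechet_derivative_eqI:
  "(f has_derivative D) (at x) \<Longrightarrow> frechet_derivative f (at x) = D"
  using frechet_derivative_at by metis

lemma differentiable_times_const: "differentiable_times n (\<lambda>x. c)"
proof (induction n arbitrary: c)
  case (Suc n)
  have "frechet_derivative (\<lambda>x. c) (at x) = (\<lambda>v. 0)" for x :: 'a
    by (rule frechet_derivative_eqI) simp
  then show ?case using Suc by simp
qed simp

lemma differentiable_times_add:
  "differentiable_times n f \<Longrightarrow> differentiable_times n g \<Longrightarrow> differentiable_times n (\<lambda>x. f x + g x)"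
proof (induction n arbitrary: f g)
  case (Suc n)
  have "frechet_derivative (\<lambda>x. f x + g x) (at x) =
      (\<lambda>v. frechet_derivative f (at x) v + frechet_derivative g (at x) v)" for x
    using Suc.prems
    by (intro frechet_derivative_eqI has_derivative_add) (auto simp: frechet_derivative_works)
  then show ?case using Suc by simp
qed simp

lemma differentiable_times_mult:
  "differentiable_times n f \<Longrightarrow> differentiable_times n g \<Longrightarrow> differentiable_times n (\<lambda>x. f x * g x)"
proof (induction n arbitrary: f g)
  case (Suc n)
  have "frechet_derivative (\<lambda>x. f x * g x) (at x) =
      (\<lambda>v. f x * frechet_derivative g (at x) v + frechet_derivative f (at x) v * g x)" for x
    using Suc.prems
    by (intro frechet_derivative_eqI has_derivative_mult) (auto simp: frechet_derivative_works)
  moreover have "differentiable_times n f" "differentiable_times n g"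
    using Suc.prems differentiable_times_Suc_imp by blast+
  ultimately show ?case using Suc by (auto intro!: differentiable_times_add)
qed simp

lemma differentiable_times_inverse:
  "differentiable_times n f \<Longrightarrow> (\<And>x. f x \<noteq> 0) \<Longrightarrow> differentiable_times n (\<lambda>x. inverse (f x))"
proof (induction n arbitrary: f)
  case (Suc n)
  have "frechet_derivative (\<lambda>x. inverse (f x)) (at x) =
      (\<lambda>v. - (inverse (f x) * frechet_derivative f (at x) v * inverse (f x)))" for x
    using Suc.prems
    by (intro frechet_derivative_eqI Deriv.has_derivative_inverse) (auto simp: frechet_derivative_works)
  \<comment> \<open>The minus sign becomes a constant factor, so that closure under products and
    constants suffices.\<close>
  then have eq: "frechet_derivative (\<lambda>x. inverse (f x)) (at x) =
      (\<lambda>v. (-1) * (inverse (f x) * frechet_derivative f (at x) v * inverse (f x)))" for x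
    by simp
  have "differentiable_times n f"
    using Suc.prems differentiable_times_Suc_imp by blast
  then have "differentiable_times n (\<lambda>x. inverse (f x))" using Suc by blast
  then show ?case using Suc.prems unfolding differentiable_times.simps eq
    by (intro conjI allI differentiable_times_mult differentiable_times_const) auto
qed simp

lemma differentiable_times_compose:
  fixes h :: "real \<Rightarrow> real"
  shows "differentiable_times n h \<Longrightarrow> differentiable_times n g \<Longrightarrow> differentiable_times n (\<lambda>x. h (g x))"
proof (induction n arbitrary: h g)
  case (Suc n)
  have *: "frechet_derivative (\<lambda>x. h (g x)) (at x) =
      (\<lambda>v. frechet_derivative h (at (g x)) (frechet_derivative g (at x) v))" for x
  proof (rule frechet_derivative_eqI)
    have "(g has_derivative frechet_derivative g (at x)) (at x)"
      "(h has_derivative frechet_derivative h (at (g x))) (at (g x))"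
      using Suc.prems by (simp_all add: frechet_derivative_works[symmetric])
    then show "((\<lambda>x. h (g x)) has_derivative
        (\<lambda>v. frechet_derivative h (at (g x)) (frechet_derivative g (at x) v))) (at x)"
      by (rule has_derivative_compose)
  qed
  \<comment> \<open>A linear map on the real line is multiplication by its value at 1. The chain
    rule thus yields a product, and the induction hypothesis applies to the derivative of
    \<open>h\<close> composed with \<open>g\<close>.\<close>
  have lin: "frechet_derivative h (at y) t = t * frechet_derivative h (at y) 1" for y t
    using linear_scale[OF linear_frechet_derivative[of h "at y"], of t 1] Suc.prems by simp
  have eq: "frechet_derivative (\<lambda>x. h (g x)) (at x) =
      (\<lambda>v. frechet_derivative g (at x) v * frechet_derivative h (at (g x)) 1)" for x
    unfolding * by (rule ext) (rule lin)
  have "differentiable_times n g"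
    using Suc.prems differentiable_times_Suc_imp by blast
  then have "differentiable_times n (\<lambda>x. frechet_derivative h (at (g x)) 1)"
    using Suc.prems(1) Suc.IH[of "\<lambda>y. frechet_derivative h (at y) 1" g] by simp
  moreover have "(\<lambda>x. h (g x)) differentiable (at x)" for x
    using Suc.prems differentiable_chain_at[of g x h] by (simp add: comp_def)
  ultimately show ?case using Suc.prems unfolding differentiable_times.simps eq
    by (intro conjI allI differentiable_times_mult) auto
qed simp

lemma smooth_fun_differentiable: "smooth_fun f \<Longrightarrow> f differentiable (at x)"
  by (metis smooth_fun.cases)

lemma smooth_fun_frechet_derivative: "smooth_fun f \<Longrightarrow> smooth_fun (\<lambda>x. frechet_derivative f (at x) v)"
  by (metis smooth_fun.cases)

lemma smooth_fun_continuous_on: "smooth_fun f \<Longrightarrow> continuous_on A f"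
  by (simp add: differentiable_imp_continuous_within smooth_fun_differentiable
      continuous_at_imp_continuous_on)

lemma smooth_fun_const: "smooth_fun (\<lambda>x. c)"
  and smooth_fun_add: "smooth_fun f \<Longrightarrow> smooth_fun g \<Longrightarrow> smooth_fun (\<lambda>x. f x + g x)"
  and smooth_fun_mult: "smooth_fun f \<Longrightarrow> smooth_fun g \<Longrightarrow> smooth_fun (\<lambda>x. f x * g x)"
  and smooth_fun_inverse: "smooth_fun f \<Longrightarrow> (\<And>x. f x \<noteq> 0) \<Longrightarrow> smooth_fun (\<lambda>x. inverse (f x))"
  and smooth_fun_compose: "smooth_fun h \<Longrightarrow> smooth_fun f \<Longrightarrow> smooth_fun (\<lambda>x. h (f x))"
  for h :: "real \<Rightarrow> real"
  by (simp_all add: smooth_fun_iff_differentiable_times differentiable_times_const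
      differentiable_times_add differentiable_times_mult differentiable_times_inverse
      differentiable_times_compose)

lemma smooth_fun_divide:
  "smooth_fun f \<Longrightarrow> smooth_fun g \<Longrightarrow> (\<And>x. g x \<noteq> 0) \<Longrightarrow> smooth_fun (\<lambda>x. f x / g x)"
  unfolding divide_inverse by (intro smooth_fun_mult smooth_fun_inverse)

lemma smooth_fun_diff: "smooth_fun f \<Longrightarrow> smooth_fun g \<Longrightarrow> smooth_fun (\<lambda>x. f x - g x)"
  using smooth_fun_add[of f "\<lambda>x. (-1) * g x"] smooth_fun_mult[OF smooth_fun_const, of g "-1"] by simp

lemma smooth_fun_sum:
  "(\<And>i. i \<in> I \<Longrightarrow> smooth_fun (f i)) \<Longrightarrow> smooth_fun (\<lambda>x. \<Sum>i\<in>I. f i x)"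
  by (induction I rule: infinite_finite_induct) (auto intro: smooth_fun_const smooth_fun_add)

lemma smooth_fun_prod:
  "(\<And>i. i \<in> I \<Longrightarrow> smooth_fun (f i)) \<Longrightarrow> smooth_fun (\<lambda>x. \<Prod>i\<in>I. f i x)"
  by (induction I rule: infinite_finite_induct) (auto intro: smooth_fun_const smooth_fun_mult)

lemma smooth_fun_inner: "smooth_fun (\<lambda>x. x \<bullet> a)"
proof (subst smooth_fun.simps, intro exI conjI allI)
  show "(\<lambda>x. x \<bullet> a) = (\<lambda>x. x \<bullet> a)" ..
  fix v :: 'a
  have "frechet_derivative (\<lambda>x. x \<bullet> a) (at x) = (\<lambda>v. v \<bullet> a)" for x
    by (intro frechet_derivative_eqI bounded_linear_imp_has_derivative bounded_linear_inner_left)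
  then show "smooth_fun (\<lambda>x. frechet_derivative (\<lambda>x. x \<bullet> a) (at x) v)"
    by (simp add: smooth_fun_const)
qed auto

lemma smooth_fun_inner_self: "smooth_fun (\<lambda>x. x \<bullet> x)"
proof -
  have "(\<lambda>x::'a. x \<bullet> x) = (\<lambda>x. \<Sum>b\<in>Basis. (x \<bullet> b) * (x \<bullet> b))"
    by (rule ext) (rule euclidean_inner)
  then show ?thesis by (simp add: smooth_fun_sum smooth_fun_mult smooth_fun_inner)
qed

subsection \<open>Cutoff functions\<close>

lemma poly_exp_tendsto_0:
  fixes P :: "real poly"
  shows "((\<lambda>s. poly P s * exp (- s)) \<longlongrightarrow> 0) at_top"
proof -
  have "((\<lambda>s::real. s ^ k / exp s) \<longlongrightarrow> 0) at_top" for k :: nat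
    by (rule tendsto_power_div_exp_0)
  then have "((\<lambda>s. \<Sum>i\<le>degree P. coeff P i * (s ^ i / exp s)) \<longlongrightarrow> 0) at_top"
    by (intro tendsto_null_sum tendsto_mult_right_zero)
  then show ?thesis
    by (simp add: poly_altdef sum_distrib_right exp_minus divide_inverse mult.assoc)
qed

text \<open>The case P = 1 is the classical flat function exp (- 1 / t). The polynomial factor in 1
  / t is carried along because the family is then closed under differentiation, which is what
  coinduction needs.\<close>

definition flat_poly :: "real poly \<Rightarrow> real \<Rightarrow> real" where
  "flat_poly P t = (if t > 0 then poly P (1 / t) * exp (- (1 / t)) else 0)"

text \<open>Put s = 1 / t, so that ds/dt = - s^2. Differentiating P(s) exp (- s) gives s^2 (P -
  P')(s) exp (- s), and \<open>[:0, 0, 1:]\<close> is the polynomial s^2.\<close>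

lemma flat_poly_has_derivative:
  "(flat_poly P has_field_derivative flat_poly (([:0, 0, 1:]) * (P - pderiv P)) t) (at t)"
proof -
  consider "t > 0" | "t < 0" | "t = 0" by linarith
  then show ?thesis
  proof cases
    case 1
    have "((\<lambda>t. poly P (1 / t) * exp (- (1 / t))) has_field_derivative
        flat_poly (([:0, 0, 1:]) * (P - pderiv P)) t) (at t)"
      using 1 unfolding flat_poly_def
      by (auto intro!: derivative_eq_intros poly_DERIV[THEN DERIV_chain2]
          simp: field_simps power2_eq_square)
    then show ?thesis
      by (rule has_field_derivative_transform_within[where d = t])
        (use 1 in \<open>auto simp: flat_poly_def dist_real_def\<close>)
  next
    case 2
    have "((\<lambda>t. 0) has_field_derivative flat_poly (([:0, 0, 1:]) * (P - pderiv P)) t) (at t)"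
      using 2 unfolding flat_poly_def by auto
    then show ?thesis
      by (rule has_field_derivative_transform_within[where d = "-t"])
        (use 2 in \<open>auto simp: flat_poly_def dist_real_def\<close>)
  next
    case 3
    have "((\<lambda>y. flat_poly P y / y) \<longlongrightarrow> 0) (at_right 0)"
    proof -
      \<comment> \<open>The difference quotient at 0 has an additional factor 1 / y, which
        \<open>pCons 0\<close> absorbs into the polynomial.\<close>
      have "((\<lambda>s. poly (pCons 0 P) s * exp (- s)) \<longlongrightarrow> 0) at_top"
        by (rule poly_exp_tendsto_0)
      then have "((\<lambda>y. poly (pCons 0 P) (inverse y) * exp (- inverse y)) \<longlongrightarrow> 0) (at_right 0)"
        by (rule filterlim_compose) (rule filterlim_inverse_at_top_right)
      then show ?thesis
        by (rule Lim_transform_eventually)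
          (auto simp: flat_poly_def divide_inverse eventually_at_right_less
            intro!: eventually_mono[OF eventually_at_right_less])
    qed
    moreover have "((\<lambda>y. flat_poly P y / y) \<longlongrightarrow> 0) (at_left 0)"
      by (rule tendsto_eventually)
        (auto simp: flat_poly_def eventually_at_left_field intro!: exI[of _ "-1"])
    ultimately have "((\<lambda>y. flat_poly P y / y) \<longlongrightarrow> 0) (at 0)"
      by (simp add: filterlim_split_at)
    then show ?thesis
      using 3 by (simp add: has_field_derivative_iff flat_poly_def)
  qed
qed

lemma smooth_fun_flat_poly: "smooth_fun (flat_poly P)"
proof (coinduction arbitrary: P)
  case smooth_fun
  have D: "(flat_poly P has_derivative
      (\<lambda>v. v * flat_poly (([:0, 0, 1:]) * (P - pderiv P)) t)) (at t)" for t
  proof -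
    have "(\<lambda>v. v * flat_poly (([:0, 0, 1:]) * (P - pderiv P)) t) =
        (*) (flat_poly (([:0, 0, 1:]) * (P - pderiv P)) t)"
      by (rule ext) (rule mult.commute)
    then show ?thesis
      using flat_poly_has_derivative[of P t] unfolding has_field_derivative_def by metis
  qed
  \<comment> \<open>The direction \<open>v\<close> is absorbed into the polynomial, so directional
    derivatives stay in the family.\<close>
  have "(\<lambda>t. frechet_derivative (flat_poly P) (at t) v) =
      flat_poly (smult v (([:0, 0, 1:]) * (P - pderiv P)))" for v
    by (rule ext) (subst frechet_derivative_eqI[OF D], simp add: flat_poly_def)
  moreover have "flat_poly P differentiable at t" for t
    using D by (rule differentiableI)
  ultimately show ?case by blast
qed

definition flat :: "real \<Rightarrow> real" where
  "flat = flat_poly 1"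

lemma smooth_fun_flat: "smooth_fun flat"
  unfolding flat_def by (rule smooth_fun_flat_poly)

lemma flat_nonneg: "flat t \<ge> 0"
  and flat_pos_iff: "flat t > 0 \<longleftrightarrow> t > 0"
  and flat_eq_0_iff: "flat t = 0 \<longleftrightarrow> t \<le> 0"
  by (auto simp: flat_def flat_poly_def)

text \<open>The argument enters through \<open>x \<bullet> x\<close>, which unlike the norm is
  smooth at the origin; 1 and 4 are the squares of the radii between which the function falls from 1
  to 0. The two terms of the denominator are positive on overlapping ranges that cover
  everything.\<close>

definition cutoff :: "'a::euclidean_space \<Rightarrow> real" where
  "cutoff x = flat (4 - x \<bullet> x) / (flat (4 - x \<bullet> x) + flat (x \<bullet> x - 1))"

lemma cutoff_denom_pos: "flat (4 - x \<bullet> x) + flat (x \<bullet> x - 1) > 0"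
proof -
  have "4 - x \<bullet> x > 0 \<or> x \<bullet> x - 1 > 0" by argo
  then show ?thesis
    by (metis add_nonneg_pos add_pos_nonneg flat_nonneg flat_pos_iff)
qed

lemma smooth_fun_cutoff: "smooth_fun cutoff"
proof -
  have a: "smooth_fun (\<lambda>x::'a. flat (4 - x \<bullet> x))"
    by (rule smooth_fun_compose[OF smooth_fun_flat])
      (intro smooth_fun_diff smooth_fun_const smooth_fun_inner_self)
  have b: "smooth_fun (\<lambda>x::'a. flat (x \<bullet> x - 1))"
    by (rule smooth_fun_compose[OF smooth_fun_flat])
      (intro smooth_fun_diff smooth_fun_const smooth_fun_inner_self)
  show ?thesis
    unfolding cutoff_def[abs_def]
    by (intro smooth_fun_divide smooth_fun_add a b) (use cutoff_denom_pos less_irrefl in metis)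
qed

lemma cutoff_bounds: "0 \<le> cutoff x" "cutoff x \<le> 1"
  using cutoff_denom_pos[of x] flat_nonneg[of "4 - x \<bullet> x"] flat_nonneg[of "x \<bullet> x - 1"]
  by (auto simp: cutoff_def divide_le_eq_1)

lemma cutoff_eq_1: "norm x \<le> 1 \<Longrightarrow> cutoff x = 1"
proof -
  assume "norm x \<le> 1"
  then have "x \<bullet> x \<le> 1" by (simp add: dot_square_norm power_le_one)
  then have "flat (x \<bullet> x - 1) = 0" "flat (4 - x \<bullet> x) > 0"
    by (auto simp: flat_eq_0_iff flat_pos_iff)
  then show ?thesis by (simp add: cutoff_def)
qed

lemma cutoff_eq_0: "norm x \<ge> 2 \<Longrightarrow> cutoff x = 0"
proof -
  assume "norm x \<ge> 2"
  then have "x \<bullet> x \<ge> 4" using power_mono[of 2 "norm x" 2] by (simp add: dot_square_norm)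
  then show ?thesis by (simp add: cutoff_def flat_eq_0_iff)
qed

section \<open>Bumps on boxes\<close>

definition box_bump :: "'a::euclidean_space \<Rightarrow> 'a \<Rightarrow> 'a \<Rightarrow> real" where
  "box_bump a b x = (\<Prod>i\<in>Basis. flat ((x - a) \<bullet> i) * flat ((b - x) \<bullet> i))"

lemma smooth_fun_box_bump: "smooth_fun (box_bump a b)"
  unfolding box_bump_def[abs_def] inner_diff_left
  by (intro smooth_fun_prod smooth_fun_mult smooth_fun_compose[OF smooth_fun_flat]
      smooth_fun_diff smooth_fun_inner smooth_fun_const)

lemma box_bump_nonneg: "box_bump a b x \<ge> 0"
  by (simp add: box_bump_def flat_nonneg prod_nonneg)

lemma box_bump_eq_0_iff: "box_bump a b x = 0 \<longleftrightarrow> x \<notin> box a b"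
  by (force simp: box_bump_def flat_eq_0_iff mem_box inner_diff_left not_le)

text \<open>As \<open>e\<close> decreases to 0 these functions increase to the indicator of the open
  box, so that integrals over boxes are limits of integrals against test functions.\<close>

lemma test_fun_box_bump_ratio:
  assumes "cbox a b \<subseteq> \<Omega>" "e > 0"
  shows "test_fun \<Omega> (\<lambda>x. box_bump a b x / (box_bump a b x + e))"
proof -
  have pos: "box_bump a b x + e > 0" for x
    using assms box_bump_nonneg[of a b x] by linarith
  have "smooth_fun (\<lambda>x. box_bump a b x / (box_bump a b x + e))"
    by (intro smooth_fun_divide smooth_fun_add smooth_fun_box_bump smooth_fun_const)
      (use pos less_irrefl in metis)
  moreover have "{x. box_bump a b x / (box_bump a b x + e) \<noteq> 0} \<subseteq> cbox a b"
    using box_subset_cbox by (auto simp: box_bump_eq_0_iff)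
  then have "closure {x. box_bump a b x / (box_bump a b x + e) \<noteq> 0} \<subseteq> cbox a b"
    by (rule closure_minimal) (rule closed_cbox)
  ultimately show ?thesis
    unfolding test_fun_def using assms
    by (meson bounded_cbox bounded_subset closed_closure compact_eq_bounded_closed order_trans)
qed

subsection \<open>Powers of the norm\<close>

text \<open>The gradient of \<open>a \<mapsto> norm a powr p\<close>.\<close>
definition powr_grad :: "real \<Rightarrow> 'b::euclidean_space \<Rightarrow> 'b" where
  "powr_grad p a = (p * norm a powr (p - 1)) *\<^sub>R sgn a"

lemma Young_powr:
  fixes p \<alpha> \<beta> :: real
  assumes "p > 1" "\<alpha> \<ge> 0" "\<beta> \<ge> 0"
  shows "p * \<alpha> powr (p - 1) * \<beta> \<le> (p - 1) * \<alpha> powr p + \<beta> powr p"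
proof -
  have "\<beta> * \<alpha> powr (p - 1) \<le> \<beta> powr p / p + (\<alpha> powr (p - 1)) powr (p / (p - 1)) / (p / (p - 1))"
    using assms by (intro Youngs_inequality) (auto simp: field_simps)
  also have "(\<alpha> powr (p - 1)) powr (p / (p - 1)) = \<alpha> powr p"
    using assms by (simp add: powr_powr)
  finally show ?thesis using assms by (simp add: field_simps)
qed

lemma norm_powr_grad: "p > 1 \<Longrightarrow> norm (powr_grad p a) = p * norm a powr (p - 1)"
  by (simp add: powr_grad_def norm_sgn)

lemma powr_grad_inner_self: "p > 1 \<Longrightarrow> powr_grad p a \<bullet> a = p * norm a powr p"
proof -
  assume p: "p > 1"
  have "sgn a \<bullet> a = norm a"
    by (cases "a = 0") (simp_all add: sgn_div_norm dot_square_norm power2_eq_square)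
  moreover have "norm a powr (p - 1) * norm a = norm a powr p"
    by (cases "a = 0") (simp_all add: powr_diff)
  ultimately show ?thesis by (simp add: powr_grad_def mult.assoc)
qed

text \<open>Cauchy-Schwarz followed by Young's inequality. The right-hand side takes the role of
  Hoelder's inequality: it is an integrable majorant as soon as both arguments are
  p-integrable.\<close>

lemma abs_powr_grad_inner_le:
  assumes "p > 1"
  shows "\<bar>powr_grad p a \<bullet> b\<bar> \<le> (p - 1) * norm a powr p + norm b powr p"
proof -
  have "\<bar>powr_grad p a \<bullet> b\<bar> \<le> p * norm a powr (p - 1) * norm b"
    using Cauchy_Schwarz_ineq2[of "powr_grad p a" b] assms by (simp add: norm_powr_grad)
  then show ?thesis
    using Young_powr[OF assms, of "norm a" "norm b"] by simp
qed

text \<open>Convexity without second derivatives: pairing the gradient with \<open>a\<close> gives p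
  times \<open>norm a powr p\<close>, and what remains is exactly the Young bound for the pairing
  with \<open>b\<close>.\<close>

lemma norm_powr_ge_tangent:
  assumes "p > 1"
  shows "norm a powr p + powr_grad p a \<bullet> (b - a) \<le> norm b powr p"
  using abs_powr_grad_inner_le[OF assms, of a b] powr_grad_inner_self[OF assms, of a]
  by (simp add: inner_diff_right algebra_simps abs_le_iff)

text \<open>Convexity applied to a + b as the combination of a / (1 - l) and b / l with weights 1 -
  l and l. The coefficient of the first power tends to 1 as l tends to 0, so the inequality can
  replace Minkowski's when b is a small perturbation.\<close>

lemma norm_powr_add_le:
  fixes a b :: "'b::euclidean_space"
  assumes "p > 1" "0 < l" "l < 1"
  shows "norm (a + b) powr p \<le> (1 - l) powr (1 - p) * norm a powr p + l powr (1 - p) * norm b powr p"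
proof -
  define x y z where "x = a + b" and "y = a /\<^sub>R (1 - l)" and "z = b /\<^sub>R l"
  have x: "x = (1 - l) *\<^sub>R y + l *\<^sub>R z"
    using assms by (simp add: x_def y_def z_def)
  \<comment> \<open>Jensen's inequality: both tangents are taken at the combination
    \<open>x\<close>, so their linear terms cancel in the weighted sum.\<close>
  have "(1 - l) * (norm x powr p + powr_grad p x \<bullet> (y - x)) + l * (norm x powr p + powr_grad p x \<bullet> (z - x))
      \<le> (1 - l) * norm y powr p + l * norm z powr p"
    using assms by (intro add_mono mult_left_mono norm_powr_ge_tangent) auto
  moreover have "(1 - l) * (norm x powr p + powr_grad p x \<bullet> (y - x)) + l * (norm x powr p + powr_grad p x \<bullet> (z - x))
      = norm x powr p + powr_grad p x \<bullet> ((1 - l) *\<^sub>R y + l *\<^sub>R z - x)"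
    by (simp add: inner_diff_right inner_add_right algebra_simps)
  ultimately have "norm x powr p \<le> (1 - l) * norm y powr p + l * norm z powr p"
    using x by simp
  moreover have "(1 - l) * norm y powr p = (1 - l) powr (1 - p) * norm a powr p"
    using assms by (simp add: y_def powr_mult powr_diff powr_divide divide_simps inverse_eq_divide)
  moreover have "l * norm z powr p = l powr (1 - p) * norm b powr p"
    using assms by (simp add: z_def powr_mult powr_diff powr_divide divide_simps inverse_eq_divide)
  ultimately show ?thesis by (simp add: x_def)
qed

text \<open>At 0 the factor \<open>sgn\<close> is discontinuous, but the other factor tends to 0
  there because p > 1.\<close>

lemma tendsto_powr_grad:
  assumes "p > 1" "(f \<longlongrightarrow> a) F"
  shows "((\<lambda>x. powr_grad p (f x)) \<longlongrightarrow> powr_grad p a) F"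
proof (cases "a = 0")
  case True
  have "((\<lambda>x. p * norm (f x) powr (p - 1)) \<longlongrightarrow> p * 0 powr (p - 1)) F"
    using assms True
    by (intro tendsto_intros tendsto_powr') (auto intro: tendsto_norm_zero)
  then have "((\<lambda>x. norm (powr_grad p (f x))) \<longlongrightarrow> 0) F"
    using assms by (simp add: norm_powr_grad)
  then have "((\<lambda>x. powr_grad p (f x)) \<longlongrightarrow> 0) F"
    by (rule tendsto_norm_zero_cancel)
  then show ?thesis using True by (simp add: powr_grad_def)
next
  case False
  then show ?thesis unfolding powr_grad_def
    using assms by (intro tendsto_intros) auto
qed

lemma borel_measurable_powr_grad:
  assumes "p > 1"
  shows "powr_grad p \<in> borel_measurable borel"
proof (rule borel_measurable_continuous_onI)
  show "continuous_on UNIV (powr_grad p)"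
    unfolding continuous_on_def using tendsto_powr_grad[OF assms tendsto_ident_at] by auto
qed

text \<open>This is strict convexity in one variable, the source of the uniqueness of the
  p-mean.\<close>

lemma powr_grad_strict_mono:
  fixes a b :: real
  assumes "p > 1" "a < b"
  shows "powr_grad p a < powr_grad p b"
proof -
  have pw: "s powr (p - 1) < t powr (p - 1)" if "0 \<le> s" "s < t" for s t :: real
    using that assms by (simp add: powr_less_mono2)
  consider "0 \<le> a" | "b \<le> 0" | "a < 0" "0 < b" by linarith
  then show ?thesis
  proof cases
    case 1
    then show ?thesis using assms pw[of a b] by (cases "a = 0") (auto simp: powr_grad_def)
  next
    case 2
    then show ?thesis using assms pw[of "-b" "-a"] by (cases "b = 0") (auto simp: powr_grad_def)
  next
    case 3
    then have "powr_grad p a < 0" "0 < powr_grad p b" using assms by (auto simp: powr_grad_def)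
    then show ?thesis by simp
  qed
qed

subsection \<open>The space of p-integrable functions\<close>

text \<open>One notion for scalar and vector values, so that functions and their weak gradients
  share the same convexity estimates.\<close>

definition in_Lp :: "real \<Rightarrow> 'a::euclidean_space set \<Rightarrow> ('a \<Rightarrow> 'b::euclidean_space) \<Rightarrow> bool" where
  "in_Lp p \<Omega> f \<longleftrightarrow> f \<in> borel_measurable lebesgue
     \<and> integrable lebesgue (\<lambda>x. indicator \<Omega> x * norm (f x) powr p)"

definition Lp_int :: "real \<Rightarrow> 'a::euclidean_space set \<Rightarrow> ('a \<Rightarrow> 'b::euclidean_space) \<Rightarrow> real" where
  "Lp_int p \<Omega> f = (\<integral>x. indicator \<Omega> x * norm (f x) powr p \<partial>lebesgue)"

lemma Lp_fun_iff_in_Lp: "Lp_fun p \<Omega> u \<longleftrightarrow> in_Lp p \<Omega> u"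
  by (simp add: Lp_fun_def in_Lp_def)

lemma Lp_vec_iff_in_Lp: "Lp_vec p \<Omega> G \<longleftrightarrow> in_Lp p \<Omega> G"
  by (simp add: Lp_vec_def in_Lp_def)

lemma Lp_int_nonneg: "Lp_int p \<Omega> f \<ge> 0"
  by (simp add: Lp_int_def)

lemma Lp_int_scaleR: "Lp_int p \<Omega> (\<lambda>x. c *\<^sub>R f x) = \<bar>c\<bar> powr p * Lp_int p \<Omega> f"
proof -
  have "Lp_int p \<Omega> (\<lambda>x. c *\<^sub>R f x) = (\<integral>x. \<bar>c\<bar> powr p * (indicator \<Omega> x * norm (f x) powr p) \<partial>lebesgue)"
    unfolding Lp_int_def by (intro Bochner_Integration.integral_cong) (auto simp: powr_mult)
  then show ?thesis by (simp add: Lp_int_def)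
qed

locale Lp_domain =
  fixes \<Omega> :: "'a::euclidean_space set" and p :: real
  assumes open_domain: "open \<Omega>" and bounded_domain: "bounded \<Omega>" and p_gt_1: "p > 1"
begin

lemma domain_sets [measurable]: "\<Omega> \<in> sets lebesgue"
  using open_domain by simp

lemma domain_lmeasurable: "\<Omega> \<in> lmeasurable"
  using bounded_domain domain_sets bounded_set_imp_lmeasurable by blast

lemma integrable_indicator_const: "integrable lebesgue (\<lambda>x. indicator \<Omega> x * (c::real))"
  using domain_lmeasurable
  by (intro integrable_mult_left) (simp add: fmeasurable_def less_top_ennreal integrable_real_indicator)

lemma in_Lp_measurable: "in_Lp p \<Omega> f \<Longrightarrow> f \<in> borel_measurable lebesgue"
  by (simp add: in_Lp_def)

lemma in_Lp_integrable: "in_Lp p \<Omega> f \<Longrightarrow> integrable lebesgue (\<lambda>x. indicator \<Omega> x * norm (f x) powr p)"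
  by (simp add: in_Lp_def)

lemma in_Lp_bounded:
  assumes "f \<in> borel_measurable lebesgue" "\<And>x. x \<in> \<Omega> \<Longrightarrow> norm (f x) \<le> B"
  shows "in_Lp p \<Omega> f"
  unfolding in_Lp_def
proof
  show "integrable lebesgue (\<lambda>x. indicator \<Omega> x * norm (f x) powr p)"
  proof (rule Bochner_Integration.integrable_bound[OF integrable_indicator_const[of "\<bar>B\<bar> powr p"]])
    show "(\<lambda>x. indicator \<Omega> x * norm (f x) powr p) \<in> borel_measurable lebesgue"
      using assms(1) by measurable
    have "norm (f x) powr p \<le> \<bar>B\<bar> powr p" if "x \<in> \<Omega>" for x
      using assms(2)[OF that] p_gt_1 by (intro powr_mono2) auto
    then show "AE x in lebesgue. norm (indicator \<Omega> x * norm (f x) powr p)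
        \<le> norm (indicator \<Omega> x * \<bar>B\<bar> powr p)"
      by (auto simp: indicator_def)
  qed
qed fact

lemma in_Lp_const: "in_Lp p \<Omega> (\<lambda>x. c)"
  by (rule in_Lp_bounded[where B = "norm c"]) auto

lemma in_Lp_scaleR:
  assumes "in_Lp p \<Omega> f"
  shows "in_Lp p \<Omega> (\<lambda>x. c *\<^sub>R f x)"
  unfolding in_Lp_def
proof
  have "(\<lambda>x. indicator \<Omega> x * norm (c *\<^sub>R f x) powr p)
      = (\<lambda>x. \<bar>c\<bar> powr p * (indicator \<Omega> x * norm (f x) powr p))"
    by (auto simp: powr_mult)
  then show "integrable lebesgue (\<lambda>x. indicator \<Omega> x * norm (c *\<^sub>R f x) powr p)"
    using in_Lp_integrable[OF assms] by (simp only: integrable_mult_right)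
qed (use in_Lp_measurable[OF assms] in measurable)

lemma in_Lp_add_and_Lp_int_add_le:
  assumes f: "in_Lp p \<Omega> f" and g: "in_Lp p \<Omega> g" and l: "0 < l" "l < 1"
  shows "in_Lp p \<Omega> (\<lambda>x. f x + g x) \<and>
    Lp_int p \<Omega> (\<lambda>x. f x + g x) \<le> (1 - l) powr (1 - p) * Lp_int p \<Omega> f + l powr (1 - p) * Lp_int p \<Omega> g"
proof -
  let ?h = "\<lambda>x. (1 - l) powr (1 - p) * (indicator \<Omega> x * norm (f x) powr p)
     + l powr (1 - p) * (indicator \<Omega> x * norm (g x) powr p)"
  note [measurable] = in_Lp_measurable[OF f] in_Lp_measurable[OF g]
  have int: "integrable lebesgue ?h"
    using in_Lp_integrable[OF f] in_Lp_integrable[OF g] by auto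
  have le: "indicator \<Omega> x * norm (f x + g x) powr p \<le> ?h x" for x
    using norm_powr_add_le[OF p_gt_1 l, of "f x" "g x"] by (auto simp: indicator_def)
  have int': "integrable lebesgue (\<lambda>x. indicator \<Omega> x * norm (f x + g x) powr p)"
    by (rule Bochner_Integration.integrable_bound[OF int])
      (use le in \<open>auto intro!: AE_I2 order_trans[OF _ abs_ge_self]\<close>)
  have "Lp_int p \<Omega> (\<lambda>x. f x + g x) \<le> (\<integral>x. ?h x \<partial>lebesgue)"
    unfolding Lp_int_def by (intro integral_mono int int' le)
  also have "\<dots> = (1 - l) powr (1 - p) * Lp_int p \<Omega> f + l powr (1 - p) * Lp_int p \<Omega> g"
    using in_Lp_integrable[OF f] in_Lp_integrable[OF g] by (simp add: Lp_int_def)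
  finally show ?thesis using int' by (auto simp: in_Lp_def)
qed

lemma in_Lp_add: "in_Lp p \<Omega> f \<Longrightarrow> in_Lp p \<Omega> g \<Longrightarrow> in_Lp p \<Omega> (\<lambda>x. f x + g x)"
  using in_Lp_add_and_Lp_int_add_le[of f g "1/2"] by auto

lemma Lp_int_add_le:
  "in_Lp p \<Omega> f \<Longrightarrow> in_Lp p \<Omega> g \<Longrightarrow> 0 < l \<Longrightarrow> l < 1 \<Longrightarrow>
    Lp_int p \<Omega> (\<lambda>x. f x + g x) \<le> (1 - l) powr (1 - p) * Lp_int p \<Omega> f + l powr (1 - p) * Lp_int p \<Omega> g"
  using in_Lp_add_and_Lp_int_add_le by blast

text \<open>The case l = 1/2, with 2 powr (p - 1) rounded up. It serves as triangle inequality
  wherever constants do not matter.\<close>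

lemma Lp_int_add_le_double:
  assumes "in_Lp p \<Omega> f" "in_Lp p \<Omega> g"
  shows "Lp_int p \<Omega> (\<lambda>x. f x + g x) \<le> 2 powr p * (Lp_int p \<Omega> f + Lp_int p \<Omega> g)"
proof -
  have "Lp_int p \<Omega> (\<lambda>x. f x + g x) \<le> (1/2) powr (1 - p) * (Lp_int p \<Omega> f + Lp_int p \<Omega> g)"
    using Lp_int_add_le[OF assms, of "1/2"] by (simp add: algebra_simps)
  also have "(1/2) powr (1 - p) \<le> 2 powr p"
    by (simp add: powr_divide powr_diff)
  finally show ?thesis
    using Lp_int_nonneg[of p \<Omega> f] Lp_int_nonneg[of p \<Omega> g] by (simp add: mult_right_mono)
qed

lemma in_Lp_diff: "in_Lp p \<Omega> f \<Longrightarrow> in_Lp p \<Omega> g \<Longrightarrow> in_Lp p \<Omega> (\<lambda>x. f x - g x)"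
  using in_Lp_add[of f "\<lambda>x. (-1) *\<^sub>R g x"] in_Lp_scaleR[of g "-1"] by simp

lemma Lp_int_mono:
  assumes "in_Lp p \<Omega> f" "in_Lp p \<Omega> g" "\<And>x. x \<in> \<Omega> \<Longrightarrow> norm (f x) \<le> norm (g x)"
  shows "Lp_int p \<Omega> f \<le> Lp_int p \<Omega> g"
  unfolding Lp_int_def
  using assms p_gt_1
  by (intro integral_mono in_Lp_integrable) (auto simp: indicator_def intro!: powr_mono2)

lemma Lp_int_const: "Lp_int p \<Omega> (\<lambda>x. c) = norm c powr p * measure lebesgue \<Omega>"
  unfolding Lp_int_def by (simp add: mult.commute)

text \<open>The second bound is not homogeneous in \<open>g\<close>; for functionals on the Sobolev
  space \<open>W1p0_dualI\<close> repairs this by scaling.\<close>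

lemma integrable_powr_grad_inner:
  assumes f: "in_Lp p \<Omega> f" and g: "in_Lp p \<Omega> g"
  shows "integrable lebesgue (\<lambda>x. indicator \<Omega> x * (powr_grad p (f x) \<bullet> g x))"
    and "\<bar>\<integral>x. indicator \<Omega> x * (powr_grad p (f x) \<bullet> g x) \<partial>lebesgue\<bar>
      \<le> (p - 1) * Lp_int p \<Omega> f + Lp_int p \<Omega> g"
proof -
  let ?h = "\<lambda>x. (p - 1) * (indicator \<Omega> x * norm (f x) powr p) + indicator \<Omega> x * norm (g x) powr p"
  note [measurable] = in_Lp_measurable[OF f] in_Lp_measurable[OF g] borel_measurable_powr_grad[OF p_gt_1]
  have int: "integrable lebesgue ?h"
    using in_Lp_integrable[OF f] in_Lp_integrable[OF g] by auto
  have le: "\<bar>indicator \<Omega> x * (powr_grad p (f x) \<bullet> g x)\<bar> \<le> ?h x" for x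
    using abs_powr_grad_inner_le[OF p_gt_1, of "f x" "g x"] by (auto simp: indicator_def)
  show *: "integrable lebesgue (\<lambda>x. indicator \<Omega> x * (powr_grad p (f x) \<bullet> g x))"
    by (rule Bochner_Integration.integrable_bound[OF int])
      (use le in \<open>auto intro!: AE_I2 order_trans[OF _ abs_ge_self]\<close>)
  have "\<bar>\<integral>x. indicator \<Omega> x * (powr_grad p (f x) \<bullet> g x) \<partial>lebesgue\<bar>
      \<le> (\<integral>x. \<bar>indicator \<Omega> x * (powr_grad p (f x) \<bullet> g x)\<bar> \<partial>lebesgue)"
    by (rule integral_abs_bound)
  also have "\<dots> \<le> (\<integral>x. ?h x \<partial>lebesgue)"
    by (intro integral_mono int integrable_abs * le)
  also have "\<dots> = (p - 1) * Lp_int p \<Omega> f + Lp_int p \<Omega> g"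
    using in_Lp_integrable[OF f] in_Lp_integrable[OF g] by (simp add: Lp_int_def)
  finally show "\<bar>\<integral>x. indicator \<Omega> x * (powr_grad p (f x) \<bullet> g x) \<partial>lebesgue\<bar>
      \<le> (p - 1) * Lp_int p \<Omega> f + Lp_int p \<Omega> g" .
qed

lemma Lp_int_ge_tangent:
  assumes f: "in_Lp p \<Omega> f" and g: "in_Lp p \<Omega> g"
  shows "Lp_int p \<Omega> f + (\<integral>x. indicator \<Omega> x * (powr_grad p (f x) \<bullet> (g x - f x)) \<partial>lebesgue) \<le> Lp_int p \<Omega> g"
proof -
  note int = in_Lp_integrable[OF f] integrable_powr_grad_inner(1)[OF f in_Lp_diff[OF g f]]
  have "Lp_int p \<Omega> f + (\<integral>x. indicator \<Omega> x * (powr_grad p (f x) \<bullet> (g x - f x)) \<partial>lebesgue)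
     = (\<integral>x. indicator \<Omega> x * norm (f x) powr p + indicator \<Omega> x * (powr_grad p (f x) \<bullet> (g x - f x)) \<partial>lebesgue)"
    using int by (simp add: Lp_int_def)
  also have "\<dots> \<le> Lp_int p \<Omega> g"
    unfolding Lp_int_def
    using int in_Lp_integrable[OF g] norm_powr_ge_tangent[OF p_gt_1]
    by (intro integral_mono) (auto simp: indicator_def)
  finally show ?thesis .
qed

subsection \<open>The p-mean\<close>

lemma isCont_integral_powr_grad_shift:
  fixes u :: "'a \<Rightarrow> real"
  assumes u: "in_Lp p \<Omega> u"
  shows "isCont (\<lambda>t. \<integral>x. indicator \<Omega> x * powr_grad p (u x - t) \<partial>lebesgue) t"
  unfolding continuous_at_sequentially comp_def
proof (intro allI impI)
  fix T :: "nat \<Rightarrow> real"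
  assume T: "T \<longlonglongrightarrow> t"
  then obtain C where C: "\<And>n. \<bar>T n\<bar> \<le> C"
    by (metis Bseq_def convergentI convergent_imp_Bseq real_norm_def)
  \<comment> \<open>A convergent sequence of shifts is bounded by some C, and the integrand is then
    dominated by its value at |u| + C. Written as a pairing with the constant 1, this majorant is
    integrable over the bounded domain.\<close>
  let ?w = "\<lambda>x. indicator \<Omega> x * (powr_grad p (\<bar>u x\<bar> + C) \<bullet> 1)"
  note [measurable] = in_Lp_measurable[OF u] borel_measurable_powr_grad[OF p_gt_1]
  have "in_Lp p \<Omega> (\<lambda>x. \<bar>u x\<bar>)"
    using u by (simp add: in_Lp_def)
  then have "in_Lp p \<Omega> (\<lambda>x. \<bar>u x\<bar> + C)"
    by (intro in_Lp_add in_Lp_const)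
  then have w: "integrable lebesgue ?w"
    by (rule integrable_powr_grad_inner(1)[OF _ in_Lp_const])
  have C0: "C \<ge> 0" using C[of 0] by linarith
  show "(\<lambda>n. \<integral>x. indicator \<Omega> x * powr_grad p (u x - T n) \<partial>lebesgue)
      \<longlonglongrightarrow> (\<integral>x. indicator \<Omega> x * powr_grad p (u x - t) \<partial>lebesgue)"
  proof (rule integral_dominated_convergence[OF _ _ w])
    show "AE x in lebesgue. (\<lambda>n. indicator \<Omega> x * powr_grad p (u x - T n))
        \<longlonglongrightarrow> indicator \<Omega> x * powr_grad p (u x - t)"
      by (intro AE_I2 tendsto_mult tendsto_const tendsto_powr_grad p_gt_1 tendsto_diff T)
    fix n
    have "\<bar>powr_grad p (u x - T n)\<bar> \<le> powr_grad p (\<bar>u x\<bar> + C)" for x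
    proof -
      have "\<bar>powr_grad p (u x - T n)\<bar> = p * \<bar>u x - T n\<bar> powr (p - 1)"
        using norm_powr_grad[OF p_gt_1, of "u x - T n"] by simp
      also have "\<dots> \<le> p * (\<bar>u x\<bar> + C) powr (p - 1)"
        using p_gt_1 C[of n] by (intro mult_left_mono powr_mono2) auto
      also have "\<dots> = powr_grad p (\<bar>u x\<bar> + C)"
        using C0 p_gt_1 by (cases "\<bar>u x\<bar> + C = 0") (auto simp: powr_grad_def sgn_if)
      finally show ?thesis .
    qed
    then show "AE x in lebesgue. norm (indicator \<Omega> x * powr_grad p (u x - T n)) \<le> ?w x"
      by (auto simp: indicator_def)
  qed measurable
qed

text \<open>The equation is the Euler equation of the minimum that defines \<open>m_p\<close>. With
  g the function to be minimised, -H is its derivative, but the tangent inequality alone suffices,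
  so there is no differentiation under the integral. H is continuous and strictly decreasing and
  changes sign by coercivity of g; its zero is the only minimum point.\<close>

lemma integral_powr_grad_m_p:
  fixes u :: "'a \<Rightarrow> real"
  assumes u: "in_Lp p \<Omega> u" and ne: "\<Omega> \<noteq> {}"
  shows "(\<integral>x. indicator \<Omega> x * powr_grad p (u x - m_p p \<Omega> u) \<partial>lebesgue) = 0"
proof -
  define g where "g t = Lp_int p \<Omega> (\<lambda>x. u x - t)" for t
  define H where "H t = (\<integral>x. indicator \<Omega> x * powr_grad p (u x - t) \<partial>lebesgue)" for t
  have shift: "in_Lp p \<Omega> (\<lambda>x. u x - t)" for t
    by (intro in_Lp_diff u in_Lp_const)
  have Hint: "integrable lebesgue (\<lambda>x. indicator \<Omega> x * powr_grad p (u x - t))" for t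
    using integrable_powr_grad_inner(1)[OF shift[of t] in_Lp_const[of 1]] by simp
  have pos: "measure lebesgue \<Omega> > 0"
  proof -
    have "emeasure lebesgue \<Omega> \<noteq> 0"
      using open_domain ne open_not_negligible negligible_iff_emeasure0[OF domain_sets] by blast
    then show ?thesis
      using domain_lmeasurable by (metis emeasure_eq_measure2 ennreal_0 zero_less_measure_iff)
  qed
  have tangent: "g t + (t - s) * H t \<le> g s" for s t
  proof -
    have "(\<lambda>x. indicator \<Omega> x * (powr_grad p (u x - t) \<bullet> ((u x - s) - (u x - t))))
        = (\<lambda>x. (t - s) * (indicator \<Omega> x * powr_grad p (u x - t)))"
      by (simp add: algebra_simps)
    then show ?thesis
      using Lp_int_ge_tangent[OF shift[of t] shift[of s]] by (simp add: g_def H_def)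
  qed
  have anti: "H t < H s" if "s < t" for s t
  proof -
    have lt: "powr_grad p (u x - t) < powr_grad p (u x - s)" for x
      using that p_gt_1 by (intro powr_grad_strict_mono) auto
    have neq: "powr_grad p (u x - s) \<noteq> powr_grad p (u x - t)" for x
      using lt[of x] by simp
    have "H t \<le> H s"
      unfolding H_def using lt by (intro integral_mono Hint) (auto simp: indicator_def less_imp_le)
    moreover have "H t \<noteq> H s"
    proof
      assume "H t = H s"
      then have "(\<integral>x. indicator \<Omega> x * powr_grad p (u x - s) - indicator \<Omega> x * powr_grad p (u x - t) \<partial>lebesgue) = 0"
        using Hint by (simp add: H_def)
      \<comment> \<open>The difference is strictly positive on the whole domain, so a vanishing
        integral would make the nonempty open domain a null set.\<close>
      then have "AE x in lebesgue. indicator \<Omega> x * powr_grad p (u x - s) - indicator \<Omega> x * powr_grad p (u x - t) = 0"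
        using lt Hint by (subst (asm) integral_nonneg_eq_0_iff_AE) (auto simp: indicator_def less_imp_le)
      then have "AE x in lebesgue. x \<notin> \<Omega>"
        by eventually_elim (use neq in \<open>auto simp: indicator_def split: if_splits\<close>)
      then have "emeasure lebesgue \<Omega> = 0"
        by (subst (asm) AE_iff_measurable[of \<Omega>]) auto
      then show False using pos by (simp add: measure_def)
    qed
    ultimately show ?thesis by simp
  qed
  obtain T where T: "T > 0" "g 0 \<le> g T" "g 0 \<le> g (-T)"
  proof -
    \<comment> \<open>If g t < g 0, coercivity bounds |t| powr p by K. T is chosen with T powr p =
      |K| + 1, which rules this out for t = T and t = -T.\<close>
    define K where "K = (2 * 2 powr p * g 0) / measure lebesgue \<Omega>"
    define T where "T = (\<bar>K\<bar> + 1) powr (1 / p)"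
    have coercive: "\<bar>t\<bar> powr p * measure lebesgue \<Omega> \<le> 2 powr p * (g 0 + g t)" for t
    proof -
      have "Lp_int p \<Omega> (\<lambda>x. (-1) *\<^sub>R (u x - t)) = g t"
        unfolding Lp_int_scaleR g_def by simp
      moreover have "in_Lp p \<Omega> (\<lambda>x. (-1) *\<^sub>R (u x - t))"
        by (rule in_Lp_scaleR[OF shift])
      \<comment> \<open>The constant t is written as u - (u - t), hence its p-integral is controlled
        by g 0 and g t.\<close>
      ultimately have "Lp_int p \<Omega> (\<lambda>x. (u x - 0) + (-1) *\<^sub>R (u x - t)) \<le> 2 powr p * (g 0 + g t)"
        using Lp_int_add_le_double[OF shift[of 0], of "\<lambda>x. (-1) *\<^sub>R (u x - t)"] by (simp add: g_def)
      then show ?thesis by (simp add: Lp_int_const)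
    qed
    have "T > 0" by (simp add: T_def add_nonneg_pos)
    have "\<bar>t\<bar> = T \<Longrightarrow> g 0 \<le> g t" for t
    proof (rule ccontr)
      assume t: "\<bar>t\<bar> = T" "\<not> g 0 \<le> g t"
      have "\<bar>t\<bar> powr p = \<bar>K\<bar> + 1"
        using t p_gt_1 by (simp add: T_def powr_powr)
      then have "(\<bar>K\<bar> + 1) * measure lebesgue \<Omega> \<le> 2 powr p * (g 0 + g t)"
        using coercive[of t] by simp
      also have "\<dots> \<le> 2 powr p * (2 * g 0)"
        using t by (intro mult_left_mono) auto
      also have "\<dots> = K * measure lebesgue \<Omega>"
        using pos by (simp add: K_def)
      finally show False using pos by (simp add: mult_le_cancel_right)
    qed
    then show thesis using that[of T] \<open>T > 0\<close> by simp
  qed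
  have "H T \<le> 0"
    using tangent[of T 0] T by (smt (verit) mult_pos_pos)
  moreover have "0 \<le> H (-T)"
    using tangent[of "-T" 0] T by (smt (verit) mult_neg_neg)
  moreover have "isCont H t" for t
    unfolding H_def by (rule isCont_integral_powr_grad_shift[OF u])
  ultimately obtain m where m: "H m = 0"
    using IVT2[of H T 0 "-T"] T by auto
  have "m_p p \<Omega> u = m"
    unfolding m_p_def
  proof (rule the_equality)
    show "\<forall>s. (\<integral>x. indicator \<Omega> x * \<bar>u x - m\<bar> powr p \<partial>lebesgue) \<le> (\<integral>x. indicator \<Omega> x * \<bar>u x - s\<bar> powr p \<partial>lebesgue)"
      using tangent[of m] m by (simp add: g_def Lp_int_def)
  next
    fix t
    assume "\<forall>s. (\<integral>x. indicator \<Omega> x * \<bar>u x - t\<bar> powr p \<partial>lebesgue) \<le> (\<integral>x. indicator \<Omega> x * \<bar>u x - s\<bar> powr p \<partial>lebesgue)"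
    then have min: "g t \<le> g s" for s by (simp add: g_def Lp_int_def)
    \<comment> \<open>A second minimum point t is compared with the midpoint between t and m. There
      H has a strict sign, since it is strictly decreasing and vanishes at m, and the tangent at the
      midpoint then forces g t above g s.\<close>
    define s where "s = (t + m) / 2"
    have le: "(s - t) * H s \<le> 0"
      using tangent[of s t] min[of s] by linarith
    show "t = m"
    proof (rule linorder_cases)
      assume "t < m"
      then have "s - t > 0" "H s > 0" using anti[of s m] m by (auto simp: s_def)
      then show ?thesis using le by (smt (verit) mult_pos_pos)
    next
      assume "m < t"
      then have "s - t < 0" "H s < 0" using anti[of m s] m by (auto simp: s_def)
      then show ?thesis using le by (smt (verit) mult_neg_neg)
    qed
  qed
  then show ?thesis using m by (simp add: H_def)
qed

end

subsection \<open>Test functions\<close>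

lemma test_fun_smooth: "test_fun \<Omega> \<phi> \<Longrightarrow> smooth_fun \<phi>"
  by (simp add: test_fun_def)

lemma test_fun_outside: "test_fun \<Omega> \<phi> \<Longrightarrow> x \<notin> \<Omega> \<Longrightarrow> \<phi> x = 0"
  using closure_subset[of "{x. \<phi> x \<noteq> 0}"] by (auto simp: test_fun_def)

lemma test_funI:
  assumes "smooth_fun \<phi>" "compact K" "K \<subseteq> \<Omega>" "\<And>x. x \<notin> K \<Longrightarrow> \<phi> x = 0"
  shows "test_fun \<Omega> \<phi>"
proof -
  have "closure {x. \<phi> x \<noteq> 0} \<subseteq> K"
    using assms by (intro closure_minimal compact_imp_closed) auto
  then show ?thesis
    using assms compact_Int_closed[OF \<open>compact K\<close> closed_closure, of "{x. \<phi> x \<noteq> 0}"]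
    by (auto simp: test_fun_def Int_absorb1)
qed

lemma test_fun_support:
  assumes "test_fun \<Omega> \<phi>"
  obtains K where "compact K" "K \<subseteq> \<Omega>" "\<And>x. x \<notin> K \<Longrightarrow> \<phi> x = 0"
    "\<And>x v. x \<notin> K \<Longrightarrow> frechet_derivative \<phi> (at x) v = 0"
proof
  let ?K = "closure {x. \<phi> x \<noteq> 0}"
  show "compact ?K" "?K \<subseteq> \<Omega>" using assms by (auto simp: test_fun_def)
  show z: "\<phi> x = 0" if "x \<notin> ?K" for x
    using that closure_subset[of "{x. \<phi> x \<noteq> 0}"] by auto
  show "frechet_derivative \<phi> (at x) v = 0" if "x \<notin> ?K" for x v
  proof -
    have "((\<lambda>x. 0) has_derivative (\<lambda>v. 0)) (at x)" by simp
    moreover have "open (- ?K)" "x \<in> - ?K" using that by auto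
    ultimately have "(\<phi> has_derivative (\<lambda>v. 0)) (at x)"
      by (rule has_derivative_transform_within_open) (rule z[symmetric], erule ComplD)
    then show ?thesis by (simp add: frechet_derivative_eqI)
  qed
qed

lemma test_fun_mult:
  assumes "test_fun \<Omega> \<phi>" "smooth_fun \<psi>"
  shows "test_fun \<Omega> (\<lambda>x. \<phi> x * \<psi> x)"
proof -
  obtain K where K: "compact K" "K \<subseteq> \<Omega>" "\<And>x. x \<notin> K \<Longrightarrow> \<phi> x = 0"
    using test_fun_support[OF assms(1)] by metis
  show ?thesis
    by (rule test_funI[OF smooth_fun_mult[OF test_fun_smooth[OF assms(1)] assms(2)] K(1,2)])
      (simp add: K(3))
qed

lemma test_fun_add:
  assumes "test_fun \<Omega> \<phi>" "test_fun \<Omega> \<psi>"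
  shows "test_fun \<Omega> (\<lambda>x. \<phi> x + \<psi> x)"
proof -
  obtain K where K: "compact K" "K \<subseteq> \<Omega>" "\<And>x. x \<notin> K \<Longrightarrow> \<phi> x = 0"
    using test_fun_support[OF assms(1)] by metis
  obtain L where L: "compact L" "L \<subseteq> \<Omega>" "\<And>x. x \<notin> L \<Longrightarrow> \<psi> x = 0"
    using test_fun_support[OF assms(2)] by metis
  show ?thesis
    by (rule test_funI[of _ "K \<union> L", OF smooth_fun_add[OF assms[THEN test_fun_smooth]]])
      (use K L in auto)
qed

lemma test_fun_cmult: "test_fun \<Omega> \<phi> \<Longrightarrow> test_fun \<Omega> (\<lambda>x. c * \<phi> x)"
  using test_fun_mult[OF _ smooth_fun_const, of \<Omega> \<phi> c] by (simp add: mult.commute)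

lemma test_fun_frechet_derivative:
  assumes "test_fun \<Omega> \<phi>"
  shows "test_fun \<Omega> (\<lambda>x. frechet_derivative \<phi> (at x) v)"
proof -
  obtain K where K: "compact K" "K \<subseteq> \<Omega>" "\<And>x v. x \<notin> K \<Longrightarrow> frechet_derivative \<phi> (at x) v = 0"
    using test_fun_support[OF assms(1)] by metis
  show ?thesis
    by (rule test_funI[OF smooth_fun_frechet_derivative[OF test_fun_smooth[OF assms]] K])
qed

lemma smooth_fun_borel_measurable: "smooth_fun f \<Longrightarrow> f \<in> borel_measurable borel"
  by (intro borel_measurable_continuous_onI smooth_fun_continuous_on)

lemma smooth_fun_lebesgue_measurable: "smooth_fun f \<Longrightarrow> f \<in> borel_measurable lebesgue"
  by (intro measurable_completion) (simp add: smooth_fun_borel_measurable)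

lemma test_fun_bounded:
  assumes "test_fun \<Omega> \<phi>"
  obtains B where "B \<ge> 0" "\<And>x. \<bar>\<phi> x\<bar> \<le> B"
proof -
  obtain K where K: "compact K" "K \<subseteq> \<Omega>" "\<And>x. x \<notin> K \<Longrightarrow> \<phi> x = 0"
    using test_fun_support[OF assms] by metis
  have "bounded (\<phi> ` K)"
    using K assms by (intro compact_imp_bounded compact_continuous_image)
      (auto intro: smooth_fun_continuous_on test_fun_smooth)
  then obtain B where "\<And>x. x \<in> K \<Longrightarrow> \<bar>\<phi> x\<bar> \<le> B"
    unfolding bounded_iff by auto
  then have "\<bar>\<phi> x\<bar> \<le> max B 0" for x
    using K(3)[of x] by (cases "x \<in> K") (auto simp: le_max_iff_disj)
  then show thesis using that[of "max B 0"] by simp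
qed

lemma test_fun_integrable:
  assumes "test_fun \<Omega> \<phi>"
  shows "integrable lborel \<phi>"
proof -
  obtain K where K: "compact K" "K \<subseteq> \<Omega>" "\<And>x. x \<notin> K \<Longrightarrow> \<phi> x = 0"
    using test_fun_support[OF assms] by metis
  have "integrable lborel (\<lambda>x. indicator K x *\<^sub>R \<phi> x)"
    using K assms by (intro borel_integrable_compact smooth_fun_continuous_on test_fun_smooth)
  moreover have "(\<lambda>x. indicator K x *\<^sub>R \<phi> x) = \<phi>"
    using K(3) by (auto simp: indicator_def fun_eq_iff)
  ultimately show ?thesis by simp
qed

text \<open>By translation invariance the difference quotients have integral zero.\<close>
lemma integral_partial_derivative_eq_0:
  fixes f :: "'a::euclidean_space \<Rightarrow> real"
  assumes "test_fun UNIV f"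
  shows "(\<integral>x. frechet_derivative f (at x) i \<partial>lborel) = 0"
proof -
  define D where "D x = frechet_derivative f (at x) i" for x
  define h where "h n = 1 / (real n + 1)" for n
  have h: "0 < h n" "h n \<le> 1" for n by (auto simp: h_def)
  have h0: "h \<longlonglongrightarrow> 0"
    using LIMSEQ_inverse_real_of_nat by (simp add: h_def[abs_def] inverse_eq_divide add.commute)
  have D: "test_fun UNIV D"
    unfolding D_def by (rule test_fun_frechet_derivative[OF assms])
  obtain B where B: "B \<ge> 0" "\<And>x. \<bar>D x\<bar> \<le> B"
    using test_fun_bounded[OF D] by metis
  obtain K where K: "compact K" "\<And>x. x \<notin> K \<Longrightarrow> f x = 0"
    using test_fun_support[OF assms] by metis
  obtain R where R: "\<And>x. x \<in> K \<Longrightarrow> norm x \<le> R"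
    using compact_imp_bounded[OF K(1)] by (auto simp: bounded_iff)
  have line: "((\<lambda>t. f (x + t *\<^sub>R i)) has_field_derivative D (x + t *\<^sub>R i)) (at t)" for x t
  proof -
    have fd: "(f has_derivative frechet_derivative f (at (x + t *\<^sub>R i))) (at (x + t *\<^sub>R i))"
      using smooth_fun_differentiable[OF test_fun_smooth[OF assms]]
      by (simp add: frechet_derivative_works[symmetric])
    have "((\<lambda>t. x + t *\<^sub>R i) has_derivative (\<lambda>s. s *\<^sub>R i)) (at t)"
      by (auto intro!: derivative_eq_intros)
    then have "((\<lambda>t. f (x + t *\<^sub>R i)) has_derivative (\<lambda>s. frechet_derivative f (at (x + t *\<^sub>R i)) (s *\<^sub>R i))) (at t)"
      using fd by (rule has_derivative_compose)
    moreover have "frechet_derivative f (at (x + t *\<^sub>R i)) (s *\<^sub>R i) = D (x + t *\<^sub>R i) * s" for s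
      unfolding D_def
      using linear_scale[OF has_derivative_linear[OF fd], of s i] by simp
    ultimately show ?thesis by (simp add: has_field_derivative_def)
  qed
  define q where "q n x = (f (x + h n *\<^sub>R i) - f x) / h n" for n x
  \<comment> \<open>By the mean value theorem the quotients are bounded by the maximum of the
    derivative. As the increments are at most 1, enlarging the radius of the support by
    \<open>norm i\<close> captures all translates.\<close>
  have q_le: "\<bar>q n x\<bar> \<le> indicator (cball 0 (R + norm i)) x * B" for n x
  proof (cases "x \<in> cball 0 (R + norm i)")
    case True
    obtain z where z: "0 < z" "z < h n" "f (x + h n *\<^sub>R i) - f (x + 0 *\<^sub>R i) = (h n - 0) * D (x + z *\<^sub>R i)"
      using MVT2[of 0 "h n" "\<lambda>t. f (x + t *\<^sub>R i)" "\<lambda>t. D (x + t *\<^sub>R i)"] h[of n] line by blast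
    then have "q n x = D (x + z *\<^sub>R i)" using h[of n] by (simp add: q_def)
    then show ?thesis using B True by simp
  next
    case False
    then have n: "norm x > R + norm i" by simp
    moreover have "norm (x + h n *\<^sub>R i) \<ge> norm x - norm i"
    proof -
      have "norm (h n *\<^sub>R i) \<le> norm i" using h[of n] by (simp add: mult_left_le_one_le)
      then show ?thesis using norm_diff_ineq[of x "h n *\<^sub>R i"] by linarith
    qed
    ultimately have "norm (x + h n *\<^sub>R i) > R" by linarith
    moreover have "norm x > R" using n norm_ge_zero[of i] by linarith
    ultimately have "x \<notin> K" "x + h n *\<^sub>R i \<notin> K" using R by force+
    then show ?thesis using K(2) False by (simp add: q_def)
  qed
  have fm[measurable]: "f \<in> borel_measurable borel" "D \<in> borel_measurable borel"
    using assms D by (auto intro: smooth_fun_borel_measurable test_fun_smooth)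
  have "(\<lambda>n. \<integral>x. q n x \<partial>lborel) \<longlonglongrightarrow> (\<integral>x. D x \<partial>lborel)"
  proof (rule integral_dominated_convergence)
    show "integrable lborel (\<lambda>x::'a. indicator (cball 0 (R + norm i)) x * B)"
      by (intro integrable_mult_left integrable_real_indicator)
        (use emeasure_lborel_cball_finite[of "0::'a" "R + norm i"] in auto)
    show "AE x in lborel. (\<lambda>n. q n x) \<longlonglongrightarrow> D x"
    proof (intro AE_I2)
      fix x
      have "((\<lambda>t. (f (x + t *\<^sub>R i) - f x) / t) \<longlongrightarrow> D x) (at 0)"
        using line[of x 0] by (simp add: has_field_derivative_iff)
      moreover have "filterlim h (at 0) sequentially"
        using h(1) h0 by (simp add: filterlim_at less_imp_neq[THEN not_sym])
      ultimately show "(\<lambda>n. q n x) \<longlonglongrightarrow> D x"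
        unfolding q_def by (rule filterlim_compose)
    qed
    show "AE x in lborel. norm (q n x) \<le> indicator (cball 0 (R + norm i)) x * B" for n
      using q_le by simp
    show "q n \<in> borel_measurable lborel" for n unfolding q_def by measurable
  qed measurable
  moreover have "(\<integral>x. q n x \<partial>lborel) = 0" for n
  proof -
    have int: "integrable lborel f" by (rule test_fun_integrable[OF assms])
    have d: "lborel = distr lborel borel ((+) (h n *\<^sub>R i))"
      by (rule lborel_distr_plus[symmetric])
    have "(\<integral>x. f x \<partial>lborel) = (\<integral>x. f (h n *\<^sub>R i + x) \<partial>lborel)"
      by (subst d, subst integral_distr) auto
    moreover have "integrable lborel (\<lambda>x. f (h n *\<^sub>R i + x))"
      using int by (subst (asm) d, subst (asm) integrable_distr_eq) auto
    ultimately show ?thesis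
      unfolding q_def using int by (simp add: add.commute)
  qed
  ultimately show ?thesis
    by (simp add: D_def LIMSEQ_const_iff)
qed

subsection \<open>The fundamental lemma of the calculus of variations\<close>

text \<open>Boxes form an intersection-stable generator of the Borel sets, so by the pi-lambda
  theorem all Borel integrals vanish and f and 0 are densities of the same signed measure. The total
  integral is what the step to complements uses, the whole space being no box.\<close>

lemma AE_eq_0_if_box_integrals_eq_0:
  fixes f :: "'a::euclidean_space \<Rightarrow> real"
  assumes f: "integrable lborel f" and zero: "(\<integral>x. f x \<partial>lborel) = 0"
    and box: "\<And>a b. (LINT x:box a b|lborel. f x) = 0"
  shows "AE x in lborel. f x = 0"
proof (rule density_unique_real[OF f])
  have si: "set_integrable lborel A f" if "A \<in> sets borel" for A
    using integrable_mult_indicator[of A lborel f] that f by (simp add: set_integrable_def)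
  let ?G = "range (\<lambda>(a, b). box a b :: 'a set)"
  fix A :: "'a set" assume A: "A \<in> sets lborel"
  have "Int_stable ?G"
    by (auto simp: Int_stable_def box_Int_box)
  moreover have "?G \<subseteq> Pow UNIV" by simp
  moreover have "A \<in> sigma_sets UNIV ?G"
    using A unfolding sets_lborel borel_eq_box by simp
  ultimately have "A \<in> sets borel \<and> (LINT x:A|lborel. f x) = 0"
  proof (induction rule: sigma_sets_induct_disjoint)
    case (basic A)
    then show ?case using box by auto
  next
    case empty
    then show ?case by (simp add: set_lebesgue_integral_def)
  next
    case (compl A)
    then have A: "A \<in> sets borel" "(LINT x:A|lborel. f x) = 0" by auto
    have "(LINT x:A \<union> (UNIV - A)|lborel. f x) = (LINT x:A|lborel. f x) + (LINT x:UNIV - A|lborel. f x)"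
      using A by (intro set_integral_Un si) auto
    then show ?case using A zero by (simp add: set_lebesgue_integral_def)
  next
    case (union A)
    then have A: "A i \<in> sets borel" "(LINT x:A i|lborel. f x) = 0" for i by auto
    have "(LINT x:(\<Union>i. A i)|lborel. f x) = (\<Sum>i. (LINT x:A i|lborel. f x))"
      using A union.hyps(1)
      by (intro lebesgue_integral_countable_add si) (auto simp: disjoint_family_on_def)
    then show ?case using A by auto
  qed
  then show "(LINT x:A|lborel. f x) = (LINT x:A|lborel. 0)" by simp
qed simp

text \<open>Approximating indicators by test functions makes the integral of g vanish over every box
  whose closed box lies in the domain. On one such box these integrals determine g, and countably
  many of them cover the domain.\<close>

lemma test_fun_orthogonal_imp_AE_eq_0:
  fixes g :: "'a::euclidean_space \<Rightarrow> real"
  assumes "open \<Omega>" and g: "integrable lebesgue (\<lambda>x. indicator \<Omega> x * g x)"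
    and orth: "\<And>\<phi>. test_fun \<Omega> \<phi> \<Longrightarrow> (\<integral>x. indicator \<Omega> x * (g x * \<phi> x) \<partial>lebesgue) = 0"
  shows "AE x in lebesgue. x \<in> \<Omega> \<longrightarrow> g x = 0"
proof -
  define \<gamma> where "\<gamma> x = indicator \<Omega> x * g x" for x
  have \<gamma>: "integrable lebesgue \<gamma>" using g by (simp add: \<gamma>_def[abs_def])
  have \<gamma>m[measurable]: "\<gamma> \<in> borel_measurable lebesgue"
    using \<gamma> by (rule borel_measurable_integrable)
  have box0: "(\<integral>x. indicator (box a b) x * \<gamma> x \<partial>lebesgue) = 0"
    if "cbox a b \<subseteq> \<Omega>" for a b
  proof -
    define \<phi> where "\<phi> n x = box_bump a b x / (box_bump a b x + 1 / (real n + 1))" for n x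
    have \<phi>: "test_fun \<Omega> (\<phi> n)" for n
      unfolding \<phi>_def using that by (rule test_fun_box_bump_ratio) simp
    have \<phi>1: "\<bar>\<phi> n x\<bar> \<le> 1" for n x
      using box_bump_nonneg[of a b x] by (auto simp: \<phi>_def divide_le_eq_1 add_nonneg_pos)
    have [measurable]: "\<phi> n \<in> borel_measurable lebesgue" for n
      by (rule smooth_fun_lebesgue_measurable[OF test_fun_smooth[OF \<phi>]])
    have "(\<lambda>n. \<integral>x. \<phi> n x * \<gamma> x \<partial>lebesgue)
        \<longlonglongrightarrow> (\<integral>x. indicator (box a b) x * \<gamma> x \<partial>lebesgue)"
    proof (rule integral_dominated_convergence[where w = "\<lambda>x. \<bar>\<gamma> x\<bar>"])
      show "AE x in lebesgue. (\<lambda>n. \<phi> n x * \<gamma> x)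
          \<longlonglongrightarrow> indicator (box a b) x * \<gamma> x"
      proof (intro AE_I2 tendsto_mult tendsto_const)
        fix x
        show "(\<lambda>n. \<phi> n x) \<longlonglongrightarrow> indicator (box a b) x"
        proof (cases "x \<in> box a b")
          case True
          then have "box_bump a b x \<noteq> 0" by (simp add: box_bump_eq_0_iff)
          then have "(\<lambda>n. \<phi> n x) \<longlonglongrightarrow> box_bump a b x / (box_bump a b x + 0)"
            unfolding \<phi>_def using LIMSEQ_inverse_real_of_nat
            by (intro tendsto_intros) (auto simp: inverse_eq_divide add.commute)
          then show ?thesis using True \<open>box_bump a b x \<noteq> 0\<close> by simp
        next
          case False
          then have "box_bump a b x = 0" by (simp add: box_bump_eq_0_iff)
          then show ?thesis using False by (simp add: \<phi>_def)
        qed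
      qed
      show "AE x in lebesgue. norm (\<phi> n x * \<gamma> x) \<le> \<bar>\<gamma> x\<bar>" for n
        using \<phi>1 by (auto simp: abs_mult intro!: AE_I2 mult_left_le_one_le)
      show "(\<lambda>x. indicator (box a b) x * \<gamma> x) \<in> borel_measurable lebesgue"
        by (intro borel_measurable_times \<gamma>m borel_measurable_indicator) simp
      show "integrable lebesgue (\<lambda>x. \<bar>\<gamma> x\<bar>)" using \<gamma> by (rule integrable_abs)
      show "(\<lambda>x. \<phi> n x * \<gamma> x) \<in> borel_measurable lebesgue" for n by measurable
    qed
    moreover have "(\<integral>x. \<phi> n x * \<gamma> x \<partial>lebesgue) = 0" for n
      using orth[OF \<phi>, of n] by (simp add: \<gamma>_def ac_simps)
    ultimately show ?thesis by (simp add: LIMSEQ_const_iff)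
  qed
  have AE_box: "AE x in lebesgue. x \<in> box a b \<longrightarrow> g x = 0" if ab: "cbox a b \<subseteq> \<Omega>" for a b
  proof -
    let ?f = "\<lambda>x. indicator (box a b) x * \<gamma> x"
    have int: "integrable lebesgue ?f"
      using integrable_mult_indicator[OF _ \<gamma>, of "box a b"] by simp
    then have fm[measurable]: "?f \<in> borel_measurable (completion lborel)"
      by (rule borel_measurable_integrable)
    \<comment> \<open>Boxes generate only the Borel sets, so the argument runs on a Borel
      representative.\<close>
    then obtain f' where f'm[measurable]: "f' \<in> borel_measurable lborel"
      and f': "AE x in lborel. ?f x = f' x"
      using completion_ex_borel_measurable_real by blast
    have f'L: "AE x in lebesgue. ?f x = f' x" using f' by (rule AE_completion)
    have f'lm[measurable]: "f' \<in> borel_measurable lebesgue"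
      by (rule measurable_completion[OF f'm])
    have int': "integrable lebesgue f'"
      using int integrable_cong_AE[OF fm f'lm f'L] by blast
    have "(\<integral>x. indicator (box c d) x * f' x \<partial>lborel) = 0" for c d
    proof -
      have "(\<integral>x. indicator (box c d) x * f' x \<partial>lborel) = (\<integral>x. indicator (box c d) x * f' x \<partial>lebesgue)"
        by (subst integral_completion) auto
      also have "\<dots> = (\<integral>x. indicator (box c d) x * ?f x \<partial>lebesgue)"
        using f'L by (intro integral_cong_AE borel_measurable_times borel_measurable_indicator f'lm \<gamma>m)
          (auto elim!: eventually_mono)
      \<comment> \<open>The intersection is again a box, and its closed box lies in
        \<open>cbox a b\<close>, so \<open>box0\<close> applies even if \<open>box c d\<close>
        leaves the domain.\<close>
      also have "\<dots> = (\<integral>x. indicator (box a b \<inter> box c d) x * \<gamma> x \<partial>lebesgue)"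
        by (intro Bochner_Integration.integral_cong) (auto simp: indicator_def)
      also have "\<dots> = 0"
        unfolding box_Int_box
      proof (rule box0)
        show "cbox (\<Sum>i\<in>Basis. max (a \<bullet> i) (c \<bullet> i) *\<^sub>R i) (\<Sum>i\<in>Basis. min (b \<bullet> i) (d \<bullet> i) *\<^sub>R i) \<subseteq> \<Omega>"
          unfolding Int_interval[symmetric] using ab by auto
      qed
      finally show ?thesis .
    qed
    moreover have "(\<integral>x. f' x \<partial>lborel) = 0"
    proof -
      have "(\<integral>x. f' x \<partial>lborel) = (\<integral>x. f' x \<partial>lebesgue)"
        by (subst integral_completion) auto
      also have "\<dots> = (\<integral>x. ?f x \<partial>lebesgue)"
        using f'L by (intro integral_cong_AE fm f'lm) (auto elim!: eventually_mono)
      finally show ?thesis using box0[OF ab] by simp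
    qed
    moreover have "integrable lborel f'"
      using int' integrable_completion[OF f'm] by blast
    ultimately have "AE x in lborel. f' x = 0"
      by (intro AE_eq_0_if_box_integrals_eq_0) (auto simp: set_lebesgue_integral_def)
    then have "AE x in lebesgue. f' x = 0" by (rule AE_completion)
    with f'L show ?thesis
      by eventually_elim (use ab box_subset_cbox in \<open>auto simp: \<gamma>_def indicator_def split: if_splits\<close>)
  qed
  obtain \<D> where \<D>: "countable \<D>" "\<D> \<subseteq> Pow \<Omega>" "\<And>X. X \<in> \<D> \<Longrightarrow> \<exists>a b. X = cbox a b" "\<Union>\<D> = \<Omega>"
    using open_countable_Union_open_cbox[OF \<open>open \<Omega>\<close>] by metis
  have "AE x in lebesgue. \<forall>X\<in>\<D>. x \<in> X \<longrightarrow> g x = 0"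
  proof (subst AE_ball_countable[OF \<D>(1)], intro ballI)
    fix X assume X: "X \<in> \<D>"
    then obtain a b where ab: "X = cbox a b" using \<D>(3) by blast
    \<comment> \<open>The countable cover consists of closed boxes while \<open>AE_box\<close>
      concerns open ones; the faces are null sets.\<close>
    have "negligible (cbox a b - box a b)" by (rule negligible_frontier_interval)
    then have "AE x in lebesgue. x \<notin> cbox a b - box a b"
      using AE_not_in[of "cbox a b - box a b" lebesgue] by (simp add: negligible_iff_null_sets)
    moreover have "AE x in lebesgue. x \<in> box a b \<longrightarrow> g x = 0"
      using X ab \<D>(2) by (intro AE_box) auto
    ultimately show "AE x in lebesgue. x \<in> X \<longrightarrow> g x = 0"
      by eventually_elim (auto simp: ab)
  qed
  then show ?thesis by eventually_elim (use \<D>(4) in auto)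
qed

subsection \<open>Weak gradients\<close>

definition test_grad :: "('a::euclidean_space \<Rightarrow> real) \<Rightarrow> 'a \<Rightarrow> 'a" where
  "test_grad \<phi> x = (\<Sum>i\<in>Basis. frechet_derivative \<phi> (at x) i *\<^sub>R i)"

lemma test_grad_inner: "i \<in> Basis \<Longrightarrow> test_grad \<phi> x \<bullet> i = frechet_derivative \<phi> (at x) i"
  by (simp add: test_grad_def)

lemma test_grad_measurable:
  assumes "smooth_fun \<phi>"
  shows "test_grad \<phi> \<in> borel_measurable lebesgue"
  unfolding test_grad_def[abs_def]
  by (intro borel_measurable_sum borel_measurable_scaleR borel_measurable_const
      smooth_fun_lebesgue_measurable smooth_fun_frechet_derivative assms)

lemma norm_test_grad_le:
  "norm (test_grad \<phi> x) \<le> (\<Sum>i\<in>Basis. \<bar>frechet_derivative \<phi> (at x) i\<bar>)"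
  using norm_le_l1[of "test_grad \<phi> x"] by (simp add: test_grad_inner)

lemma test_grad_bounded:
  fixes \<phi> :: "'a::euclidean_space \<Rightarrow> real"
  assumes "test_fun \<Omega> \<phi>"
  obtains B where "B \<ge> 0" "\<And>x. norm (test_grad \<phi> x) \<le> B"
proof -
  have "\<exists>B. \<forall>x. \<bar>frechet_derivative \<phi> (at x) i\<bar> \<le> B" for i
    using test_fun_bounded[OF test_fun_frechet_derivative[OF assms]] by metis
  then obtain B where B: "\<And>i x. \<bar>frechet_derivative \<phi> (at x) i\<bar> \<le> B i"
    by metis
  have "norm (test_grad \<phi> x) \<le> (\<Sum>i\<in>Basis. B i)" for x
    by (rule order_trans[OF norm_test_grad_le]) (intro sum_mono B)
  moreover from this have "0 \<le> (\<Sum>i\<in>Basis. B i)"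
    using norm_ge_zero order_trans by blast
  ultimately show thesis using that by blast
qed

text \<open>Integration by parts: the product of two test functions is compactly supported, so its
  partial derivatives have integral zero, and the product rule splits them.\<close>

lemma weak_grad_test_fun:
  assumes "test_fun \<Omega> \<phi>"
  shows "weak_grad \<Omega> \<phi> (test_grad \<phi>)"
  unfolding weak_grad_def
proof (intro allI impI ballI)
  fix \<psi> :: "'a \<Rightarrow> real" and i :: 'a
  assume \<psi>: "test_fun \<Omega> \<psi>" and i: "i \<in> Basis"
  let ?a = "\<lambda>x. \<phi> x * frechet_derivative \<psi> (at x) i"
  let ?b = "\<lambda>x. frechet_derivative \<phi> (at x) i * \<psi> x"
  have a: "test_fun \<Omega> ?a"
    by (intro test_fun_mult assms smooth_fun_frechet_derivative test_fun_smooth[OF \<psi>])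
  have b: "test_fun \<Omega> ?b"
    by (intro test_fun_mult test_fun_frechet_derivative assms test_fun_smooth[OF \<psi>])
  have "test_fun UNIV (\<lambda>x. \<phi> x * \<psi> x)"
    using test_fun_mult[OF assms test_fun_smooth[OF \<psi>]] by (simp add: test_fun_def)
  then have "(\<integral>x. frechet_derivative (\<lambda>x. \<phi> x * \<psi> x) (at x) i \<partial>lborel) = 0"
    by (rule integral_partial_derivative_eq_0)
  moreover have "frechet_derivative (\<lambda>x. \<phi> x * \<psi> x) (at x) i = ?a x + ?b x" for x
  proof -
    have "(\<phi> has_derivative frechet_derivative \<phi> (at x)) (at x)"
      "(\<psi> has_derivative frechet_derivative \<psi> (at x)) (at x)"
      using assms \<psi> smooth_fun_differentiable test_fun_smooth frechet_derivative_works by blast+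
    then have "((\<lambda>x. \<phi> x * \<psi> x) has_derivative
        (\<lambda>h. \<phi> x * frechet_derivative \<psi> (at x) h + frechet_derivative \<phi> (at x) h * \<psi> x)) (at x)"
      by (rule has_derivative_mult)
    from frechet_derivative_eqI[OF this] show ?thesis by simp
  qed
  ultimately have "(\<integral>x. ?a x + ?b x \<partial>lborel) = 0" by simp
  then have sum0: "(\<integral>x. ?a x \<partial>lborel) + (\<integral>x. ?b x \<partial>lborel) = 0"
    using test_fun_integrable[OF a] test_fun_integrable[OF b] by simp
  have "(\<integral>x. indicator \<Omega> x * ?a x \<partial>lebesgue) = (\<integral>x. ?a x \<partial>lebesgue)"
    using test_fun_outside[OF a] by (intro Bochner_Integration.integral_cong) (auto simp: indicator_def)
  also have "\<dots> = (\<integral>x. ?a x \<partial>lborel)"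
    using test_fun_integrable[OF a] by (intro integral_completion) auto
  finally have 1: "(\<integral>x. indicator \<Omega> x * ?a x \<partial>lebesgue) = (\<integral>x. ?a x \<partial>lborel)" .
  have "(\<integral>x. indicator \<Omega> x * ((test_grad \<phi> x \<bullet> i) * \<psi> x) \<partial>lebesgue) = (\<integral>x. ?b x \<partial>lebesgue)"
    using test_fun_outside[OF b] i
    by (intro Bochner_Integration.integral_cong) (auto simp: indicator_def test_grad_inner)
  also have "\<dots> = (\<integral>x. ?b x \<partial>lborel)"
    using test_fun_integrable[OF b] by (intro integral_completion) auto
  finally show "(\<integral>x. indicator \<Omega> x * ?a x \<partial>lebesgue)
      = - (\<integral>x. indicator \<Omega> x * ((test_grad \<phi> x \<bullet> i) * \<psi> x) \<partial>lebesgue)"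
    using 1 sum0 by simp
qed

context Lp_domain
begin

text \<open>On a bounded domain |f| <= 1 + |f| powr p shows that p-integrable functions are
  integrable, and a bounded factor preserves this.\<close>

lemma integrable_Lp_mult_test_fun:
  fixes f :: "'a \<Rightarrow> real"
  assumes f: "in_Lp p \<Omega> f" and \<phi>: "\<phi> \<in> borel_measurable lebesgue" "\<And>x. \<bar>\<phi> x\<bar> \<le> B"
  shows "integrable lebesgue (\<lambda>x. indicator \<Omega> x * (f x * \<phi> x))"
proof -
  note [measurable] = in_Lp_measurable[OF f] \<phi>(1)
  let ?h = "\<lambda>x. B * (indicator \<Omega> x * 1 + indicator \<Omega> x * norm (f x) powr p)"
  have B: "B \<ge> 0" using \<phi>(2)[of undefined] by linarith
  have int: "integrable lebesgue ?h"
    using in_Lp_integrable[OF f] integrable_indicator_const[of 1]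
    by (intro integrable_mult_right Bochner_Integration.integrable_add)
  have "\<bar>f x\<bar> \<le> 1 + \<bar>f x\<bar> powr p" for x
  proof (cases "\<bar>f x\<bar> \<le> 1")
    case True
    then show ?thesis by (simp add: add_increasing2)
  next
    case False
    then have "\<bar>f x\<bar> powr 1 \<le> \<bar>f x\<bar> powr p" using p_gt_1 by (intro powr_mono) auto
    then show ?thesis using False by simp
  qed
  then have "\<bar>f x * \<phi> x\<bar> \<le> B * (1 + \<bar>f x\<bar> powr p)" for x
    unfolding abs_mult mult.commute[of B] using \<phi>(2) B by (intro mult_mono) auto
  then have le: "\<bar>indicator \<Omega> x * (f x * \<phi> x)\<bar> \<le> ?h x" for x
    by (auto simp: indicator_def)
  show ?thesis
    by (rule Bochner_Integration.integrable_bound[OF int])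
      (use le in \<open>auto intro!: AE_I2 order_trans[OF _ abs_ge_self]\<close>)
qed

lemma in_Lp_inner:
  assumes "in_Lp p \<Omega> G" "i \<in> Basis"
  shows "in_Lp p \<Omega> (\<lambda>x. G x \<bullet> i)"
  unfolding in_Lp_def
proof
  note [measurable] = in_Lp_measurable[OF assms(1)]
  show [measurable]: "(\<lambda>x. G x \<bullet> i) \<in> borel_measurable lebesgue" by measurable
  have "norm (G x \<bullet> i) powr p \<le> norm (G x) powr p" for x
    using p_gt_1 Basis_le_norm[OF assms(2), of "G x"] by (intro powr_mono2) auto
  then show "integrable lebesgue (\<lambda>x. indicator \<Omega> x * norm (G x \<bullet> i) powr p)"
    by (intro Bochner_Integration.integrable_bound[OF in_Lp_integrable[OF assms(1)]])
      (auto simp: indicator_def)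
qed

lemma integrable_weak_grad_terms:
  assumes "test_fun \<Omega> \<phi>" "i \<in> Basis"
  shows "in_Lp p \<Omega> u \<Longrightarrow> integrable lebesgue (\<lambda>x. indicator \<Omega> x * (u x * frechet_derivative \<phi> (at x) i))"
    and "in_Lp p \<Omega> G \<Longrightarrow> integrable lebesgue (\<lambda>x. indicator \<Omega> x * ((G x \<bullet> i) * \<phi> x))"
proof -
  assume u: "in_Lp p \<Omega> u"
  have D: "test_fun \<Omega> (\<lambda>x. frechet_derivative \<phi> (at x) i)"
    by (rule test_fun_frechet_derivative[OF assms(1)])
  obtain B where "\<And>x. \<bar>frechet_derivative \<phi> (at x) i\<bar> \<le> B"
    using test_fun_bounded[OF D] by metis
  then show "integrable lebesgue (\<lambda>x. indicator \<Omega> x * (u x * frechet_derivative \<phi> (at x) i))"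
    by (rule integrable_Lp_mult_test_fun[OF u smooth_fun_lebesgue_measurable[OF test_fun_smooth[OF D]]])
next
  assume G: "in_Lp p \<Omega> G"
  obtain B where "\<And>x. \<bar>\<phi> x\<bar> \<le> B"
    using test_fun_bounded[OF assms(1)] by metis
  then show "integrable lebesgue (\<lambda>x. indicator \<Omega> x * ((G x \<bullet> i) * \<phi> x))"
    by (rule integrable_Lp_mult_test_fun[OF in_Lp_inner[OF G assms(2)]
          smooth_fun_lebesgue_measurable[OF test_fun_smooth[OF assms(1)]]])
qed

lemma weak_grad_lincomb:
  assumes "in_Lp p \<Omega> u" "in_Lp p \<Omega> v" "in_Lp p \<Omega> G" "in_Lp p \<Omega> H"
    and "weak_grad \<Omega> u G" "weak_grad \<Omega> v H"
  shows "weak_grad \<Omega> (\<lambda>x. a * u x + b * v x) (\<lambda>x. a *\<^sub>R G x + b *\<^sub>R H x)"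
  unfolding weak_grad_def
proof (intro allI impI ballI)
  fix \<phi> :: "'a \<Rightarrow> real" and i :: 'a
  assume \<phi>: "test_fun \<Omega> \<phi>" and i: "i \<in> Basis"
  let ?u = "\<lambda>x. indicator \<Omega> x * (u x * frechet_derivative \<phi> (at x) i)"
  let ?v = "\<lambda>x. indicator \<Omega> x * (v x * frechet_derivative \<phi> (at x) i)"
  let ?G = "\<lambda>x. indicator \<Omega> x * ((G x \<bullet> i) * \<phi> x)"
  let ?H = "\<lambda>x. indicator \<Omega> x * ((H x \<bullet> i) * \<phi> x)"
  note int = integrable_weak_grad_terms[OF \<phi> i]
  have "(\<integral>x. indicator \<Omega> x * ((a * u x + b * v x) * frechet_derivative \<phi> (at x) i) \<partial>lebesgue)
      = (\<integral>x. a * ?u x + b * ?v x \<partial>lebesgue)"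
    by (intro Bochner_Integration.integral_cong) (auto simp: algebra_simps)
  also have "\<dots> = a * (\<integral>x. ?u x \<partial>lebesgue) + b * (\<integral>x. ?v x \<partial>lebesgue)"
    using int(1)[OF assms(1)] int(1)[OF assms(2)] by simp
  also have "\<dots> = - (a * (\<integral>x. ?G x \<partial>lebesgue) + b * (\<integral>x. ?H x \<partial>lebesgue))"
    using assms(5,6) \<phi> i by (simp add: weak_grad_def)
  also have "\<dots> = - (\<integral>x. a * ?G x + b * ?H x \<partial>lebesgue)"
    using int(2)[OF assms(3)] int(2)[OF assms(4)] by simp
  also have "(\<integral>x. a * ?G x + b * ?H x \<partial>lebesgue)
      = (\<integral>x. indicator \<Omega> x * (((a *\<^sub>R G x + b *\<^sub>R H x) \<bullet> i) * \<phi> x) \<partial>lebesgue)"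
    by (intro Bochner_Integration.integral_cong) (auto simp: algebra_simps)
  finally show "(\<integral>x. indicator \<Omega> x * ((a * u x + b * v x) * frechet_derivative \<phi> (at x) i) \<partial>lebesgue)
      = - (\<integral>x. indicator \<Omega> x * (((a *\<^sub>R G x + b *\<^sub>R H x) \<bullet> i) * \<phi> x) \<partial>lebesgue)" .
qed

text \<open>The gradient \<open>wgrad\<close> is picked by choice. Through this lemma it may be
  replaced almost everywhere by any explicitly known weak gradient.\<close>

lemma weak_grad_unique:
  assumes "in_Lp p \<Omega> G" "in_Lp p \<Omega> H" "weak_grad \<Omega> u G" "weak_grad \<Omega> u H"
  shows "AE x in lebesgue. x \<in> \<Omega> \<longrightarrow> G x = H x"
proof -
  have "AE x in lebesgue. x \<in> \<Omega> \<longrightarrow> (G x - H x) \<bullet> i = 0" if i: "i \<in> Basis" for i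
  proof (rule test_fun_orthogonal_imp_AE_eq_0[OF open_domain])
    have "in_Lp p \<Omega> (\<lambda>x. (G x - H x) \<bullet> i)"
      by (intro in_Lp_inner in_Lp_diff assms i)
    then show "integrable lebesgue (\<lambda>x. indicator \<Omega> x * ((G x - H x) \<bullet> i))"
      using integrable_Lp_mult_test_fun[of "\<lambda>x. (G x - H x) \<bullet> i" "\<lambda>x. 1" 1] by simp
  next
    fix \<phi> assume \<phi>: "test_fun \<Omega> \<phi>"
    have "(\<integral>x. indicator \<Omega> x * ((G x - H x) \<bullet> i * \<phi> x) \<partial>lebesgue)
        = (\<integral>x. indicator \<Omega> x * ((G x \<bullet> i) * \<phi> x) - indicator \<Omega> x * ((H x \<bullet> i) * \<phi> x) \<partial>lebesgue)"
      by (intro Bochner_Integration.integral_cong) (auto simp: algebra_simps)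
    also have "\<dots> = (\<integral>x. indicator \<Omega> x * ((G x \<bullet> i) * \<phi> x) \<partial>lebesgue)
        - (\<integral>x. indicator \<Omega> x * ((H x \<bullet> i) * \<phi> x) \<partial>lebesgue)"
      using integrable_weak_grad_terms(2)[OF \<phi> i] assms
      by (intro Bochner_Integration.integral_diff) auto
    also have "\<dots> = 0"
      using assms(3,4)[unfolded weak_grad_def, rule_format, OF \<phi> i] by linarith
    finally show "(\<integral>x. indicator \<Omega> x * ((G x - H x) \<bullet> i * \<phi> x) \<partial>lebesgue) = 0" .
  qed
  then have "AE x in lebesgue. \<forall>i\<in>Basis. x \<in> \<Omega> \<longrightarrow> (G x - H x) \<bullet> i = 0"
    by (subst AE_ball_countable) (auto simp: countable_finite)
  then show ?thesis
    by eventually_elim (simp add: inner_diff_left euclidean_eq_iff[where 'a = 'a])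
qed

subsection \<open>Sobolev spaces\<close>

lemma W1p_in_Lp: "W1p p \<Omega> u \<Longrightarrow> in_Lp p \<Omega> u"
  by (simp add: W1p_def Lp_fun_iff_in_Lp)

lemma wgrad_weak_grad:
  assumes "W1p p \<Omega> u"
  shows "in_Lp p \<Omega> (wgrad p \<Omega> u)" "weak_grad \<Omega> u (wgrad p \<Omega> u)"
  using assms someI_ex[of "\<lambda>G. Lp_vec p \<Omega> G \<and> weak_grad \<Omega> u G"]
  unfolding W1p_def wgrad_def Lp_vec_iff_in_Lp by blast+

lemma W1pI: "in_Lp p \<Omega> u \<Longrightarrow> in_Lp p \<Omega> G \<Longrightarrow> weak_grad \<Omega> u G \<Longrightarrow> W1p p \<Omega> u"
  by (auto simp: W1p_def Lp_fun_iff_in_Lp Lp_vec_iff_in_Lp)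

lemma wgrad_AE_eq:
  assumes "in_Lp p \<Omega> u" "in_Lp p \<Omega> G" "weak_grad \<Omega> u G"
  shows "AE x in lebesgue. x \<in> \<Omega> \<longrightarrow> wgrad p \<Omega> u x = G x"
  using weak_grad_unique[OF wgrad_weak_grad(1)[OF W1pI[OF assms]] assms(2)
      wgrad_weak_grad(2)[OF W1pI[OF assms]] assms(3)] .

lemma Lp_int_cong_AE:
  assumes "in_Lp p \<Omega> f" "in_Lp p \<Omega> g" "AE x in lebesgue. x \<in> \<Omega> \<longrightarrow> f x = g x"
  shows "Lp_int p \<Omega> f = Lp_int p \<Omega> g"
  unfolding Lp_int_def
  using assms(3)
  by (intro integral_cong_AE borel_measurable_integrable[OF in_Lp_integrable] assms)
    (auto elim!: eventually_mono simp: indicator_def)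

lemma W1p_lincomb:
  assumes "W1p p \<Omega> u" "W1p p \<Omega> v"
  shows "W1p p \<Omega> (\<lambda>x. a * u x + b * v x)"
    and "AE x in lebesgue. x \<in> \<Omega> \<longrightarrow>
      wgrad p \<Omega> (\<lambda>x. a * u x + b * v x) x = a *\<^sub>R wgrad p \<Omega> u x + b *\<^sub>R wgrad p \<Omega> v x"
    and "in_Lp p \<Omega> (\<lambda>x. a *\<^sub>R wgrad p \<Omega> u x + b *\<^sub>R wgrad p \<Omega> v x)"
proof -
  note u = W1p_in_Lp[OF assms(1)] wgrad_weak_grad[OF assms(1)]
  note v = W1p_in_Lp[OF assms(2)] wgrad_weak_grad[OF assms(2)]
  have 1: "in_Lp p \<Omega> (\<lambda>x. a * u x + b * v x)"
    using in_Lp_add[OF in_Lp_scaleR[OF u(1)] in_Lp_scaleR[OF v(1)]] by simp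
  show 2: "in_Lp p \<Omega> (\<lambda>x. a *\<^sub>R wgrad p \<Omega> u x + b *\<^sub>R wgrad p \<Omega> v x)"
    by (intro in_Lp_add in_Lp_scaleR u v)
  note 3 = weak_grad_lincomb[OF u(1) v(1) u(2) v(2) u(3) v(3), of a b]
  show "W1p p \<Omega> (\<lambda>x. a * u x + b * v x)" by (rule W1pI[OF 1 2 3])
  show "AE x in lebesgue. x \<in> \<Omega> \<longrightarrow>
      wgrad p \<Omega> (\<lambda>x. a * u x + b * v x) x = a *\<^sub>R wgrad p \<Omega> u x + b *\<^sub>R wgrad p \<Omega> v x"
    by (rule wgrad_AE_eq[OF 1 2 3])
qed

text \<open>This is the p-th power of \<open>W1p_norm\<close>. Unlike the norm it is a plain sum of
  integrals, so the estimates are made for it and transferred to the norm only where duality or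
  convergence in norm is involved.\<close>

definition energy :: "('a \<Rightarrow> real) \<Rightarrow> real" where
  "energy u = Lp_int p \<Omega> u + Lp_int p \<Omega> (wgrad p \<Omega> u)"

lemma energy_nonneg: "energy u \<ge> 0"
  by (simp add: energy_def Lp_int_nonneg)

lemma W1p_norm_eq: "W1p_norm p \<Omega> u = energy u powr (1 / p)"
  by (simp add: W1p_norm_def energy_def Lp_int_def)

lemma energy_eq_W1p_norm_powr: "energy u = W1p_norm p \<Omega> u powr p"
  using p_gt_1 energy_nonneg by (simp add: W1p_norm_eq powr_powr)

lemma W1p_norm_tendsto_0_iff:
  "(\<lambda>n. W1p_norm p \<Omega> (us n)) \<longlonglongrightarrow> 0 \<longleftrightarrow> (\<lambda>n. energy (us n)) \<longlonglongrightarrow> 0"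
proof
  assume "(\<lambda>n. W1p_norm p \<Omega> (us n)) \<longlonglongrightarrow> 0"
  then have "(\<lambda>n. W1p_norm p \<Omega> (us n) powr p) \<longlonglongrightarrow> 0 powr p"
    using p_gt_1 by (intro tendsto_powr') (auto intro!: tendsto_const simp: W1p_norm_eq)
  then show "(\<lambda>n. energy (us n)) \<longlonglongrightarrow> 0"
    by (simp add: energy_eq_W1p_norm_powr)
next
  assume "(\<lambda>n. energy (us n)) \<longlonglongrightarrow> 0"
  then have "(\<lambda>n. energy (us n) powr (1 / p)) \<longlonglongrightarrow> 0 powr (1 / p)"
    using p_gt_1 by (intro tendsto_powr') (auto intro!: tendsto_const simp: energy_nonneg)
  then show "(\<lambda>n. W1p_norm p \<Omega> (us n)) \<longlonglongrightarrow> 0"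
    by (simp add: W1p_norm_eq)
qed

lemma energy_eqI:
  assumes "in_Lp p \<Omega> u" "in_Lp p \<Omega> G" "weak_grad \<Omega> u G"
  shows "energy u = Lp_int p \<Omega> u + Lp_int p \<Omega> G"
  unfolding energy_def
  using Lp_int_cong_AE[OF wgrad_weak_grad(1)[OF W1pI[OF assms]] assms(2) wgrad_AE_eq[OF assms]] by simp

lemma energy_lincomb_le:
  assumes "W1p p \<Omega> u" "W1p p \<Omega> v"
  shows "energy (\<lambda>x. a * u x + b * v x) \<le> 2 powr p * (\<bar>a\<bar> powr p * energy u + \<bar>b\<bar> powr p * energy v)"
proof -
  note u = W1p_in_Lp[OF assms(1)] wgrad_weak_grad[OF assms(1)]
  note v = W1p_in_Lp[OF assms(2)] wgrad_weak_grad[OF assms(2)]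
  have "energy (\<lambda>x. a * u x + b * v x)
      = Lp_int p \<Omega> (\<lambda>x. a *\<^sub>R u x + b *\<^sub>R v x) + Lp_int p \<Omega> (\<lambda>x. a *\<^sub>R wgrad p \<Omega> u x + b *\<^sub>R wgrad p \<Omega> v x)"
    unfolding energy_def
    using Lp_int_cong_AE[OF wgrad_weak_grad(1)[OF W1p_lincomb(1)[OF assms]]
        W1p_lincomb(3)[OF assms] W1p_lincomb(2)[OF assms]] by simp
  also have "\<dots> \<le> 2 powr p * (\<bar>a\<bar> powr p * Lp_int p \<Omega> u + \<bar>b\<bar> powr p * Lp_int p \<Omega> v)
      + 2 powr p * (\<bar>a\<bar> powr p * Lp_int p \<Omega> (wgrad p \<Omega> u) + \<bar>b\<bar> powr p * Lp_int p \<Omega> (wgrad p \<Omega> v))"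
    unfolding Lp_int_scaleR[symmetric]
    by (intro add_mono Lp_int_add_le_double in_Lp_scaleR u v)
  also have "\<dots> = 2 powr p * (\<bar>a\<bar> powr p * energy u + \<bar>b\<bar> powr p * energy v)"
    by (simp add: energy_def algebra_simps)
  finally show ?thesis .
qed

lemma energy_scale:
  assumes "W1p p \<Omega> u"
  shows "energy (\<lambda>x. a * u x) = \<bar>a\<bar> powr p * energy u"
proof -
  note u = W1p_in_Lp[OF assms(1)] wgrad_weak_grad[OF assms(1)]
  have "weak_grad \<Omega> (\<lambda>x. a * u x) (\<lambda>x. a *\<^sub>R wgrad p \<Omega> u x)"
    using weak_grad_lincomb[OF u(1) u(1) u(2) u(2) u(3) u(3), of a 0] by simp
  then have "energy (\<lambda>x. a * u x) = Lp_int p \<Omega> (\<lambda>x. a *\<^sub>R u x) + Lp_int p \<Omega> (\<lambda>x. a *\<^sub>R wgrad p \<Omega> u x)"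
    using energy_eqI[OF _ in_Lp_scaleR[OF u(2)]] in_Lp_scaleR[OF u(1), of a] by simp
  then show ?thesis unfolding Lp_int_scaleR energy_def[of u] by (simp add: algebra_simps)
qed

lemma test_fun_in_Lp: "test_fun \<Omega> \<phi> \<Longrightarrow> in_Lp p \<Omega> \<phi>"
  by (metis in_Lp_bounded real_norm_def smooth_fun_lebesgue_measurable test_fun_bounded test_fun_smooth)

lemma test_grad_in_Lp: "test_fun \<Omega> \<phi> \<Longrightarrow> in_Lp p \<Omega> (test_grad \<phi>)"
  by (metis in_Lp_bounded test_grad_bounded test_grad_measurable test_fun_smooth)

lemma test_fun_W1p: "test_fun \<Omega> \<phi> \<Longrightarrow> W1p p \<Omega> \<phi>"
  by (rule W1pI[OF test_fun_in_Lp test_grad_in_Lp weak_grad_test_fun])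

text \<open>The chosen gradient of the zero function is known only almost everywhere; homogeneity
  with factor 0 avoids looking at it.\<close>

lemma energy_zero: "energy (\<lambda>x. 0) = 0"
proof -
  have "W1p p \<Omega> (\<lambda>x. 0)"
    by (rule test_fun_W1p) (simp add: test_fun_def smooth_fun_const)
  from energy_scale[OF this, of 0] show ?thesis using p_gt_1 by simp
qed

lemma test_fun_W1p0:
  assumes "test_fun \<Omega> \<phi>"
  shows "\<phi> \<in> W1p0 p \<Omega>"
proof -
  have "(\<lambda>n::nat. W1p_norm p \<Omega> (\<lambda>x. \<phi> x - \<phi> x)) \<longlonglongrightarrow> 0"
    unfolding W1p_norm_tendsto_0_iff by (simp add: energy_zero)
  then show ?thesis
    unfolding W1p0_def
    using assms test_fun_W1p[OF assms] test_fun_outside[OF assms]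
    by (auto intro!: exI[of _ "\<lambda>n. \<phi>"])
qed

lemma W1p0_W1p: "u \<in> W1p0 p \<Omega> \<Longrightarrow> W1p p \<Omega> u"
  by (simp add: W1p0_def)

lemma W1p0_approx:
  assumes "u \<in> W1p0 p \<Omega>"
  obtains \<phi> where "\<And>n. test_fun \<Omega> (\<phi> n)" "(\<lambda>n. energy (\<lambda>x. \<phi> n x - u x)) \<longlonglongrightarrow> 0"
  using assms unfolding W1p0_def W1p_norm_tendsto_0_iff by blast

lemma W1p0_lincomb:
  assumes u: "u \<in> W1p0 p \<Omega>" and v: "v \<in> W1p0 p \<Omega>"
  shows "(\<lambda>x. a * u x + b * v x) \<in> W1p0 p \<Omega>"
proof -
  obtain \<phi> where \<phi>: "\<And>n. test_fun \<Omega> (\<phi> n)" "(\<lambda>n. energy (\<lambda>x. \<phi> n x - u x)) \<longlonglongrightarrow> 0"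
    using W1p0_approx[OF u] by blast
  obtain \<psi> where \<psi>: "\<And>n. test_fun \<Omega> (\<psi> n)" "(\<lambda>n. energy (\<lambda>x. \<psi> n x - v x)) \<longlonglongrightarrow> 0"
    using W1p0_approx[OF v] by blast
  define \<theta> where "\<theta> n x = a * \<phi> n x + b * \<psi> n x" for n x
  have "test_fun \<Omega> (\<theta> n)" for n
    unfolding \<theta>_def by (intro test_fun_add test_fun_cmult \<phi> \<psi>)
  moreover have "(\<lambda>n. energy (\<lambda>x. \<theta> n x - (a * u x + b * v x))) \<longlonglongrightarrow> 0"
  proof (rule tendsto_sandwich[OF _ _ tendsto_const])
    show "\<forall>\<^sub>F n in sequentially. 0 \<le> energy (\<lambda>x. \<theta> n x - (a * u x + b * v x))"
      by (simp add: energy_nonneg)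
    have "energy (\<lambda>x. \<theta> n x - (a * u x + b * v x))
      \<le> 2 powr p * (\<bar>a\<bar> powr p * energy (\<lambda>x. \<phi> n x - u x) + \<bar>b\<bar> powr p * energy (\<lambda>x. \<psi> n x - v x))" for n
    proof -
      have "W1p p \<Omega> (\<lambda>x. \<phi> n x - u x)" "W1p p \<Omega> (\<lambda>x. \<psi> n x - v x)"
        using W1p_lincomb(1)[OF test_fun_W1p[OF \<phi>(1)] W1p0_W1p[OF u], of 1 n "-1"]
          W1p_lincomb(1)[OF test_fun_W1p[OF \<psi>(1)] W1p0_W1p[OF v], of 1 n "-1"] by auto
      from energy_lincomb_le[OF this, of a b] show ?thesis
        by (simp add: \<theta>_def algebra_simps)
    qed
    then show "\<forall>\<^sub>F n in sequentially. energy (\<lambda>x. \<theta> n x - (a * u x + b * v x))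
      \<le> 2 powr p * (\<bar>a\<bar> powr p * energy (\<lambda>x. \<phi> n x - u x) + \<bar>b\<bar> powr p * energy (\<lambda>x. \<psi> n x - v x))"
      by simp
    show "(\<lambda>n. 2 powr p * (\<bar>a\<bar> powr p * energy (\<lambda>x. \<phi> n x - u x) + \<bar>b\<bar> powr p * energy (\<lambda>x. \<psi> n x - v x))) \<longlonglongrightarrow> 0"
      using \<phi>(2) \<psi>(2) by (auto intro!: tendsto_eq_intros)
  qed
  ultimately show ?thesis
    using W1p_lincomb(1)[OF W1p0_W1p[OF u] W1p0_W1p[OF v], of a b] u v
    unfolding W1p0_def W1p_norm_tendsto_0_iff by auto
qed

lemma weak_conv_if_energy_tendsto_0:
  assumes us: "\<And>k. us k \<in> W1p0 p \<Omega>" and u: "u \<in> W1p0 p \<Omega>"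
    and lim: "(\<lambda>k. energy (\<lambda>x. us k x - u x)) \<longlonglongrightarrow> 0"
  shows "weak_conv_W1p0 p \<Omega> us u"
  unfolding weak_conv_W1p0_def
proof (intro allI impI)
  fix L assume L: "W1p0_dual p \<Omega> L"
  then obtain C where C: "\<And>v. v \<in> W1p0 p \<Omega> \<Longrightarrow> \<bar>L v\<bar> \<le> C * W1p_norm p \<Omega> v"
    unfolding W1p0_dual_def by blast
  have "norm (L (us k) - L u) \<le> C * W1p_norm p \<Omega> (\<lambda>x. us k x - u x)" for k
  proof -
    have "L (\<lambda>x. 1 * us k x + (-1) * u x) = 1 * L (us k) + (-1) * L u"
      using L us u unfolding W1p0_dual_def by blast
    moreover have "(\<lambda>x. us k x - u x) \<in> W1p0 p \<Omega>"
      using W1p0_lincomb[OF us u, of 1 k "-1"] by simp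
    ultimately show ?thesis using C[of "\<lambda>x. us k x - u x"] by simp
  qed
  moreover have "(\<lambda>k. C * W1p_norm p \<Omega> (\<lambda>x. us k x - u x)) \<longlonglongrightarrow> 0"
    by (rule tendsto_mult_right_zero[OF W1p_norm_tendsto_0_iff[THEN iffD2, OF lim]])
  ultimately have "(\<lambda>k. L (us k) - L u) \<longlonglongrightarrow> 0"
    by (rule Lim_null_comparison[OF always_eventually[OF allI]])
  then show "(\<lambda>k. L (us k)) \<longlonglongrightarrow> L u" by (simp add: LIM_zero_iff)
qed

end

subsection \<open>The lower bound\<close>

text \<open>Required for Tonelli's theorem in the nonlocal double integral.\<close>

lemma sigma_finite_lebesgue: "sigma_finite_measure (lebesgue :: 'a::euclidean_space measure)"
proof
  have "(\<Union>n. ball (0::'a) (real n)) = UNIV"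
    by (auto intro: reals_Archimedean2)
  then show "\<exists>A::'a set set. countable A \<and> A \<subseteq> sets lebesgue \<and> \<Union> A = space lebesgue
      \<and> (\<forall>a\<in>A. emeasure lebesgue a \<noteq> \<infinity>)"
    using emeasure_lborel_ball_finite[of "0::'a"]
    by (intro exI[of _ "range (\<lambda>n. ball (0::'a) (real n))"]) (auto simp: less_top)
qed

context Lp_domain
begin

lemma nn_integral_eq_Lp_int:
  assumes "in_Lp p \<Omega> f"
  shows "(\<integral>\<^sup>+ x. ennreal (norm (f x) powr p) * indicator \<Omega> x \<partial>lebesgue) = ennreal (Lp_int p \<Omega> f)"
proof -
  have "(\<integral>\<^sup>+ x. ennreal (norm (f x) powr p) * indicator \<Omega> x \<partial>lebesgue)
      = (\<integral>\<^sup>+ x. ennreal (indicator \<Omega> x * norm (f x) powr p) \<partial>lebesgue)"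
    by (intro nn_integral_cong) (auto simp: indicator_def)
  also have "\<dots> = ennreal (Lp_int p \<Omega> f)"
    unfolding Lp_int_def by (intro nn_integral_eq_integral in_Lp_integrable assms) auto
  finally show ?thesis .
qed

lemma F_lim_eq:
  assumes "W1p p \<Omega> u"
  shows "F_lim p \<Omega> u = ennreal (Lp_int p \<Omega> (\<lambda>x. u x - m_p p \<Omega> u) + Lp_int p \<Omega> (wgrad p \<Omega> u))"
  unfolding F_lim_def
  using nn_integral_eq_Lp_int[OF in_Lp_diff[OF W1p_in_Lp[OF assms] in_Lp_const], of "m_p p \<Omega> u"]
    nn_integral_eq_Lp_int[OF wgrad_weak_grad(1)[OF assms]]
  by (simp add: Lp_int_nonneg)

text \<open>After exchanging the integrals, the nonlocal term is the average over y of
  \<open>Lp_int\<close> of v shifted by the number v y. A bound valid for all shifts survives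
  averaging, whatever values v takes on the ball.\<close>

lemma F_eps_ge:
  assumes v: "W1p p \<Omega> v" and "e > 0" and a: "\<And>t. a \<le> Lp_int p \<Omega> (\<lambda>x. v x - t)"
  shows "ennreal (a + Lp_int p \<Omega> (wgrad p \<Omega> v)) \<le> F_eps p \<Omega> e v"
proof -
  let ?B = "ball (0::'a) e"
  note vL = W1p_in_Lp[OF v]
  note vm[measurable] = in_Lp_measurable[OF vL]
  interpret pair_sigma_finite "lebesgue :: 'a measure" "lebesgue :: 'a measure"
    using sigma_finite_lebesgue by (simp add: pair_sigma_finite_def)
  \<comment> \<open>The bound \<open>a\<close> comes from an affine function and may be negative.
    Its positive part is still a bound, and \<open>ennreal\<close> is additive on nonnegative
    numbers.\<close>
  define b where "b = max 0 a"
  have Bs[measurable]: "?B \<in> sets lebesgue" by simp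
  have Bfin: "emeasure lebesgue ?B = ennreal (measure lebesgue ?B)"
    using emeasure_lborel_ball_finite[of "0::'a" e] by (simp add: emeasure_eq_ennreal_measure less_top)
  have Bpos: "measure lebesgue ?B > 0"
    using \<open>e > 0\<close> by simp
  have meas: "(\<lambda>(x, y). ennreal (\<bar>v x - v y\<bar> powr p) * indicator ?B y * indicator \<Omega> x)
      \<in> borel_measurable (lebesgue \<Otimes>\<^sub>M lebesgue)"
    by measurable
  have "ennreal b = ennreal (1 / measure lebesgue ?B) * (ennreal b * emeasure lebesgue ?B)"
  proof -
    have "b = 1 / measure lebesgue ?B * (b * measure lebesgue ?B)" using Bpos by simp
    then show ?thesis unfolding Bfin by (metis b_def ennreal_mult' ennreal_mult'' max.cobounded1
        measure_nonneg mult_nonneg_nonneg zero_le_divide_1_iff)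
  qed
  also have "ennreal b * emeasure lebesgue ?B = (\<integral>\<^sup>+ y. ennreal b * indicator ?B y \<partial>lebesgue)"
    by (simp add: nn_integral_cmult_indicator)
  also have "\<dots> \<le> (\<integral>\<^sup>+ y. ennreal (Lp_int p \<Omega> (\<lambda>x. v x - v y)) * indicator ?B y \<partial>lebesgue)"
    using a Lp_int_nonneg by (intro nn_integral_mono mult_right_mono ennreal_leI) (auto simp: b_def)
  also have "\<dots> = (\<integral>\<^sup>+ y. \<integral>\<^sup>+ x. ennreal (\<bar>v x - v y\<bar> powr p) * indicator ?B y * indicator \<Omega> x \<partial>lebesgue \<partial>lebesgue)"
  proof (rule nn_integral_cong)
    fix y
    have "(\<integral>\<^sup>+ x. ennreal (\<bar>v x - v y\<bar> powr p) * indicator ?B y * indicator \<Omega> x \<partial>lebesgue)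
        = (\<integral>\<^sup>+ x. ennreal (norm (v x - v y) powr p) * indicator \<Omega> x * indicator ?B y \<partial>lebesgue)"
      by (intro nn_integral_cong) (simp add: ac_simps)
    also have "\<dots> = (\<integral>\<^sup>+ x. ennreal (norm (v x - v y) powr p) * indicator \<Omega> x \<partial>lebesgue) * indicator ?B y"
      by (intro nn_integral_multc) measurable
    also have "\<dots> = ennreal (Lp_int p \<Omega> (\<lambda>x. v x - v y)) * indicator ?B y"
      using nn_integral_eq_Lp_int[OF in_Lp_diff[OF vL in_Lp_const], of "v y"] by simp
    finally show "ennreal (Lp_int p \<Omega> (\<lambda>x. v x - v y)) * indicator ?B y
        = (\<integral>\<^sup>+ x. ennreal (\<bar>v x - v y\<bar> powr p) * indicator ?B y * indicator \<Omega> x \<partial>lebesgue)" ..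
  qed
  also have "\<dots> = (\<integral>\<^sup>+ x. \<integral>\<^sup>+ y. ennreal (\<bar>v x - v y\<bar> powr p) * indicator ?B y * indicator \<Omega> x \<partial>lebesgue \<partial>lebesgue)"
    using meas by (rule Fubini')
  also have "\<dots> = (\<integral>\<^sup>+ x. (\<integral>\<^sup>+ y. ennreal (\<bar>v x - v y\<bar> powr p) * indicator ?B y \<partial>lebesgue) * indicator \<Omega> x \<partial>lebesgue)"
    by (intro nn_integral_cong nn_integral_multc) measurable
  finally have "ennreal b \<le> ennreal (1 / measure lebesgue ?B) *
      (\<integral>\<^sup>+ x. (\<integral>\<^sup>+ y. ennreal (\<bar>v x - v y\<bar> powr p) * indicator ?B y \<partial>lebesgue) * indicator \<Omega> x \<partial>lebesgue)"
    by (simp add: mult_left_mono)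
  then have "ennreal b + ennreal (Lp_int p \<Omega> (wgrad p \<Omega> v)) \<le> F_eps p \<Omega> e v"
    unfolding F_eps_def nn_integral_eq_Lp_int[OF wgrad_weak_grad(1)[OF v]] by (intro add_right_mono)
  moreover have "ennreal (a + Lp_int p \<Omega> (wgrad p \<Omega> v)) \<le> ennreal b + ennreal (Lp_int p \<Omega> (wgrad p \<Omega> v))"
  proof -
    have "ennreal (a + Lp_int p \<Omega> (wgrad p \<Omega> v)) \<le> ennreal (b + Lp_int p \<Omega> (wgrad p \<Omega> v))"
      by (intro ennreal_leI) (simp add: b_def)
    also have "\<dots> = ennreal b + ennreal (Lp_int p \<Omega> (wgrad p \<Omega> v))"
      by (intro ennreal_plus) (auto simp: b_def Lp_int_nonneg)
    finally show ?thesis .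
  qed
  ultimately show ?thesis by (rule order_trans[rotated])
qed

text \<open>The homogeneity of \<open>L\<close> and of the norm turns an affine bound into a linear one.\<close>
lemma W1p0_dualI:
  assumes lin: "\<And>u v a b. u \<in> W1p0 p \<Omega> \<Longrightarrow> v \<in> W1p0 p \<Omega> \<Longrightarrow>
      L (\<lambda>x. a * u x + b * v x) = a * L u + b * L v"
    and bound: "\<And>v. v \<in> W1p0 p \<Omega> \<Longrightarrow> \<bar>L v\<bar> \<le> A + energy v"
  shows "W1p0_dual p \<Omega> L"
proof -
  have hom: "\<bar>a\<bar> * \<bar>L v\<bar> \<le> A + \<bar>a\<bar> powr p * energy v" if v: "v \<in> W1p0 p \<Omega>" for a v
  proof -
    have "(\<lambda>x. a * v x) \<in> W1p0 p \<Omega>" "L (\<lambda>x. a * v x) = a * L v"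
      using W1p0_lincomb[OF v v, of a 0] lin[OF v v, of a 0] by simp_all
    then show ?thesis
      using bound[of "\<lambda>x. a * v x"] energy_scale[OF W1p0_W1p[OF v], of a] by (simp add: abs_mult)
  qed
  have "\<bar>L v\<bar> \<le> (A + 1) * W1p_norm p \<Omega> v" if v: "v \<in> W1p0 p \<Omega>" for v
  proof (cases "W1p_norm p \<Omega> v = 0")
    case True
    then have "energy v = 0" using p_gt_1 by (simp add: energy_eq_W1p_norm_powr)
    \<comment> \<open>With zero energy every multiple of v obeys the same bound A, which forces L v
      = 0.\<close>
    then have le: "\<bar>a\<bar> * \<bar>L v\<bar> \<le> A" for a using hom[OF v, of a] by simp
    have "L v = 0"
    proof (rule ccontr)
      assume "L v \<noteq> 0"
      moreover have "A \<ge> 0" using le[of 0] by simp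
      ultimately show False using le[of "(A + 1) / \<bar>L v\<bar>"] by simp
    qed
    then show ?thesis using True by simp
  next
    case False
    define N where "N = W1p_norm p \<Omega> v"
    have N: "N > 0" using False by (simp add: N_def W1p_norm_eq less_le)
    \<comment> \<open>Rescaled to norm 1, the function has energy 1, and the affine bound becomes
      the operator bound A + 1.\<close>
    have "\<bar>1 / N\<bar> powr p * energy v = 1"
      using N by (simp add: energy_eq_W1p_norm_powr powr_divide flip: N_def)
    then have "\<bar>1 / N\<bar> * \<bar>L v\<bar> \<le> A + 1" using hom[OF v, of "1 / N"] by simp
    then show ?thesis using N by (simp add: N_def[symmetric] field_simps)
  qed
  then show ?thesis unfolding W1p0_dual_def using lin by blast
qed

text \<open>The directional derivative of the limit functional at u along v. The dependence of the
  p-mean on u contributes nothing to first order, because the p-mean is a minimum point.\<close>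

definition limit_derivative :: "('a \<Rightarrow> real) \<Rightarrow> ('a \<Rightarrow> real) \<Rightarrow> real" where
  "limit_derivative u v = (\<integral>x. indicator \<Omega> x * (powr_grad p (u x - m_p p \<Omega> u) \<bullet> v x) \<partial>lebesgue)
     + (\<integral>x. indicator \<Omega> x * (powr_grad p (wgrad p \<Omega> u x) \<bullet> wgrad p \<Omega> v x) \<partial>lebesgue)"

lemma integral_powr_grad_inner_lincomb:
  assumes "in_Lp p \<Omega> f" "in_Lp p \<Omega> g" "in_Lp p \<Omega> h"
  shows "(\<integral>x. indicator \<Omega> x * (powr_grad p (f x) \<bullet> (a *\<^sub>R g x + b *\<^sub>R h x)) \<partial>lebesgue)
      = a * (\<integral>x. indicator \<Omega> x * (powr_grad p (f x) \<bullet> g x) \<partial>lebesgue)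
        + b * (\<integral>x. indicator \<Omega> x * (powr_grad p (f x) \<bullet> h x) \<partial>lebesgue)"
proof -
  have "(\<integral>x. indicator \<Omega> x * (powr_grad p (f x) \<bullet> (a *\<^sub>R g x + b *\<^sub>R h x)) \<partial>lebesgue)
      = (\<integral>x. a * (indicator \<Omega> x * (powr_grad p (f x) \<bullet> g x)) + b * (indicator \<Omega> x * (powr_grad p (f x) \<bullet> h x)) \<partial>lebesgue)"
    by (intro Bochner_Integration.integral_cong) (auto simp: inner_add_right algebra_simps)
  then show ?thesis
    using integrable_powr_grad_inner(1)[OF assms(1,2)] integrable_powr_grad_inner(1)[OF assms(1,3)]
    by simp
qed

text \<open>Linearity rests on \<open>wgrad\<close> being linear almost everywhere, and continuity
  on the Young bound, which is affine in the energy of v.\<close>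

lemma W1p0_dual_limit_derivative:
  assumes "u \<in> W1p0 p \<Omega>"
  shows "W1p0_dual p \<Omega> (limit_derivative u)"
proof (rule W1p0_dualI)
  define m where "m = m_p p \<Omega> u"
  note u = W1p_in_Lp[OF W1p0_W1p[OF assms]] wgrad_weak_grad[OF W1p0_W1p[OF assms]]
  have um: "in_Lp p \<Omega> (\<lambda>x. u x - m)" by (intro in_Lp_diff u in_Lp_const)
  {
    fix v w a b assume v: "v \<in> W1p0 p \<Omega>" and w: "w \<in> W1p0 p \<Omega>"
    note v' = W1p_in_Lp[OF W1p0_W1p[OF v]] wgrad_weak_grad(1)[OF W1p0_W1p[OF v]]
    note w' = W1p_in_Lp[OF W1p0_W1p[OF w]] wgrad_weak_grad(1)[OF W1p0_W1p[OF w]]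
    note vw = W1p_lincomb[OF W1p0_W1p[OF v] W1p0_W1p[OF w], of a b]
    have "(\<integral>x. indicator \<Omega> x * (powr_grad p (wgrad p \<Omega> u x) \<bullet> wgrad p \<Omega> (\<lambda>x. a * v x + b * w x) x) \<partial>lebesgue)
        = (\<integral>x. indicator \<Omega> x * (powr_grad p (wgrad p \<Omega> u x) \<bullet> (a *\<^sub>R wgrad p \<Omega> v x + b *\<^sub>R wgrad p \<Omega> w x)) \<partial>lebesgue)"
      using vw(2)
      by (intro integral_cong_AE borel_measurable_integrable integrable_powr_grad_inner(1) u vw(3)
          wgrad_weak_grad(1)[OF vw(1)]) (auto elim!: eventually_mono simp: indicator_def)
    then show "limit_derivative u (\<lambda>x. a * v x + b * w x) = a * limit_derivative u v + b * limit_derivative u w"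
      using integral_powr_grad_inner_lincomb[OF u(2) v'(2) w'(2), of a b]
        integral_powr_grad_inner_lincomb[OF um v'(1) w'(1), of a b]
      unfolding limit_derivative_def by (simp add: m_def algebra_simps)
  }
  fix v assume v: "v \<in> W1p0 p \<Omega>"
  note v' = W1p_in_Lp[OF W1p0_W1p[OF v]] wgrad_weak_grad(1)[OF W1p0_W1p[OF v]]
  show "\<bar>limit_derivative u v\<bar> \<le> (p - 1) * Lp_int p \<Omega> (\<lambda>x. u x - m) + (p - 1) * Lp_int p \<Omega> (wgrad p \<Omega> u) + energy v"
    using integrable_powr_grad_inner(2)[OF um v'(1)] integrable_powr_grad_inner(2)[OF u(2) v'(2)]
    unfolding limit_derivative_def energy_def m_def by linarith
qed

lemma F_eps_ge_tangent:
  assumes u: "u \<in> W1p0 p \<Omega>" and v: "v \<in> W1p0 p \<Omega>" and "e > 0" "\<Omega> \<noteq> {}"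
  shows "ennreal (Lp_int p \<Omega> (\<lambda>x. u x - m_p p \<Omega> u) + Lp_int p \<Omega> (wgrad p \<Omega> u)
      + (limit_derivative u v - limit_derivative u u)) \<le> F_eps p \<Omega> e v"
proof -
  define m where "m = m_p p \<Omega> u"
  note u' = W1p_in_Lp[OF W1p0_W1p[OF u]] wgrad_weak_grad(1)[OF W1p0_W1p[OF u]]
  note v' = W1p_in_Lp[OF W1p0_W1p[OF v]] wgrad_weak_grad(1)[OF W1p0_W1p[OF v]]
  have um: "in_Lp p \<Omega> (\<lambda>x. u x - m)" by (intro in_Lp_diff u' in_Lp_const)
  let ?I = "\<lambda>w. \<integral>x. indicator \<Omega> x * (powr_grad p (u x - m) \<bullet> w x) \<partial>lebesgue"
  let ?J = "\<lambda>w. \<integral>x. indicator \<Omega> x * (powr_grad p (wgrad p \<Omega> u x) \<bullet> w x) \<partial>lebesgue"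
  have "Lp_int p \<Omega> (\<lambda>x. u x - m) + (?I v - ?I u) \<le> Lp_int p \<Omega> (\<lambda>x. v x - t)" for t
  proof -
    have vu: "in_Lp p \<Omega> (\<lambda>x. v x - u x)" by (intro in_Lp_diff u' v')
    \<comment> \<open>The increment splits into v - u and the constant m - t. The constant part is
      annihilated by the optimality of m, so the bound is the same for all t, as
      \<open>F_eps_ge\<close> demands.\<close>
    have "?I (\<lambda>x. (v x - t) - (u x - m)) = ?I (\<lambda>x. 1 *\<^sub>R (v x - u x) + (m - t) *\<^sub>R 1)"
      by (simp add: algebra_simps)
    also have "\<dots> = 1 * ?I (\<lambda>x. v x - u x) + (m - t) * ?I (\<lambda>x. 1)"
      by (rule integral_powr_grad_inner_lincomb[OF um vu in_Lp_const])
    also have "?I (\<lambda>x. 1) = 0"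
      using integral_powr_grad_m_p[OF u'(1) \<open>\<Omega> \<noteq> {}\<close>] by (simp add: m_def)
    also have "?I (\<lambda>x. v x - u x) = ?I v - ?I u"
      using integral_powr_grad_inner_lincomb[OF um v'(1) u'(1), of 1 "-1"] by simp
    finally show ?thesis
      using Lp_int_ge_tangent[OF um in_Lp_diff[OF v'(1) in_Lp_const], of t] by simp
  qed
  from F_eps_ge[OF W1p0_W1p[OF v] \<open>e > 0\<close> this]
  have "ennreal (Lp_int p \<Omega> (\<lambda>x. u x - m) + (?I v - ?I u) + Lp_int p \<Omega> (wgrad p \<Omega> v)) \<le> F_eps p \<Omega> e v" .
  moreover have "Lp_int p \<Omega> (wgrad p \<Omega> u) + (?J (wgrad p \<Omega> v) - ?J (wgrad p \<Omega> u)) \<le> Lp_int p \<Omega> (wgrad p \<Omega> v)"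
    using Lp_int_ge_tangent[OF u'(2) v'(2)]
      integral_powr_grad_inner_lincomb[OF u'(2) v'(2) u'(2), of 1 "-1"] by simp
  ultimately show ?thesis
    unfolding limit_derivative_def m_def[symmetric]
    by (elim order_trans[rotated]) (auto intro!: ennreal_leI)
qed

lemma liminf_inequality:
  assumes u: "u \<in> W1p0 p \<Omega>" and us: "\<And>k. us k \<in> W1p0 p \<Omega>" and conv: "weak_conv_W1p0 p \<Omega> us u"
    and "\<And>k. \<epsilon> k > 0" "\<Omega> \<noteq> {}"
  shows "F_lim p \<Omega> u \<le> liminf (\<lambda>k. F_eps p \<Omega> (\<epsilon> k) (us k))"
proof -
  define A where "A = Lp_int p \<Omega> (\<lambda>x. u x - m_p p \<Omega> u) + Lp_int p \<Omega> (wgrad p \<Omega> u)"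
  have "(\<lambda>k. limit_derivative u (us k)) \<longlonglongrightarrow> limit_derivative u u"
    using conv W1p0_dual_limit_derivative[OF u] unfolding weak_conv_W1p0_def by blast
  then have "(\<lambda>k. A + (limit_derivative u (us k) - limit_derivative u u)) \<longlonglongrightarrow> A + (limit_derivative u u - limit_derivative u u)"
    by (intro tendsto_intros)
  then have "(\<lambda>k. ennreal (A + (limit_derivative u (us k) - limit_derivative u u))) \<longlonglongrightarrow> ennreal A"
    by (intro tendsto_ennrealI) simp
  then have "ennreal A = liminf (\<lambda>k. ennreal (A + (limit_derivative u (us k) - limit_derivative u u)))"
    by (simp add: lim_imp_Liminf)
  also have "\<dots> \<le> liminf (\<lambda>k. F_eps p \<Omega> (\<epsilon> k) (us k))"
    unfolding A_def using F_eps_ge_tangent[OF u us assms(4,5)] by (intro Liminf_mono always_eventually) auto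
  finally show ?thesis
    by (simp add: A_def F_lim_eq[OF W1p0_W1p[OF u]])
qed

end

subsection \<open>Points have zero capacity\<close>

text \<open>Dilations precompose with a map of the whole space, whereas
  \<open>differentiable_times_compose\<close> treats outer functions on the real line.\<close>

lemma differentiable_times_scale:
  "differentiable_times n f \<Longrightarrow> differentiable_times n (\<lambda>x. f (c *\<^sub>R x))"
  and frechet_derivative_scale:
  "f differentiable (at (c *\<^sub>R x)) \<Longrightarrow>
    frechet_derivative (\<lambda>x. f (c *\<^sub>R x)) (at x) = (\<lambda>v. c * frechet_derivative f (at (c *\<^sub>R x)) v)"
proof -
  have hd: "((\<lambda>x. f (c *\<^sub>R x)) has_derivative (\<lambda>v. c * frechet_derivative f (at (c *\<^sub>R x)) v)) (at x)"
    if f: "f differentiable (at (c *\<^sub>R x))" for f :: "'a \<Rightarrow> real" and x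
  proof -
    have fd: "(f has_derivative frechet_derivative f (at (c *\<^sub>R x))) (at (c *\<^sub>R x))"
      using f by (simp add: frechet_derivative_works)
    have "((\<lambda>x. c *\<^sub>R x) has_derivative (\<lambda>v. c *\<^sub>R v)) (at x)"
      by (auto intro!: derivative_eq_intros)
    then have "((\<lambda>x. f (c *\<^sub>R x)) has_derivative (\<lambda>v. frechet_derivative f (at (c *\<^sub>R x)) (c *\<^sub>R v))) (at x)"
      using fd by (rule has_derivative_compose)
    moreover have "frechet_derivative f (at (c *\<^sub>R x)) (c *\<^sub>R v) = c * frechet_derivative f (at (c *\<^sub>R x)) v" for v
      using linear_scale[OF has_derivative_linear[OF fd], of c v] by simp
    ultimately show ?thesis by simp
  qed
  show D: "f differentiable (at (c *\<^sub>R x)) \<Longrightarrow>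
      frechet_derivative (\<lambda>x. f (c *\<^sub>R x)) (at x) = (\<lambda>v. c * frechet_derivative f (at (c *\<^sub>R x)) v)"
    for f :: "'a \<Rightarrow> real" and x
    by (rule frechet_derivative_eqI[OF hd])
  show "differentiable_times n f \<Longrightarrow> differentiable_times n (\<lambda>x. f (c *\<^sub>R x))" for f :: "'a \<Rightarrow> real"
  proof (induction n arbitrary: f)
    case (Suc n)
    then have f: "\<And>x. f differentiable (at x)"
      and IH: "\<And>v. differentiable_times n (\<lambda>x. frechet_derivative f (at (c *\<^sub>R x)) v)"
      by auto
    have "(\<lambda>x. f (c *\<^sub>R x)) differentiable (at x)" for x
      using hd[OF f] by (rule differentiableI)
    then show ?case
      unfolding differentiable_times.simps D[OF f]
      by (intro conjI allI differentiable_times_mult differentiable_times_const IH) auto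
  qed simp
qed

lemma smooth_fun_scale: "smooth_fun f \<Longrightarrow> smooth_fun (\<lambda>x. f (c *\<^sub>R x))"
  unfolding smooth_fun_iff_differentiable_times by (intro allI differentiable_times_scale) blast

lemma test_grad_scale:
  assumes "smooth_fun f"
  shows "test_grad (\<lambda>x. f (c *\<^sub>R x)) x = c *\<^sub>R test_grad f (c *\<^sub>R x)"
  unfolding test_grad_def frechet_derivative_scale[OF smooth_fun_differentiable[OF assms]]
  by (simp add: scaleR_sum_right)

lemma test_grad_eqI:
  assumes "(f has_derivative (\<lambda>v. G \<bullet> v)) (at x)"
  shows "test_grad f x = G"
  unfolding test_grad_def frechet_derivative_eqI[OF assms] by (rule euclidean_representation)

lemma smooth_fun_has_derivative_test_grad:
  assumes "smooth_fun f"
  shows "(f has_derivative (\<lambda>v. test_grad f x \<bullet> v)) (at x)"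
proof -
  have fd: "(f has_derivative frechet_derivative f (at x)) (at x)"
    using smooth_fun_differentiable[OF assms] by (simp add: frechet_derivative_works)
  have "frechet_derivative f (at x) v = test_grad f x \<bullet> v" for v
  proof -
    have "frechet_derivative f (at x) v = frechet_derivative f (at x) (\<Sum>i\<in>Basis. (v \<bullet> i) *\<^sub>R i)"
      by (simp add: euclidean_representation)
    also have "\<dots> = (\<Sum>i\<in>Basis. (v \<bullet> i) * frechet_derivative f (at x) i)"
      using has_derivative_linear[OF fd] by (simp add: linear_sum linear_scale)
    also have "\<dots> = test_grad f x \<bullet> v"
      unfolding test_grad_def inner_sum_left inner_scaleR_left
      by (intro sum.cong) (auto simp: inner_commute)
    finally show ?thesis .
  qed
  then have "frechet_derivative f (at x) = (\<lambda>v. test_grad f x \<bullet> v)" by (rule ext)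
  with fd show ?thesis by metis
qed

lemma test_fun_cutoff: "test_fun UNIV cutoff"
  by (rule test_funI[OF smooth_fun_cutoff, of "cball 0 2"]) (auto simp: cutoff_eq_0)

text \<open>The cutoff is constant on each of these two open sets, so its gradient lives on an
  annulus of radius ratio 2.\<close>

lemma test_grad_cutoff_eq_0:
  assumes "norm x < 1 \<or> 2 < norm x"
  shows "test_grad cutoff x = 0"
proof (rule test_grad_eqI)
  have *: "((\<lambda>x::'a. c) has_derivative (\<lambda>v. 0 \<bullet> v)) (at x)" for c :: real by simp
  show "(cutoff has_derivative (\<lambda>v. 0 \<bullet> v)) (at x)"
  proof (cases "norm x < 1")
    case True
    show ?thesis
      by (rule has_derivative_transform_within_open[OF *[of 1], where s = "ball 0 1"])
        (use True in \<open>auto simp: cutoff_eq_1\<close>)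
  next
    case False
    show ?thesis
      by (rule has_derivative_transform_within_open[OF *[of 0], where s = "- cball 0 2"])
        (use False assms in \<open>auto simp: cutoff_eq_0\<close>)
  qed
qed

text \<open>An average of cutoffs at \<open>N\<close> scales, whose gradients have disjoint supports. Each of them has
  bounded energy when \<open>p \<le> DIM('a)\<close>, so the energy of the average is of order \<open>N powr (1 - p)\<close>.\<close>
definition multiscale_cutoff :: "nat \<Rightarrow> real \<Rightarrow> 'a::euclidean_space \<Rightarrow> real" where
  "multiscale_cutoff N e x = (\<Sum>j<N. cutoff ((1 / (4 ^ j * e)) *\<^sub>R x)) / real N"

lemma smooth_fun_multiscale_cutoff: "smooth_fun (multiscale_cutoff N e)"
  unfolding multiscale_cutoff_def[abs_def] divide_inverse
  by (intro smooth_fun_mult smooth_fun_sum smooth_fun_scale[OF smooth_fun_cutoff] smooth_fun_const)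

lemma multiscale_cutoff_bounds: "0 \<le> multiscale_cutoff N e x" "multiscale_cutoff N e x \<le> 1"
proof -
  show "0 \<le> multiscale_cutoff N e x"
    by (simp add: multiscale_cutoff_def sum_nonneg cutoff_bounds)
  have "(\<Sum>j<N. cutoff ((1 / (4 ^ j * e)) *\<^sub>R x)) \<le> (\<Sum>j<N. 1)"
    by (intro sum_mono cutoff_bounds)
  then show "multiscale_cutoff N e x \<le> 1"
    by (cases "N = 0") (simp_all add: multiscale_cutoff_def divide_le_eq_1)
qed

lemma multiscale_cutoff_eq_1:
  assumes "N > 0" "e > 0" "norm x \<le> e"
  shows "multiscale_cutoff N e x = 1"
proof -
  have "cutoff ((1 / (4 ^ j * e)) *\<^sub>R x) = 1" for j :: nat
  proof (rule cutoff_eq_1)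
    have "norm x \<le> 1 * e" using assms by simp
    also have "\<dots> \<le> 4 ^ j * e" using assms by (intro mult_right_mono) auto
    finally show "norm ((1 / (4 ^ j * e)) *\<^sub>R x) \<le> 1" using assms by (simp add: divide_le_eq_1)
  qed
  then show ?thesis using assms by (simp add: multiscale_cutoff_def)
qed

lemma multiscale_cutoff_eq_0:
  assumes "e > 0" "norm x \<ge> 2 * 4 ^ N * e"
  shows "multiscale_cutoff N e x = 0"
proof -
  have "cutoff ((1 / (4 ^ j * e)) *\<^sub>R x) = 0" if "j < N" for j :: nat
  proof (rule cutoff_eq_0)
    have "2 * (4 ^ j * e) \<le> 2 * (4 ^ N * e)"
      using that assms by (intro mult_left_mono mult_right_mono power_increasing) auto
    also have "\<dots> \<le> norm x" using assms by simp
    finally show "2 \<le> norm ((1 / (4 ^ j * e)) *\<^sub>R x)" using assms by (simp add: le_divide_eq)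
  qed
  then show ?thesis by (simp add: multiscale_cutoff_def)
qed

lemma test_grad_multiscale_cutoff:
  "test_grad (multiscale_cutoff N e) x
    = (\<Sum>j<N. (1 / (4 ^ j * e)) *\<^sub>R test_grad cutoff ((1 / (4 ^ j * e)) *\<^sub>R x)) /\<^sub>R real N"
proof (rule test_grad_eqI)
  let ?f = "\<lambda>j x. cutoff ((1 / (4 ^ j * e)) *\<^sub>R x)"
  have "(?f j has_derivative (\<lambda>v. test_grad (?f j) x \<bullet> v)) (at x)" for j :: nat
    by (rule smooth_fun_has_derivative_test_grad[OF smooth_fun_scale[OF smooth_fun_cutoff]])
  then have "(?f j has_derivative
      (\<lambda>v. ((1 / (4 ^ j * e)) *\<^sub>R test_grad cutoff ((1 / (4 ^ j * e)) *\<^sub>R x)) \<bullet> v)) (at x)" for j :: nat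
    unfolding test_grad_scale[OF smooth_fun_cutoff] .
  then have "((\<lambda>x. (\<Sum>j<N. ?f j x) * inverse (real N)) has_derivative
      (\<lambda>v. (\<Sum>j<N. ((1 / (4 ^ j * e)) *\<^sub>R test_grad cutoff ((1 / (4 ^ j * e)) *\<^sub>R x)) \<bullet> v) * inverse (real N))) (at x)"
    by (intro has_derivative_mult_left has_derivative_sum)
  then show "(multiscale_cutoff N e has_derivative
      (\<lambda>v. ((\<Sum>j<N. (1 / (4 ^ j * e)) *\<^sub>R test_grad cutoff ((1 / (4 ^ j * e)) *\<^sub>R x)) /\<^sub>R real N) \<bullet> v)) (at x)"
    unfolding multiscale_cutoff_def[abs_def] divide_inverse by (simp add: inner_sum_left mult.commute)
qed

text \<open>At each point at most one term of the gradient is nonzero, so the power of the sum is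
  the power of a single term and the averaging contributes the full factor N powr (- p). That term
  is then bounded by the sum over all scales, which is ready for integration.\<close>

lemma norm_test_grad_multiscale_cutoff_powr_le:
  fixes x :: "'a::euclidean_space"
  assumes "p > 1" "e > 0" "N > 0" and M: "M \<ge> 0" "\<And>y::'a. norm (test_grad cutoff y) \<le> M"
  shows "norm (test_grad (multiscale_cutoff N e) x) powr p
    \<le> real N powr (- p) * (\<Sum>j<N. (M / (4 ^ j * e)) powr p * indicator (cball 0 (2 * (4 ^ j * e))) x)"
proof -
  define g where "g j = (1 / (4 ^ j * e)) *\<^sub>R test_grad cutoff ((1 / (4 ^ j * e)) *\<^sub>R x)" for j :: nat
  have active: "4 ^ j * e \<le> norm x \<and> norm x \<le> 2 * (4 ^ j * e)" if "g j \<noteq> 0" for j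
  proof (rule ccontr)
    assume *: "\<not> ?thesis"
    have "norm ((1 / (4 ^ j * e)) *\<^sub>R x) = norm x / (4 ^ j * e)" using \<open>e > 0\<close> by simp
    moreover have "norm x / (4 ^ j * e) < 1 \<or> 2 < norm x / (4 ^ j * e)"
      using * \<open>e > 0\<close> by (auto simp: divide_less_eq less_divide_eq not_le)
    ultimately have "test_grad cutoff ((1 / (4 ^ j * e)) *\<^sub>R x) = 0"
      by (intro test_grad_cutoff_eq_0) metis
    then have "g j = 0" by (simp add: g_def)
    then show False using that by simp
  qed
  have rhs: "0 \<le> real N powr (- p) * (\<Sum>j<N. (M / (4 ^ j * e)) powr p * indicator (cball 0 (2 * (4 ^ j * e))) x)"
    by (intro mult_nonneg_nonneg sum_nonneg) auto
  show ?thesis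
  proof (cases "\<exists>j<N. g j \<noteq> 0")
    case False
    then have "test_grad (multiscale_cutoff N e) x = 0"
      by (simp add: test_grad_multiscale_cutoff g_def[symmetric])
    then show ?thesis using rhs by simp
  next
    case True
    then obtain j where j: "j < N" "g j \<noteq> 0" by blast
    have uniq: "g i = 0" if "i \<noteq> j" for i
    proof (rule ccontr)
      assume "g i \<noteq> 0"
      \<comment> \<open>Consecutive scales differ by the factor 4, more than the ratio 2 between the
        radii of one annulus; hence the annuli are disjoint.\<close>
      have False if "a < b" "g a \<noteq> 0" "g b \<noteq> 0" for a b :: nat
      proof -
        have "4 * (4 ^ a * e) = 4 ^ Suc a * e" by simp
        also have "\<dots> \<le> 4 ^ b * e"
          using that \<open>e > 0\<close> by (intro mult_right_mono power_increasing) auto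
        also have "\<dots> \<le> 2 * (4 ^ a * e)"
          using active[of a] active[of b] that by linarith
        finally show False using \<open>e > 0\<close> by simp
      qed
      from this[of i j] this[of j i] show False
        using that j(2) \<open>g i \<noteq> 0\<close> by linarith
    qed
    have "(\<Sum>i<N. g i) = g j"
      using j uniq by (subst sum.remove[of _ j]) auto
    then have "norm (test_grad (multiscale_cutoff N e) x) = norm (g j) / real N"
      unfolding test_grad_multiscale_cutoff g_def[symmetric] by (simp add: divide_inverse_commute)
    also have "\<dots> \<le> (M / (4 ^ j * e)) / real N"
      using M(2) \<open>e > 0\<close> by (intro divide_right_mono) (auto simp: g_def divide_right_mono)
    finally have "norm (test_grad (multiscale_cutoff N e) x) powr p \<le> ((M / (4 ^ j * e)) / real N) powr p"
      using \<open>p > 1\<close> by (intro powr_mono2) auto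
    also have "\<dots> = real N powr (- p) * ((M / (4 ^ j * e)) powr p * indicator (cball 0 (2 * (4 ^ j * e))) x)"
    proof -
      have "(a / real N) powr p = real N powr (- p) * a powr p" if "a \<ge> 0" for a
        using that by (simp add: powr_divide powr_minus_divide)
      moreover have "M / (4 ^ j * e) \<ge> 0" "x \<in> cball 0 (2 * (4 ^ j * e))"
        using active[OF j(2)] M(1) \<open>e > 0\<close> by auto
      ultimately show ?thesis by (metis indicator_simps(1) mult.right_neutral)
    qed
    also have "\<dots> \<le> real N powr (- p) * (\<Sum>j<N. (M / (4 ^ j * e)) powr p * indicator (cball 0 (2 * (4 ^ j * e))) x)"
      using j(1) by (intro mult_left_mono member_le_sum) auto
    finally show ?thesis .
  qed
qed

section \<open>Energy estimates for the averaged cutoffs\<close>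

context Lp_domain
begin

lemma in_Lp_multiscale_cutoff:
  "in_Lp p \<Omega> (multiscale_cutoff N e :: 'a \<Rightarrow> real)" "in_Lp p \<Omega> (test_grad (multiscale_cutoff N e) :: 'a \<Rightarrow> 'a)"
proof -
  show "in_Lp p \<Omega> (multiscale_cutoff N e :: 'a \<Rightarrow> real)"
    by (intro in_Lp_bounded[where B = 1] smooth_fun_lebesgue_measurable smooth_fun_multiscale_cutoff)
      (simp add: multiscale_cutoff_bounds)
  obtain M where M: "M \<ge> 0" "\<And>y::'a. norm (test_grad cutoff y) \<le> M"
    using test_grad_bounded[OF test_fun_cutoff] by metis
  have "norm (test_grad (multiscale_cutoff N e) x) \<le> (\<Sum>j<N. \<bar>1 / (4 ^ j * e)\<bar> * M) / real N" for x :: 'a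
  proof -
    have "norm (\<Sum>j<N. (1 / (4 ^ j * e)) *\<^sub>R test_grad cutoff ((1 / (4 ^ j * e)) *\<^sub>R x))
        \<le> (\<Sum>j<N. \<bar>1 / (4 ^ j * e)\<bar> * M)"
      unfolding norm_scaleR[symmetric]
      by (rule order_trans[OF norm_sum], rule sum_mono, subst norm_scaleR, rule mult_left_mono[OF M(2)]) simp
    from mult_left_mono[OF this, of "inverse (real N)"] show ?thesis
      unfolding test_grad_multiscale_cutoff norm_scaleR by (simp add: divide_inverse mult.commute)
  qed
  then show "in_Lp p \<Omega> (test_grad (multiscale_cutoff N e) :: 'a \<Rightarrow> 'a)"
    by (intro in_Lp_bounded test_grad_measurable smooth_fun_multiscale_cutoff)
qed

lemma Lp_int_multiscale_cutoff_le:
  assumes "e > 0"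
  shows "Lp_int p \<Omega> (multiscale_cutoff N e :: 'a \<Rightarrow> real) \<le> (2 * 4 ^ N * e) ^ DIM('a) * measure lebesgue (ball (0::'a) 1)"
proof -
  let ?R = "2 * 4 ^ N * e"
  have "Lp_int p \<Omega> (multiscale_cutoff N e :: 'a \<Rightarrow> real) \<le> (\<integral>x. indicator (ball (0::'a) ?R) x \<partial>lebesgue)"
    unfolding Lp_int_def
  proof (intro integral_mono in_Lp_integrable in_Lp_multiscale_cutoff)
    show "integrable lebesgue (indicator (ball (0::'a) ?R) :: 'a \<Rightarrow> real)"
      by (intro integrable_real_indicator) (use emeasure_lborel_ball_finite[of "0::'a" ?R] in auto)
    fix x :: 'a
    have "\<bar>multiscale_cutoff N e x\<bar> powr p \<le> 1"
      using multiscale_cutoff_bounds[of N e x] p_gt_1 by (intro powr_le1) auto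
    then show "indicator \<Omega> x * norm (multiscale_cutoff N e x) powr p \<le> indicator (ball 0 ?R) x"
      using multiscale_cutoff_eq_0[OF \<open>e > 0\<close>, of N x] by (auto simp: indicator_def)
  qed
  also have "\<dots> = ?R ^ DIM('a) * measure lebesgue (ball (0::'a) 1)"
    using content_ball_conv_unit_ball[of ?R "0::'a"] assms by simp
  finally show ?thesis .
qed

text \<open>The term at scale \<delta> contributes at most K times \<delta> powr (d - p), hence at
  most K, because \<delta> <= 1 and p <= d. N such terms with the prefactor N powr (- p) give the
  exponent 1 - p.\<close>

lemma Lp_int_test_grad_multiscale_cutoff_le:
  assumes "p \<le> real DIM('a)"
  obtains K where "K \<ge> 0" "\<And>N e. N > 0 \<Longrightarrow> e > 0 \<Longrightarrow> 4 ^ N * e \<le> 1 \<Longrightarrow>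
    Lp_int p \<Omega> (test_grad (multiscale_cutoff N e :: 'a \<Rightarrow> real)) \<le> K * real N powr (1 - p)"
proof -
  obtain M where M: "M \<ge> 0" "\<And>y::'a. norm (test_grad cutoff y) \<le> M"
    using test_grad_bounded[OF test_fun_cutoff] by metis
  define V where "V = measure lebesgue (ball (0::'a) 1)"
  define K where "K = M powr p * 2 ^ DIM('a) * V"
  have "K \<ge> 0" by (simp add: K_def V_def)
  moreover have "Lp_int p \<Omega> (test_grad (multiscale_cutoff N e :: 'a \<Rightarrow> real)) \<le> K * real N powr (1 - p)"
    if N: "N > 0" and e: "e > 0" "4 ^ N * e \<le> 1" for N :: nat and e :: real
  proof -
    define \<delta> where "\<delta> j = 4 ^ j * e" for j :: nat
    have \<delta>: "0 < \<delta> j" for j using e by (simp add: \<delta>_def)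
    have \<delta>1: "\<delta> j \<le> 1" if "j < N" for j
    proof -
      have "\<delta> j \<le> 4 ^ N * e" unfolding \<delta>_def
        using that e by (intro mult_right_mono power_increasing) auto
      then show ?thesis using e by linarith
    qed
    have ci: "integrable lebesgue (indicator (cball (0::'a) r) :: 'a \<Rightarrow> real)" for r
      by (intro integrable_real_indicator) (use emeasure_lborel_cball_finite[of "0::'a" r] in auto)
    have summand: "(M / \<delta> j) powr p * measure lebesgue (cball (0::'a) (2 * \<delta> j)) \<le> K" if "j < N" for j
    proof -
      have "measure lebesgue (cball (0::'a) (2 * \<delta> j)) = (2 * \<delta> j) ^ DIM('a) * V"
        using content_ball_conv_unit_ball[of "2 * \<delta> j" "0::'a"] \<delta>[of j] content_cball_conv_ball[of "0::'a" "2 * \<delta> j"]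
        by (simp add: V_def)
      also have "\<dots> = 2 ^ DIM('a) * \<delta> j powr real DIM('a) * V"
        using \<delta>[of j] by (simp add: power_mult_distrib powr_realpow)
      also have "\<dots> \<le> 2 ^ DIM('a) * \<delta> j powr p * V"
        using \<delta>[of j] \<delta>1[OF that] assms by (intro mult_right_mono mult_left_mono powr_mono') (auto simp: V_def)
      finally have "(M / \<delta> j) powr p * measure lebesgue (cball (0::'a) (2 * \<delta> j))
          \<le> (M / \<delta> j) powr p * (2 ^ DIM('a) * \<delta> j powr p * V)"
        by (intro mult_left_mono) auto
      also have "\<dots> = K"
        using \<delta>[of j] M(1) by (simp add: K_def powr_divide)
      finally show ?thesis .
    qed
    have "Lp_int p \<Omega> (test_grad (multiscale_cutoff N e :: 'a \<Rightarrow> real))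
      \<le> (\<integral>x. real N powr (- p) * (\<Sum>j<N. (M / \<delta> j) powr p * indicator (cball (0::'a) (2 * \<delta> j)) x) \<partial>lebesgue)"
      unfolding Lp_int_def
    proof (intro integral_mono in_Lp_integrable in_Lp_multiscale_cutoff integrable_mult_right
        Bochner_Integration.integrable_sum ci)
      fix x :: 'a
      have "norm (test_grad (multiscale_cutoff N e) x) powr p
          \<le> real N powr (- p) * (\<Sum>j<N. (M / \<delta> j) powr p * indicator (cball 0 (2 * \<delta> j)) x)"
        unfolding \<delta>_def by (rule norm_test_grad_multiscale_cutoff_powr_le[OF p_gt_1 e(1) N M])
      then show "indicator \<Omega> x * norm (test_grad (multiscale_cutoff N e) x) powr p
          \<le> real N powr (- p) * (\<Sum>j<N. (M / \<delta> j) powr p * indicator (cball 0 (2 * \<delta> j)) x)"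
        by (auto simp: indicator_def[of \<Omega>] intro!: mult_nonneg_nonneg sum_nonneg)
    qed
    also have "\<dots> = real N powr (- p) * (\<Sum>j<N. \<integral>x. (M / \<delta> j) powr p * indicator (cball (0::'a) (2 * \<delta> j)) x \<partial>lebesgue)"
      by (subst integral_mult_right_zero, subst Bochner_Integration.integral_sum) (intro integrable_mult_right ci refl)+
    also have "\<dots> = real N powr (- p) * (\<Sum>j<N. (M / \<delta> j) powr p * measure lebesgue (cball (0::'a) (2 * \<delta> j)))"
      by (subst integral_mult_right_zero) simp
    also have "\<dots> \<le> real N powr (- p) * (\<Sum>j<N. K)"
      using summand by (intro mult_left_mono sum_mono) auto
    also have "\<dots> = K * real N powr (1 - p)"
      using N by (simp add: powr_diff powr_minus divide_inverse)
    finally show ?thesis .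
  qed
  ultimately show thesis using that by blast
qed

end

subsection \<open>The recovery sequence\<close>

context Lp_domain
begin

lemma test_fun_diff: "test_fun \<Omega> \<phi> \<Longrightarrow> test_fun \<Omega> \<psi> \<Longrightarrow> test_fun \<Omega> (\<lambda>x. \<phi> x - \<psi> x)"
  using test_fun_add[of \<Omega> \<phi> "\<lambda>x. (-1) * \<psi> x"] test_fun_cmult[of \<Omega> \<psi> "-1"] by simp

lemma energy_test_fun: "test_fun \<Omega> \<phi> \<Longrightarrow> energy \<phi> = Lp_int p \<Omega> \<phi> + Lp_int p \<Omega> (test_grad \<phi>)"
  by (rule energy_eqI[OF test_fun_in_Lp test_grad_in_Lp weak_grad_test_fun])

text \<open>The product rule gives the gradient (m - \<phi>) grad \<eta> - \<eta> grad \<phi>, and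
  both \<phi> and its gradient are bounded. The constant depends on \<phi> and m only, so it can be
  fixed before the cutoff \<eta> is chosen.\<close>

lemma energy_cutoff_mult_le:
  assumes \<phi>: "test_fun \<Omega> \<phi>"
  obtains C where "C \<ge> 0" "\<And>\<eta>. test_fun \<Omega> \<eta> \<Longrightarrow>
    energy (\<lambda>x. \<eta> x * (m - \<phi> x)) \<le> C * (Lp_int p \<Omega> \<eta> + Lp_int p \<Omega> (test_grad \<eta>))"
proof -
  obtain B where B: "B \<ge> 0" "\<And>x. \<bar>\<phi> x\<bar> \<le> B" using test_fun_bounded[OF \<phi>] by metis
  obtain D where D: "D \<ge> 0" "\<And>x. norm (test_grad \<phi> x) \<le> D" using test_grad_bounded[OF \<phi>] by metis
  define A where "A = \<bar>m\<bar> + B"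
  have A: "A \<ge> 0" "\<bar>m - \<phi> x\<bar> \<le> A" for x
    using B(1) B(2)[of x] unfolding A_def by linarith+
  \<comment> \<open>The first summand estimates the function; the second estimates the two terms of
    the product rule, with the factor from \<open>Lp_int_add_le_double\<close>.\<close>
  define C where "C = A powr p + 2 powr p * (A powr p + D powr p)"
  have smooth: "smooth_fun (\<lambda>x. m - \<phi> x)"
    by (intro smooth_fun_diff smooth_fun_const test_fun_smooth[OF \<phi>])
  have "energy (\<lambda>x. \<eta> x * (m - \<phi> x)) \<le> C * (Lp_int p \<Omega> \<eta> + Lp_int p \<Omega> (test_grad \<eta>))"
    if \<eta>: "test_fun \<Omega> \<eta>" for \<eta>
  proof -
    let ?w = "\<lambda>x. \<eta> x * (m - \<phi> x)"
    have w: "test_fun \<Omega> ?w" by (rule test_fun_mult[OF \<eta> smooth])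
    have grad: "test_grad ?w x = (m - \<phi> x) *\<^sub>R test_grad \<eta> x + (- \<eta> x) *\<^sub>R test_grad \<phi> x" for x
    proof (rule test_grad_eqI)
      have "((\<lambda>x. m - \<phi> x) has_derivative (\<lambda>v. 0 - test_grad \<phi> x \<bullet> v)) (at x)"
        by (intro has_derivative_diff has_derivative_const smooth_fun_has_derivative_test_grad
            test_fun_smooth[OF \<phi>])
      from has_derivative_mult[OF smooth_fun_has_derivative_test_grad[OF test_fun_smooth[OF \<eta>]] this]
      show "(?w has_derivative (\<lambda>v. ((m - \<phi> x) *\<^sub>R test_grad \<eta> x + (- \<eta> x) *\<^sub>R test_grad \<phi> x) \<bullet> v)) (at x)"
        by (simp add: inner_add_left algebra_simps)
    qed
    have L1: "in_Lp p \<Omega> (\<lambda>x. A *\<^sub>R test_grad \<eta> x)" "in_Lp p \<Omega> (\<lambda>x. A *\<^sub>R \<eta> x)" "in_Lp p \<Omega> (\<lambda>x. D *\<^sub>R \<eta> x)"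
      by (intro in_Lp_scaleR test_grad_in_Lp test_fun_in_Lp \<eta>)+
    have m1: "(\<lambda>x. (m - \<phi> x) *\<^sub>R test_grad \<eta> x) \<in> borel_measurable lebesgue"
      by (intro borel_measurable_scaleR smooth_fun_lebesgue_measurable[OF smooth]
          test_grad_measurable test_fun_smooth[OF \<eta>])
    have m2: "(\<lambda>x. (- \<eta> x) *\<^sub>R test_grad \<phi> x) \<in> borel_measurable lebesgue"
      by (intro borel_measurable_scaleR borel_measurable_uminus smooth_fun_lebesgue_measurable
          test_grad_measurable test_fun_smooth[OF \<phi>] test_fun_smooth[OF \<eta>])
    obtain B' where B': "B' \<ge> 0" "\<And>x. \<bar>\<eta> x\<bar> \<le> B'" using test_fun_bounded[OF \<eta>] by metis
    obtain D' where D': "D' \<ge> 0" "\<And>x. norm (test_grad \<eta> x) \<le> D'" using test_grad_bounded[OF \<eta>] by metis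
    have in1: "in_Lp p \<Omega> (\<lambda>x. (m - \<phi> x) *\<^sub>R test_grad \<eta> x)"
      by (rule in_Lp_bounded[OF m1, of "A * D'"]) (use A D' in \<open>auto intro!: mult_mono\<close>)
    have in2: "in_Lp p \<Omega> (\<lambda>x. (- \<eta> x) *\<^sub>R test_grad \<phi> x)"
      by (rule in_Lp_bounded[OF m2, of "B' * D"]) (use B' D in \<open>auto intro!: mult_mono\<close>)
    have le1: "Lp_int p \<Omega> (\<lambda>x. (m - \<phi> x) *\<^sub>R test_grad \<eta> x) \<le> A powr p * Lp_int p \<Omega> (test_grad \<eta>)"
      using Lp_int_mono[OF in1 L1(1)] A by (simp add: Lp_int_scaleR mult_right_mono)
    have le2: "Lp_int p \<Omega> (\<lambda>x. (- \<eta> x) *\<^sub>R test_grad \<phi> x) \<le> D powr p * Lp_int p \<Omega> \<eta>"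
    proof -
      have "Lp_int p \<Omega> (\<lambda>x. (- \<eta> x) *\<^sub>R test_grad \<phi> x) \<le> Lp_int p \<Omega> (\<lambda>x. D *\<^sub>R \<eta> x)"
        by (rule Lp_int_mono[OF in2 L1(3)]) (use D in \<open>auto simp: abs_mult mult.commute[of D] intro!: mult_left_mono\<close>)
      then show ?thesis using D(1) unfolding Lp_int_scaleR by simp
    qed
    have le3: "Lp_int p \<Omega> ?w \<le> A powr p * Lp_int p \<Omega> \<eta>"
    proof -
      have "Lp_int p \<Omega> ?w \<le> Lp_int p \<Omega> (\<lambda>x. A *\<^sub>R \<eta> x)"
        by (rule Lp_int_mono[OF test_fun_in_Lp[OF w] L1(2)])
          (use A in \<open>auto simp: abs_mult mult.commute[of A] intro!: mult_left_mono\<close>)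
      then show ?thesis using A(1) unfolding Lp_int_scaleR by simp
    qed
    have "energy ?w \<le> A powr p * Lp_int p \<Omega> \<eta>
        + 2 powr p * (A powr p * Lp_int p \<Omega> (test_grad \<eta>) + D powr p * Lp_int p \<Omega> \<eta>)"
      unfolding energy_test_fun[OF w] grad[abs_def]
      by (intro add_mono le3 order_trans[OF Lp_int_add_le_double[OF in1 in2]] mult_left_mono le1 le2) auto
    also have "\<dots> \<le> C * (Lp_int p \<Omega> \<eta> + Lp_int p \<Omega> (test_grad \<eta>))"
    proof -
      have "0 \<le> A powr p * Lp_int p \<Omega> (test_grad \<eta>) + 2 powr p * (A powr p * Lp_int p \<Omega> \<eta> + D powr p * Lp_int p \<Omega> (test_grad \<eta>))"
        by (intro add_nonneg_nonneg mult_nonneg_nonneg Lp_int_nonneg) auto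
      then show ?thesis by (simp add: C_def algebra_simps)
    qed
    finally show ?thesis .
  qed
  moreover have "C \<ge> 0" by (simp add: C_def)
  ultimately show thesis using that by blast
qed

lemma test_fun_modify_near_0:
  assumes "0 \<in> \<Omega>" "p \<le> real DIM('a)" and \<phi>: "test_fun \<Omega> \<phi>" and "d > 0"
  shows "\<exists>e0>0. \<forall>e. 0 < e \<and> e < e0 \<longrightarrow>
    (\<exists>v. test_fun \<Omega> v \<and> (\<forall>x\<in>ball 0 e. v x = m) \<and> energy (\<lambda>x. v x - \<phi> x) < d)"
proof -
  obtain C where C: "C \<ge> 0" "\<And>\<eta>. test_fun \<Omega> \<eta> \<Longrightarrow>
      energy (\<lambda>x. \<eta> x * (m - \<phi> x)) \<le> C * (Lp_int p \<Omega> \<eta> + Lp_int p \<Omega> (test_grad \<eta>))"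
    using energy_cutoff_mult_le[OF \<phi>] by metis
  obtain K where K: "K \<ge> 0" "\<And>N e. N > 0 \<Longrightarrow> e > 0 \<Longrightarrow> 4 ^ N * e \<le> 1 \<Longrightarrow>
      Lp_int p \<Omega> (test_grad (multiscale_cutoff N e :: 'a \<Rightarrow> real)) \<le> K * real N powr (1 - p)"
    using Lp_int_test_grad_multiscale_cutoff_le[OF assms(2)] by metis
  define V where "V = measure lebesgue (ball (0::'a) 1)"
  obtain r where r: "r > 0" "cball 0 r \<subseteq> \<Omega>"
    using open_domain \<open>0 \<in> \<Omega>\<close> open_contains_cball by blast
  have "((\<lambda>N. C * (K * real N powr (1 - p))) \<longlongrightarrow> C * (K * 0)) sequentially"
    using p_gt_1 by (intro tendsto_intros tendsto_neg_powr filterlim_real_sequentially) auto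
  then have "\<forall>\<^sub>F N in sequentially. C * (K * real N powr (1 - p)) < d / 2"
    using \<open>d > 0\<close> by (intro order_tendstoD) auto
  then have "\<forall>\<^sub>F N in sequentially. C * (K * real N powr (1 - p)) < d / 2 \<and> N > 0"
    by (intro eventually_conj eventually_gt_at_top)
  then obtain N where N: "C * (K * real N powr (1 - p)) < d / 2" "N > 0"
    by (auto simp: eventually_sequentially)
  have t1: "((\<lambda>e. C * ((2 * 4 ^ N * e) ^ DIM('a) * V)) \<longlongrightarrow> C * ((2 * 4 ^ N * 0) ^ DIM('a) * V)) (at_right 0)"
    by (intro tendsto_intros)
  have t2: "((\<lambda>e. 2 * 4 ^ N * e) \<longlongrightarrow> 2 * 4 ^ N * 0) (at_right (0::real))"
    by (intro tendsto_intros)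
  \<comment> \<open>With N fixed, the first condition makes the p-integral of the cutoff small; the
    second keeps its support in \<open>cball 0 r\<close> and ensures that all scales are at most
    1.\<close>
  have "\<forall>\<^sub>F e in at_right 0. C * ((2 * 4 ^ N * e) ^ DIM('a) * V) < d / 2 \<and> 2 * 4 ^ N * e < min 1 r"
    using \<open>d > 0\<close> r(1) by (intro eventually_conj order_tendstoD(2)[OF t1] order_tendstoD(2)[OF t2])
      (auto simp: power_0_left)
  then obtain e0 where e0: "e0 > 0" "\<And>e. 0 < e \<Longrightarrow> e < e0 \<Longrightarrow>
      C * ((2 * 4 ^ N * e) ^ DIM('a) * V) < d / 2 \<and> 2 * 4 ^ N * e < min 1 r"
    unfolding eventually_at_right_field by auto
  have "\<exists>v. test_fun \<Omega> v \<and> (\<forall>x\<in>ball 0 e. v x = m) \<and> energy (\<lambda>x. v x - \<phi> x) < d"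
    if e: "0 < e" "e < e0" for e
  proof -
    let ?\<eta> = "multiscale_cutoff N e :: 'a \<Rightarrow> real"
    have R: "2 * 4 ^ N * e < r" "4 ^ N * e \<le> 1" and small: "C * ((2 * 4 ^ N * e) ^ DIM('a) * V) < d / 2"
      using e0(2)[OF e] e by auto
    have \<eta>: "test_fun \<Omega> ?\<eta>"
    proof (rule test_funI[OF smooth_fun_multiscale_cutoff, of "cball 0 r"])
      show "?\<eta> x = 0" if "x \<notin> cball 0 r" for x
        using that R(1) by (intro multiscale_cutoff_eq_0 e) auto
    qed (use r in auto)
    define v where "v x = \<phi> x + ?\<eta> x * (m - \<phi> x)" for x
    have "test_fun \<Omega> v"
      unfolding v_def
      by (intro test_fun_add \<phi> test_fun_mult \<eta> smooth_fun_diff smooth_fun_const test_fun_smooth[OF \<phi>])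
    moreover have "\<forall>x\<in>ball 0 e. v x = m"
      by (simp add: v_def multiscale_cutoff_eq_1[OF N(2) e(1)])
    moreover have "energy (\<lambda>x. v x - \<phi> x) < d"
    proof -
      have "energy (\<lambda>x. v x - \<phi> x) \<le> C * (Lp_int p \<Omega> ?\<eta> + Lp_int p \<Omega> (test_grad ?\<eta>))"
        using C(2)[OF \<eta>] by (simp add: v_def)
      also have "\<dots> \<le> C * ((2 * 4 ^ N * e) ^ DIM('a) * V + K * real N powr (1 - p))"
        unfolding V_def
        by (intro mult_left_mono add_mono Lp_int_multiscale_cutoff_le K(2) N e R C)
      also have "\<dots> < d" using small N(1) by (simp add: distrib_left)
      finally show ?thesis .
    qed
    ultimately show ?thesis by blast
  qed
  then show ?thesis using e0(1) by blast
qed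

lemma W1p0_modify_near_0:
  assumes "0 \<in> \<Omega>" "p \<le> real DIM('a)" and u: "u \<in> W1p0 p \<Omega>" and "d > 0"
  shows "\<exists>e0>0. \<forall>e. 0 < e \<and> e < e0 \<longrightarrow>
    (\<exists>v. test_fun \<Omega> v \<and> (\<forall>x\<in>ball 0 e. v x = m) \<and> energy (\<lambda>x. v x - u x) < d)"
proof -
  \<comment> \<open>Two errors below d' are added with the constant \<open>2 powr p\<close>, and the
    result is to stay below d.\<close>
  define d' where "d' = d / (2 * 2 powr p)"
  have d': "d' > 0" using \<open>d > 0\<close> by (simp add: d'_def)
  obtain \<Phi> where \<Phi>: "\<And>n. test_fun \<Omega> (\<Phi> n)" "(\<lambda>n. energy (\<lambda>x. \<Phi> n x - u x)) \<longlonglongrightarrow> 0"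
    using W1p0_approx[OF u] by blast
  have "\<forall>\<^sub>F n in sequentially. energy (\<lambda>x. \<Phi> n x - u x) < d'"
    using \<Phi>(2) d' by (rule order_tendstoD)
  then obtain \<phi> where \<phi>: "test_fun \<Omega> \<phi>" "energy (\<lambda>x. \<phi> x - u x) < d'"
    using \<Phi>(1) by (auto simp: eventually_sequentially)
  obtain e0 where e0: "e0 > 0" "\<And>e. 0 < e \<Longrightarrow> e < e0 \<Longrightarrow>
      \<exists>v. test_fun \<Omega> v \<and> (\<forall>x\<in>ball 0 e. v x = m) \<and> energy (\<lambda>x. v x - \<phi> x) < d'"
    using test_fun_modify_near_0[OF assms(1,2) \<phi>(1) d'] by metis
  have "energy (\<lambda>x. v x - u x) < d" if v: "test_fun \<Omega> v" "energy (\<lambda>x. v x - \<phi> x) < d'" for v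
  proof -
    have "W1p p \<Omega> (\<lambda>x. v x - \<phi> x)"
      by (rule test_fun_W1p[OF test_fun_diff[OF v(1) \<phi>(1)]])
    moreover have "W1p p \<Omega> (\<lambda>x. \<phi> x - u x)"
      using W1p_lincomb(1)[OF test_fun_W1p[OF \<phi>(1)] W1p0_W1p[OF u], of 1 "-1"] by simp
    ultimately have "energy (\<lambda>x. v x - u x) \<le> 2 powr p * (energy (\<lambda>x. v x - \<phi> x) + energy (\<lambda>x. \<phi> x - u x))"
      using energy_lincomb_le[of "\<lambda>x. v x - \<phi> x" "\<lambda>x. \<phi> x - u x" 1 1] by simp
    also have "\<dots> < 2 powr p * (d' + d')"
      using v(2) \<phi>(2) by (intro mult_strict_left_mono add_strict_mono) auto
    also have "\<dots> = d" by (simp add: d'_def)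
    finally show ?thesis .
  qed
  then show ?thesis using e0 by blast
qed

lemma F_eps_eq_if_const_on_ball:
  assumes v: "W1p p \<Omega> v" and "e > 0" and const: "\<forall>x\<in>ball 0 e. v x = m"
  shows "F_eps p \<Omega> e v = ennreal (Lp_int p \<Omega> (\<lambda>x. v x - m) + Lp_int p \<Omega> (wgrad p \<Omega> v))"
proof -
  let ?B = "ball (0::'a) e"
  note vm[measurable] = in_Lp_measurable[OF W1p_in_Lp[OF v]]
  have Bfin: "emeasure lebesgue ?B = ennreal (measure lebesgue ?B)"
    using emeasure_lborel_ball_finite[of "0::'a" e] by (simp add: emeasure_eq_ennreal_measure less_top)
  have Bpos: "measure lebesgue ?B > 0" using \<open>e > 0\<close> by simp
  have inner: "(\<integral>\<^sup>+ y. ennreal (\<bar>v x - v y\<bar> powr p) * indicator ?B y \<partial>lebesgue)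
      = ennreal (\<bar>v x - m\<bar> powr p) * emeasure lebesgue ?B" for x
  proof -
    have "(\<integral>\<^sup>+ y. ennreal (\<bar>v x - v y\<bar> powr p) * indicator ?B y \<partial>lebesgue)
        = (\<integral>\<^sup>+ y. ennreal (\<bar>v x - m\<bar> powr p) * indicator ?B y \<partial>lebesgue)"
      using const by (intro nn_integral_cong) (auto simp: indicator_def)
    then show ?thesis by (simp add: nn_integral_cmult_indicator)
  qed
  have "(\<integral>\<^sup>+ x. ennreal (\<bar>v x - m\<bar> powr p) * emeasure lebesgue ?B * indicator \<Omega> x \<partial>lebesgue)
      = (\<integral>\<^sup>+ x. ennreal (\<bar>v x - m\<bar> powr p) * indicator \<Omega> x * emeasure lebesgue ?B \<partial>lebesgue)"
    by (intro nn_integral_cong) (simp add: ac_simps)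
  also have "\<dots> = (\<integral>\<^sup>+ x. ennreal (\<bar>v x - m\<bar> powr p) * indicator \<Omega> x \<partial>lebesgue) * emeasure lebesgue ?B"
    by (intro nn_integral_multc) measurable
  also have "\<dots> = ennreal (Lp_int p \<Omega> (\<lambda>x. v x - m)) * ennreal (measure lebesgue ?B)"
    using nn_integral_eq_Lp_int[OF in_Lp_diff[OF W1p_in_Lp[OF v] in_Lp_const], of m] Bfin by simp
  finally have "ennreal (1 / measure lebesgue ?B) *
      (\<integral>\<^sup>+ x. (\<integral>\<^sup>+ y. ennreal (\<bar>v x - v y\<bar> powr p) * indicator ?B y \<partial>lebesgue) * indicator \<Omega> x \<partial>lebesgue)
      = ennreal (1 / measure lebesgue ?B) * (ennreal (Lp_int p \<Omega> (\<lambda>x. v x - m)) * ennreal (measure lebesgue ?B))"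
    unfolding inner by simp
  also have "\<dots> = ennreal (Lp_int p \<Omega> (\<lambda>x. v x - m))"
  proof -
    have "ennreal (1 / b) * (ennreal a * ennreal b) = ennreal a" if "a \<ge> 0" "b > 0" for a b :: real
      using that by (simp add: ennreal_mult[symmetric])
    then show ?thesis using Bpos Lp_int_nonneg by blast
  qed
  finally show ?thesis
    unfolding F_eps_def nn_integral_eq_Lp_int[OF wgrad_weak_grad(1)[OF v]]
    by (simp add: Lp_int_nonneg)
qed

text \<open>The members of the sequence are u plus a perturbation of vanishing energy. For fixed l
  the convexity estimate loses the factor (1 - l) powr (1 - p) on the limit value, and the
  perturbation disappears as k grows; only afterwards does l tend to 0.\<close>

lemma limsup_inequality:
  assumes u: "u \<in> W1p0 p \<Omega>" and us: "\<And>k. us k \<in> W1p0 p \<Omega>"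
    and lim: "(\<lambda>k. energy (\<lambda>x. us k x - u x)) \<longlonglongrightarrow> 0"
    and "\<And>k. \<epsilon> k > 0" and const: "\<forall>\<^sub>F k in sequentially. \<forall>x\<in>ball 0 (\<epsilon> k). us k x = m_p p \<Omega> u"
  shows "limsup (\<lambda>k. F_eps p \<Omega> (\<epsilon> k) (us k)) \<le> F_lim p \<Omega> u"
proof -
  define m where "m = m_p p \<Omega> u"
  define A where "A = Lp_int p \<Omega> (\<lambda>x. u x - m) + Lp_int p \<Omega> (wgrad p \<Omega> u)"
  note u' = W1p_in_Lp[OF W1p0_W1p[OF u]] wgrad_weak_grad(1)[OF W1p0_W1p[OF u]]
  have bound: "limsup (\<lambda>k. F_eps p \<Omega> (\<epsilon> k) (us k)) \<le> ennreal ((1 - l) powr (1 - p) * A)"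
    if l: "0 < l" "l < 1" for l
  proof -
    let ?b = "\<lambda>k. (1 - l) powr (1 - p) * A + l powr (1 - p) * energy (\<lambda>x. us k x - u x)"
    have "F_eps p \<Omega> (\<epsilon> k) (us k) \<le> ennreal (?b k)" if c: "\<forall>x\<in>ball 0 (\<epsilon> k). us k x = m" for k
    proof -
      note k = W1p_in_Lp[OF W1p0_W1p[OF us[of k]]] wgrad_weak_grad(1)[OF W1p0_W1p[OF us[of k]]]
      have dW: "W1p p \<Omega> (\<lambda>x. us k x - u x)"
        using W1p_lincomb(1)[OF W1p0_W1p[OF us[of k]] W1p0_W1p[OF u], of 1 "-1"] by simp
      note d = W1p_in_Lp[OF dW] wgrad_weak_grad(1)[OF dW]
      have "Lp_int p \<Omega> (\<lambda>x. us k x - m) = Lp_int p \<Omega> (\<lambda>x. (u x - m) + (us k x - u x))"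
        by simp
      also have "\<dots> \<le> (1 - l) powr (1 - p) * Lp_int p \<Omega> (\<lambda>x. u x - m) + l powr (1 - p) * Lp_int p \<Omega> (\<lambda>x. us k x - u x)"
        by (intro Lp_int_add_le in_Lp_diff u' in_Lp_const k l)
      finally have 1: "Lp_int p \<Omega> (\<lambda>x. us k x - m)
          \<le> (1 - l) powr (1 - p) * Lp_int p \<Omega> (\<lambda>x. u x - m) + l powr (1 - p) * Lp_int p \<Omega> (\<lambda>x. us k x - u x)" .
      have "Lp_int p \<Omega> (wgrad p \<Omega> (us k)) = Lp_int p \<Omega> (\<lambda>x. wgrad p \<Omega> u x + wgrad p \<Omega> (\<lambda>x. us k x - u x) x)"
        using W1p_lincomb(2)[OF W1p0_W1p[OF u] dW, of 1 1]
        by (intro Lp_int_cong_AE k in_Lp_add u' d) simp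
      also have "\<dots> \<le> (1 - l) powr (1 - p) * Lp_int p \<Omega> (wgrad p \<Omega> u)
          + l powr (1 - p) * Lp_int p \<Omega> (wgrad p \<Omega> (\<lambda>x. us k x - u x))"
        by (intro Lp_int_add_le u' d l)
      finally have "Lp_int p \<Omega> (\<lambda>x. us k x - m) + Lp_int p \<Omega> (wgrad p \<Omega> (us k)) \<le> ?b k"
        using 1 by (simp add: A_def energy_def algebra_simps)
      then show ?thesis
        unfolding F_eps_eq_if_const_on_ball[OF W1p0_W1p[OF us] assms(4) c] by (rule ennreal_leI)
    qed
    then have "\<forall>\<^sub>F k in sequentially. F_eps p \<Omega> (\<epsilon> k) (us k) \<le> ennreal (?b k)"
      using const by (auto elim!: eventually_mono simp: m_def)
    then have "limsup (\<lambda>k. F_eps p \<Omega> (\<epsilon> k) (us k)) \<le> limsup (\<lambda>k. ennreal (?b k))"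
      by (rule Limsup_mono)
    also have "?b \<longlonglongrightarrow> (1 - l) powr (1 - p) * A + l powr (1 - p) * 0"
      by (intro tendsto_intros lim)
    then have "(\<lambda>k. ennreal (?b k)) \<longlonglongrightarrow> ennreal ((1 - l) powr (1 - p) * A)"
      by (intro tendsto_ennrealI) simp
    then have "limsup (\<lambda>k. ennreal (?b k)) = ennreal ((1 - l) powr (1 - p) * A)"
      by (simp add: lim_imp_Limsup)
    finally show ?thesis .
  qed
  have "((\<lambda>l. ennreal ((1 - l) powr (1 - p) * A)) \<longlongrightarrow> ennreal ((1 - 0) powr (1 - p) * A)) (at_right 0)"
    by (intro tendsto_ennrealI tendsto_intros) auto
  then have "limsup (\<lambda>k. F_eps p \<Omega> (\<epsilon> k) (us k)) \<le> ennreal ((1 - 0) powr (1 - p) * A)"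
  proof (rule tendsto_lowerbound)
    show "\<forall>\<^sub>F l in at_right 0. limsup (\<lambda>k. F_eps p \<Omega> (\<epsilon> k) (us k)) \<le> ennreal ((1 - l) powr (1 - p) * A)"
      unfolding eventually_at_right_field using bound by (intro exI[of _ 1]) auto
  qed simp
  then show ?thesis by (simp add: F_lim_eq[OF W1p0_W1p[OF u]] A_def m_def)
qed

text \<open>A diagonal argument without extraction of indices: for every accuracy d, admissible
  functions within d of u exist for all large k, so nearly optimal ones among the admissible
  functions converge to u.\<close>

lemma recovery_sequence:
  assumes "0 \<in> \<Omega>" "p \<le> real DIM('a)" and u: "u \<in> W1p0 p \<Omega>"
    and \<epsilon>: "\<And>k. \<epsilon> k > 0" "\<epsilon> \<longlonglongrightarrow> 0"
  shows "\<exists>us. (\<forall>k. us k \<in> W1p0 p \<Omega>) \<and> weak_conv_W1p0 p \<Omega> us u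
    \<and> limsup (\<lambda>k. F_eps p \<Omega> (\<epsilon> k) (us k)) \<le> F_lim p \<Omega> u"
proof -
  define m where "m = m_p p \<Omega> u"
  define S where "S k = {v. test_fun \<Omega> v \<and> (\<forall>x\<in>ball 0 (\<epsilon> k). v x = m)}" for k
  define dist_u where "dist_u v = energy (\<lambda>x. v x - u x)" for v
  have ev: "\<forall>\<^sub>F k in sequentially. \<exists>v\<in>S k. dist_u v < d" if d: "d > 0" for d
  proof -
    obtain e0 where e0: "e0 > 0" "\<And>e. 0 < e \<Longrightarrow> e < e0 \<Longrightarrow>
        \<exists>v. test_fun \<Omega> v \<and> (\<forall>x\<in>ball 0 e. v x = m) \<and> energy (\<lambda>x. v x - u x) < d"
      using W1p0_modify_near_0[OF assms(1,2) u d] by metis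
    have "\<forall>\<^sub>F k in sequentially. \<epsilon> k < e0" using \<epsilon>(2) e0(1) by (rule order_tendstoD)
    then show ?thesis
      by eventually_elim (use e0(2) \<epsilon>(1) in \<open>auto simp: S_def dist_u_def\<close>)
  qed
  define i where "i k = Inf (dist_u ` S k)" for k
  \<comment> \<open>The infimum need not be attained, hence the slack 1 / (k + 1). For small k the
    set \<open>S k\<close> can be empty, for instance if the ball leaves the domain and m is
    nonzero; then u itself is a harmless value.\<close>
  define us where "us k = (if S k = {} then u else SOME v. v \<in> S k \<and> dist_u v < i k + 1 / (real k + 1))" for k
  have bdd: "bdd_below (dist_u ` S k)" for k
    by (rule bdd_belowI[of _ 0]) (auto simp: dist_u_def energy_nonneg)
  have us: "us k \<in> S k \<and> dist_u (us k) < i k + 1 / (real k + 1)" if "S k \<noteq> {}" for k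
  proof -
    have "\<exists>v. v \<in> S k \<and> dist_u v < i k + 1 / (real k + 1)"
      using that cInf_lessD[of "dist_u ` S k" "i k + 1 / (real k + 1)"] by (auto simp: i_def)
    from someI_ex[OF this] show ?thesis using that by (simp add: us_def)
  qed
  have W: "us k \<in> W1p0 p \<Omega>" for k
  proof (cases "S k = {}")
    case True
    then show ?thesis using u by (simp add: us_def)
  next
    case False
    then have "us k \<in> S k" using us by blast
    then show ?thesis by (simp add: S_def test_fun_W1p0)
  qed
  have lim: "(\<lambda>k. energy (\<lambda>x. us k x - u x)) \<longlonglongrightarrow> 0"
  proof (rule order_tendstoI)
    fix a :: real assume "a < 0"
    then show "\<forall>\<^sub>F k in sequentially. a < energy (\<lambda>x. us k x - u x)"
      by (intro always_eventually allI less_le_trans[OF _ energy_nonneg])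
  next
    fix a :: real assume a: "0 < a"
    have "\<forall>\<^sub>F k in sequentially. 1 / (real k + 1) < a / 2"
      using a LIMSEQ_inverse_real_of_nat
      by (intro order_tendstoD(2)) (auto simp: inverse_eq_divide add.commute)
    with ev[of "a / 2"] a have "\<forall>\<^sub>F k in sequentially. (\<exists>v\<in>S k. dist_u v < a / 2) \<and> 1 / (real k + 1) < a / 2"
      by (intro eventually_conj) auto
    then show "\<forall>\<^sub>F k in sequentially. energy (\<lambda>x. us k x - u x) < a"
    proof eventually_elim
      case (elim k)
      then obtain v where v: "v \<in> S k" "dist_u v < a / 2" by blast
      then have "i k < a / 2" using cInf_lower[OF _ bdd, of "dist_u v" k] by (force simp: i_def)
      moreover have "dist_u (us k) < i k + 1 / (real k + 1)" using us[of k] v(1) by blast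
      ultimately show ?case using elim by (simp add: dist_u_def)
    qed
  qed
  have const: "\<forall>\<^sub>F k in sequentially. \<forall>x\<in>ball 0 (\<epsilon> k). us k x = m_p p \<Omega> u"
    using ev[of 1, OF zero_less_one] by eventually_elim (use us in \<open>auto simp: S_def m_def\<close>)
  show ?thesis
    using W weak_conv_if_energy_tendsto_0[OF W u lim] limsup_inequality[OF u W lim \<epsilon>(1) const]
    by blast
qed

end

theorem theorem3p3:
  fixes \<Omega> :: "'a::euclidean_space set" and p :: real and \<epsilon> :: "nat \<Rightarrow> real"
  assumes "open \<Omega>" and "connected \<Omega>" and "bounded \<Omega>" and "0 \<in> \<Omega>"
    and "1 < p" and "p \<le> real DIM('a)"
    and "\<And>k. \<epsilon> k > 0" and "\<epsilon> \<longlonglongrightarrow> 0"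
  shows "Gamma_conv (W1p0 p \<Omega>) (weak_conv_W1p0 p \<Omega>)
           (\<lambda>k u. F_eps p \<Omega> (\<epsilon> k) u) (F_lim p \<Omega>)"
proof -
  interpret Lp_domain \<Omega> p
    using assms by unfold_locales auto
  have "\<Omega> \<noteq> {}" using assms(4) by blast
  then show ?thesis
    unfolding Gamma_conv_def
    by (intro conjI ballI allI impI liminf_inequality recovery_sequence) (use assms in auto)
qed

end
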